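(* Let $d=d_n$ be positive integers with $d=o(\sqrt n)$, and for each $n$ let $\mathbf X=\mathbf X^{(n)}=(X_1,\dots,X_n)$ be an exchangeable and unconditional random vector in $\mathbb R^n$. Let $p=\binom nd$, let $m=m(p)\in\mathbb N$ with $p/m\to c$ for some fixed $c>0$, and let $K=\frac1m\sum_{k=1}^m\mathbf x^{(k)}(\mathbf x^{(k)})^{\mathrm T}$ where $\mathbf x^{(1)},\dots,\mathbf x^{(m)}$ are i.i.d. with law $\mathrm{PrincipalT}(n,d,\mathbf X)$. Suppose (i) $\mathbb E X_1^2=1$, (ii) $\frac1{n^{4d}}\mathbb E\|\mathbf X\|_2^{8d}\to1$, and (iii) there exists a sequence $L=L_n$ satisfying $Ld^2/n\to0$ such that $\mathbb E(X_1^8\cdots X_r^8)\le L^{2r}$ for all $1\le r\le d$. Then there is a sequence $L'=L'_n$ with $L'd^2/n\to0$ such that (A) $\mathbb E(X_1^2\cdots X_d^2)\to 1$; (B) $\mathbb E(X_1^2\cdots X_{2d}^2)-\bigl(\mathbb E(X_1^2\cdots X_d^2)\bigr)^2\to0$; (C) for all $n$ large enough and for all $1\le r\le d$, $\ \mathbb E(X_1^4\cdots X_r^4X_{r+1}^2\cdots X_{2d-r}^2)\le (L')^r$; and, with probability $1$, $\mathrm{ESD}(K)$ converges weakly to $\mu_{\mathrm{MP}(c)}$. Moreover, the same conclusions hold if (iii) is replaced by (iii') there exists a sequence $L=L_n$ satisfying $Ld^2/n\to0$ such that $\frac1{n^{2r}}\mathbb E\|\mathbf X\|_4^{8r}\le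 L^{2r}$ for all $1\le r\le d$.
   Context: All limits are as $n\to\infty$, and all samples, for all $n$, live on a common probability space. $\|\mathbf x\|_k$ denotes the $\ell^k$ norm of a vector. $\mathbf X$ is exchangeable if $(X_1,\dots,X_n)$ has the same law as $(X_{\sigma(1)},\dots,X_{\sigma(n)})$ for every permutation $\sigma$ of $[n]=\{1,\dots,n\}$; it is unconditional if $(X_1,\dots,X_n)$ has the same law as $(\varepsilon_1X_1,\dots,\varepsilon_nX_n)$ where $\varepsilon_i$ are independent Rademacher signs independent of $\mathbf X$. $\mathrm{PrincipalT}(n,d,\mathbf X)$ is the law of the random vector $\bigl(\prod_{\alpha\in i}X_\alpha\bigr)_{i}\in\mathbb R^p$, $p=\binom nd$, whose coordinates are indexed by the subsets $i\subseteq[n]$ of size $d$. For a real symmetric $p\times p$ matrix $K$ with eigenvalues $\lambda_1\ge\dots\ge\lambda_p$, $\mathrm{ESD}(K)=\frac1p\sum_{j=1}^p\delta_{\lambda_j}$. For $c>0$ the standard Marchenko–Pastur law is $$\mu_{\mathrm{MP}(c)}=\bigl(1-\tfrac1c\bigr)^+\delta_0+\frac{\sqrt{(b-x)(x-a)}}{2\pi c x}\mathbf 1_{[a,b]}(x)\,dx,\quad a=(1-\sqrt c)^2,\ b=(1+\sqrt c)^2.$$ *)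

theory Defs
  imports "HOL-Probability.Probability" "Jordan_Normal_Form.Char_Poly"
begin

text \<open>A random vector in R^n on a probability space \<open>N\<close> is given by its coordinates
  \<open>X i\<close>, \<open>i \<in> {1..n}\<close>; its law lives on the product space \<open>Pi\<^sub>M {1..n} (\<lambda>_. borel)\<close>.
  The values of \<open>X i\<close> for other \<open>i\<close> carry no information.\<close>

definition random_vector :: "'b measure \<Rightarrow> nat \<Rightarrow> (nat \<Rightarrow> 'b \<Rightarrow> real) \<Rightarrow> bool" where
  "random_vector N n X \<longleftrightarrow> prob_space N \<and> (\<forall>i\<in>{1..n}. X i \<in> borel_measurable N)"

definition exchangeable :: "'b measure \<Rightarrow> nat \<Rightarrow> (nat \<Rightarrow> 'b \<Rightarrow> real) \<Rightarrow> bool" where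
  "exchangeable N n X \<longleftrightarrow>
     (\<forall>\<sigma>. \<sigma> permutes {1..n} \<longrightarrow>
        distr N (Pi\<^sub>M {1..n} (\<lambda>_. borel)) (\<lambda>\<omega>. \<lambda>i\<in>{1..n}. X i \<omega>) =
        distr N (Pi\<^sub>M {1..n} (\<lambda>_. borel)) (\<lambda>\<omega>. \<lambda>i\<in>{1..n}. X (\<sigma> i) \<omega>))"

definition rademacher :: "real measure" where
  "rademacher = measure_pmf (pmf_of_set {- 1, 1})"

text \<open>The signs are the coordinates of the second factor of a product space, hence independent
  of each other and of \<open>X\<close>.\<close>

definition unconditional :: "'b measure \<Rightarrow> nat \<Rightarrow> (nat \<Rightarrow> 'b \<Rightarrow> real) \<Rightarrow> bool" where
  "unconditional N n X \<longleftrightarrow>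
     distr N (Pi\<^sub>M {1..n} (\<lambda>_. borel)) (\<lambda>\<omega>. \<lambda>i\<in>{1..n}. X i \<omega>) =
     distr (N \<Otimes>\<^sub>M Pi\<^sub>M {1..n} (\<lambda>_. rademacher)) (Pi\<^sub>M {1..n} (\<lambda>_. borel))
       (\<lambda>(\<omega>, \<epsilon>). \<lambda>i\<in>{1..n}. \<epsilon> i * X i \<omega>)"

definition lnorm :: "nat \<Rightarrow> nat \<Rightarrow> (nat \<Rightarrow> real) \<Rightarrow> real" where
  "lnorm k n x = root k (\<Sum>i=1..n. \<bar>x i\<bar> ^ k)"

definition dsubsets :: "nat \<Rightarrow> nat \<Rightarrow> nat set set" where
  "dsubsets n d = {i. i \<subseteq> {1..n} \<and> card i = d}"

text \<open>R^p with coordinates indexed by the \<open>d\<close>-subsets of \<open>[n]\<close>.\<close>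

abbreviation tensor_space :: "nat \<Rightarrow> nat \<Rightarrow> (nat set \<Rightarrow> real) measure" where
  "tensor_space n d \<equiv> Pi\<^sub>M (dsubsets n d) (\<lambda>_. borel)"

definition PrincipalT ::
    "'b measure \<Rightarrow> nat \<Rightarrow> nat \<Rightarrow> (nat \<Rightarrow> 'b \<Rightarrow> real) \<Rightarrow> (nat set \<Rightarrow> real) measure" where
  "PrincipalT N n d X =
     distr N (tensor_space n d) (\<lambda>\<omega>. \<lambda>i\<in>dsubsets n d. \<Prod>\<alpha>\<in>i. X \<alpha> \<omega>)"

text \<open>An enumeration of the \<open>d\<close>-subsets, used only to write a matrix indexed by them as one with
  numerical indices; its choice does not affect the spectrum.\<close>

definition dsubsets_list :: "nat \<Rightarrow> nat \<Rightarrow> nat set list" where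
  "dsubsets_list n d = map set (filter (\<lambda>l. length l = d) (List.subseqs [1..<Suc n]))"

lemma set_dsubsets_list: "set (dsubsets_list n d) = dsubsets n d"
proof -
  define xs where "xs = [1..<Suc n]"
  have xs: "distinct xs" "set xs = {1..n}" by (auto simp: xs_def)
  have card: "card (set l) = length l" if "l \<in> set (List.subseqs xs)" for l
    using subseqs_distinctD[OF that xs(1)] by (rule distinct_card)
  have "set (dsubsets_list n d) = {i \<in> set ` set (List.subseqs xs). card i = d}"
    unfolding dsubsets_list_def xs_def[symmetric] using card by auto
  then show ?thesis
    by (auto simp: subseqs_powset xs dsubsets_def)
qed

lemma distinct_dsubsets_list: "distinct (dsubsets_list n d)"
proof -
  define xs where "xs = [1..<Suc n]"
  have "distinct (map set (List.subseqs xs))"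
    by (rule distinct_set_subseqs) (simp add: xs_def)
  then show ?thesis
    unfolding dsubsets_list_def xs_def[symmetric] by (rule distinct_map_filter)
qed

lemma length_dsubsets_list: "length (dsubsets_list n d) = n choose d"
  using distinct_card[OF distinct_dsubsets_list[of n d]] n_subsets[of "{1..n}" d]
  by (simp add: set_dsubsets_list dsubsets_def)

text \<open>\<open>(1/m) \<Sum>\<^sub>k x\<^sup>(\<^sup>k\<^sup>) (x\<^sup>(\<^sup>k\<^sup>))\<^sup>T\<close> for vectors indexed by the \<open>d\<close>-subsets of \<open>[n]\<close>.\<close>

definition sample_cov :: "nat \<Rightarrow> nat \<Rightarrow> nat \<Rightarrow> (nat \<Rightarrow> nat set \<Rightarrow> real) \<Rightarrow> real mat" where
  "sample_cov n d m x =
     Matrix.mat (n choose d) (n choose d)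
       (\<lambda>(a, b). 1 / real m *
          (\<Sum>k=1..m. x k (dsubsets_list n d ! a) * x k (dsubsets_list n d ! b)))"

text \<open>The real eigenvalues in decreasing order, counted with algebraic multiplicity.  For a
  symmetric matrix these are all the eigenvalues, so the list has length \<open>dim_row K\<close>.\<close>

definition real_eigenvalues :: "real mat \<Rightarrow> real list" where
  "real_eigenvalues K = rev (sorted_list_of_multiset (proots (char_poly K)))"

definition ESD :: "real mat \<Rightarrow> real measure" where
  "ESD K = distr (uniform_count_measure {..<dim_row K}) borel (\<lambda>j. real_eigenvalues K ! j)"

definition MP_density :: "real \<Rightarrow> real \<Rightarrow> real" where
  "MP_density c x =
     (let a = (1 - sqrt c)\<^sup>2; b = (1 + sqrt c)\<^sup>2
      in sqrt ((b - x) * (x - a)) / (2 * pi * c * x) * indicator {a..b} x)"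

definition MP_law :: "real \<Rightarrow> real measure" where
  "MP_law c = measure_of UNIV (sets borel)
     (\<lambda>A. ennreal (max 0 (1 - 1 / c)) * emeasure (return borel 0) A
          + emeasure (density lborel (\<lambda>x. ennreal (MP_density c x))) A)"

lemma sets_MP_law [simp]: "sets (MP_law c) = sets borel"
  unfolding MP_law_def using sets.sigma_sets_eq[of "borel :: real measure"] by simp

lemma emeasure_MP_law:
  assumes "A \<in> sets borel"
  shows "emeasure (MP_law c) A =
    ennreal (max 0 (1 - 1 / c)) * indicator A 0
      + (\<integral>\<^sup>+x\<in>A. ennreal (MP_density c x) \<partial>lborel)"
proof -
  let ?\<mu> = "\<lambda>A. ennreal (max 0 (1 - 1 / c)) * emeasure (return borel (0::real)) A
          + emeasure (density lborel (\<lambda>x. ennreal (MP_density c x))) A"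
  have meas: "(\<lambda>x. ennreal (MP_density c x)) \<in> borel_measurable lborel"
    unfolding MP_density_def Let_def by measurable
  have "emeasure (MP_law c) A = ?\<mu> A"
  proof (rule emeasure_measure_of[OF MP_law_def])
    show "sets borel \<subseteq> Pow (UNIV :: real set)" by simp
    show "positive (sets (MP_law c)) ?\<mu>" by (simp add: positive_def)
    show "countably_additive (sets (MP_law c)) ?\<mu>"
    proof (rule countably_additiveI)
      fix B :: "nat \<Rightarrow> real set"
      assume B: "range B \<subseteq> sets (MP_law c)" "disjoint_family B"
      have 1: "(\<Sum>i. emeasure (return borel (0::real)) (B i)) = emeasure (return borel 0) (\<Union>i. B i)"
        using B by (intro suminf_emeasure) auto
      have 2: "(\<Sum>i. emeasure (density lborel (\<lambda>x. ennreal (MP_density c x))) (B i))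
        = emeasure (density lborel (\<lambda>x. ennreal (MP_density c x))) (\<Union>i. B i)"
        using B by (intro suminf_emeasure) auto
      show "(\<Sum>i. ?\<mu> (B i)) = ?\<mu> (\<Union>i. B i)"
        by (simp add: suminf_add[symmetric] 1 2)
    qed
    show "A \<in> sets (MP_law c)" using assms by simp
  qed
  then show ?thesis
    using assms meas by (simp add: emeasure_density)
qed

end

theory Submission
  imports Defs
begin

text \<open>Let \<open>s = (1/p) tr (K + t)\<^sup>-\<^sup>1\<close> for real \<open>t > 0\<close>.  The Sherman--Morrison formula expresses
  \<open>1 - t s\<close> through the quadratic forms of the samples with respect to the resolvents omitting them.
  If these forms are close to the traces in quadratic mean, \<open>s\<close> nearly solves
  \<open>t s + s / (1 + c s) = 1\<close>, whose left-hand side increases in \<open>s\<close> with slope at least \<open>t\<close>; hence the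
  mean of \<open>s\<close> is close to the root, the Stieltjes transform of the Marchenko--Pastur law at \<open>-t\<close>.
  Replacing one sample moves \<open>s\<close> by at most \<open>1 / (t p)\<close>, so McDiarmid's inequality and
  Borel--Cantelli give almost sure convergence, and countably many \<open>t\<close> determine the weak limit.

  Since the coordinates \<open>x\<^sub>i\<close> are unconditional, \<open>E (x\<^sub>i x\<^sub>j x\<^sub>k x\<^sub>l)\<close> vanishes unless
  \<open>i \<triangle> j = k \<triangle> l\<close>, and by exchangeability sums of such moments are bounded by falling factorials times
  \<open>E \<parallel>X\<parallel>\<^sub>2\<^sup>4\<^sup>d\<close>; with (A) and (B) this controls the quadratic forms.  Jensen's inequality gives
  \<open>E \<parallel>X\<parallel>\<^sub>2\<^sup>2\<^sup>k / n\<^sup>k \<longlongrightarrow> 1\<close> for \<open>k \<le> 2d\<close>, and terms with repeated indices in the expansion of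
  \<open>\<parallel>X\<parallel>\<^sub>2\<^sup>2\<^sup>k\<close> are negligible by the bound on \<open>\<parallel>X\<parallel>\<^sub>4\<close>, which yields (A) and (B).\<close>

section \<open>Resolvents of Gram matrices\<close>

text \<open>Since \<open>d\<close> may grow, no factor exponential in \<open>d\<close> is affordable
  in the variance of a quadratic form. Off the diagonal, a pair with \<open>|i - j| = s\<close>
  carries \<open>4 ^ s\<close>, but together with about \<open>(d / n) ^ s\<close>, so a row of the
  covariance kernel sums to \<open>p\<close> times a multiple of \<open>d / n\<close>. On the
  diagonal, overlapping pairs have no bound of their own: their total is a second moment, at most
  \<open>E ||X||_2^{4d} / d!^2\<close>, minus what the disjoint pairs contribute exactly, and these
  cancel to leading order. The \<open>8 d\<close>-th moment of the norm is what Cauchy--Schwarz asks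
  for when \<open>T S^{k-2}\<close> with \<open>k <= 2 d\<close> is split. Taking \<open>t\<close>
  real and positive makes every Sherman--Morrison denominator at least 1 and confines
  \<open>s\<close> to \<open>[0, 1 / t]\<close>. A resolvent defined by recursion on the samples is
  an explicit rational function of them: measurability and the removal of one sample are immediate,
  at the price of proving that the order of the list is immaterial.\<close>

definition dot :: "'i set \<Rightarrow> ('i \<Rightarrow> real) \<Rightarrow> ('i \<Rightarrow> real) \<Rightarrow> real" where
  "dot I u v = (\<Sum>i\<in>I. u i * v i)"

definition app :: "'i set \<Rightarrow> ('i \<Rightarrow> 'i \<Rightarrow> real) \<Rightarrow> ('i \<Rightarrow> real) \<Rightarrow> 'i \<Rightarrow> real" where
  "app I A v i = (\<Sum>j\<in>I. A i j * v j)"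

definition quad :: "'i set \<Rightarrow> ('i \<Rightarrow> 'i \<Rightarrow> real) \<Rightarrow> ('i \<Rightarrow> real) \<Rightarrow> real" where
  "quad I A v = dot I v (app I A v)"

definition trace_on :: "'i set \<Rightarrow> ('i \<Rightarrow> 'i \<Rightarrow> real) \<Rightarrow> real" where
  "trace_on I A = (\<Sum>i\<in>I. A i i)"

text \<open>The inverse of \<open>t + w \<Sum> x x\<^sup>T\<close>, the sum ranging over a list of vectors, built up by the
  Sherman--Morrison formula.\<close>

primrec resolvent ::
    "'i set \<Rightarrow> real \<Rightarrow> real \<Rightarrow> ('i \<Rightarrow> real) list \<Rightarrow> 'i \<Rightarrow> 'i \<Rightarrow> real" where
  "resolvent I w t [] = (\<lambda>i j. if i = j then 1 / t else 0)"
| "resolvent I w t (x # xs) = (\<lambda>i j. resolvent I w t xs i j -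
     w * app I (resolvent I w t xs) x i * app I (resolvent I w t xs) x j
       / (1 + w * quad I (resolvent I w t xs) x))"

lemma sum_list_sum_swap:
  "(\<Sum>i\<in>I. \<Sum>x\<leftarrow>xs. f i x) = (\<Sum>x\<leftarrow>xs. \<Sum>i\<in>I. f i x :: real)"
  by (induction xs) (simp_all add: sum.distrib)

lemma dot_self_nonneg: "dot I v v \<ge> 0"
  by (auto simp: dot_def intro!: sum_nonneg)

lemma dot_app_commute:
  assumes "\<And>i j. A i j = A j i"
  shows "dot I u (app I A v) = dot I v (app I A u)"
proof -
  have "dot I u (app I A v) = (\<Sum>i\<in>I. \<Sum>j\<in>I. u i * (A i j * v j))"
    by (simp add: dot_def app_def sum_distrib_left)
  also have "\<dots> = (\<Sum>j\<in>I. \<Sum>i\<in>I. u i * (A i j * v j))"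
    by (rule sum.swap)
  also have "\<dots> = dot I v (app I A u)"
  proof -
    have "u i * (A i j * v j) = v j * (A j i * u i)" for i j
      using assms[of i j] by simp
    then show ?thesis by (simp only: dot_def app_def sum_distrib_left)
  qed
  finally show ?thesis .
qed

lemma resolvent_sym: "resolvent I w t xs i j = resolvent I w t xs j i"
  by (induction xs arbitrary: i j) (auto simp: mult_ac)

locale resolvent_setting =
  fixes I :: "'i set" and w t :: real
  assumes fin: "finite I" and w_nonneg: "w \<ge> 0" and t_pos: "t > 0"
begin

abbreviation G :: "('i \<Rightarrow> real) list \<Rightarrow> 'i \<Rightarrow> 'i \<Rightarrow> real" where
  "G \<equiv> resolvent I w t"

text \<open>By symmetry of \<open>G\<close>, \<open>app I (G xs) x\<close> is also the row vector
  \<open>x^T G\<close>, so this is \<open>(t + w \<Sum> x x^T) G = 1\<close> on \<open>I\<close>. It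
  is a predicate because the induction that proves it uses the positivity it implies for the shorter
  list.\<close>

definition is_inv :: "('i \<Rightarrow> real) list \<Rightarrow> bool" where
  "is_inv xs \<longleftrightarrow> (\<forall>i\<in>I. \<forall>k\<in>I.
     t * G xs i k + w * (\<Sum>x\<leftarrow>xs. x i * app I (G xs) x k) = (if i = k then 1 else 0))"

lemma app_unit: "k \<in> I \<Longrightarrow> app I A (\<lambda>j. if j = k then 1 else 0) i = A i k"
  using fin by (simp add: app_def if_distrib cong: if_cong)

lemma is_inv_app:
  assumes inv: "is_inv xs" and i: "i \<in> I"
  shows "t * app I (G xs) v i + w * (\<Sum>x\<leftarrow>xs. x i * dot I x (app I (G xs) v)) = v i"
proof -
  have "v i = (\<Sum>k\<in>I. (if i = k then 1 else 0) * v k)"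
    using fin i by (simp add: if_distrib if_distribR cong: if_cong)
  also have "\<dots> = (\<Sum>k\<in>I. (t * G xs i k + w * (\<Sum>x\<leftarrow>xs. x i * app I (G xs) x k)) * v k)"
    using inv i by (intro sum.cong) (auto simp: is_inv_def)
  also have "\<dots> = t * app I (G xs) v i
      + w * (\<Sum>k\<in>I. \<Sum>x\<leftarrow>xs. x i * app I (G xs) x k * v k)"
  proof -
    have "t * app I (G xs) v i = (\<Sum>k\<in>I. t * G xs i k * v k)"
      by (simp add: app_def sum_distrib_left mult.assoc)
    moreover have "w * (\<Sum>k\<in>I. \<Sum>x\<leftarrow>xs. x i * app I (G xs) x k * v k)
        = (\<Sum>k\<in>I. w * (\<Sum>x\<leftarrow>xs. x i * app I (G xs) x k) * v k)"
      by (simp add: sum_distrib_left mult.assoc flip: sum_list_mult_const)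
    ultimately show ?thesis by (simp add: distrib_right sum.distrib)
  qed
  also have "(\<Sum>k\<in>I. \<Sum>x\<leftarrow>xs. x i * app I (G xs) x k * v k)
      = (\<Sum>x\<leftarrow>xs. \<Sum>k\<in>I. x i * app I (G xs) x k * v k)"
    by (rule sum_list_sum_swap)
  also have "\<dots> = (\<Sum>x\<leftarrow>xs. x i * dot I v (app I (G xs) x))"
    by (simp add: dot_def sum_distrib_left mult_ac)
  finally show ?thesis
    by (simp add: dot_app_commute[OF resolvent_sym, of _ v])
qed

text \<open>With \<open>g = G v\<close> and \<open>v = (t + w \<Sum> x x^T) g\<close> this is
  \<open>v^T g\<close> expanded: positivity without any spectral theory.\<close>

lemma is_inv_quad:
  assumes "is_inv xs"
  shows "quad I (G xs) v = t * dot I (app I (G xs) v) (app I (G xs) v)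
    + w * (\<Sum>x\<leftarrow>xs. (dot I x (app I (G xs) v))\<^sup>2)"
proof -
  let ?g = "app I (G xs) v"
  have "quad I (G xs) v
      = (\<Sum>i\<in>I. (t * ?g i + w * (\<Sum>x\<leftarrow>xs. x i * dot I x ?g)) * ?g i)"
    unfolding quad_def dot_def[of _ v] using is_inv_app[OF assms] by (intro sum.cong) auto
  also have "\<dots> = t * dot I ?g ?g + w * (\<Sum>i\<in>I. \<Sum>x\<leftarrow>xs. x i * dot I x ?g * ?g i)"
  proof -
    have "t * dot I ?g ?g = (\<Sum>i\<in>I. t * ?g i * ?g i)"
      by (simp add: dot_def sum_distrib_left mult.assoc)
    moreover have "w * (\<Sum>i\<in>I. \<Sum>x\<leftarrow>xs. x i * dot I x ?g * ?g i)
        = (\<Sum>i\<in>I. w * (\<Sum>x\<leftarrow>xs. x i * dot I x ?g) * ?g i)"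
      by (simp add: sum_distrib_left mult.assoc flip: sum_list_mult_const)
    ultimately show ?thesis by (simp add: distrib_right sum.distrib)
  qed
  also have "(\<Sum>i\<in>I. \<Sum>x\<leftarrow>xs. x i * dot I x ?g * ?g i)
      = (\<Sum>x\<leftarrow>xs. \<Sum>i\<in>I. x i * dot I x ?g * ?g i)"
    by (rule sum_list_sum_swap)
  also have "\<dots> = (\<Sum>x\<leftarrow>xs. dot I x ?g * dot I x ?g)"
    by (simp add: dot_def sum_distrib_left sum_distrib_right mult_ac)
  finally show ?thesis by (simp add: power2_eq_square)
qed

lemma is_inv_quad_ge: "is_inv xs \<Longrightarrow> quad I (G xs) v \<ge> t * dot I (app I (G xs) v) (app I (G xs) v)"
  using w_nonneg by (auto simp: is_inv_quad intro!: mult_nonneg_nonneg sum_list_nonneg)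

lemma is_inv_quad_nonneg: "is_inv xs \<Longrightarrow> quad I (G xs) v \<ge> 0"
  using is_inv_quad_ge[of xs v] t_pos dot_self_nonneg[of I "app I (G xs) v"]
  by (smt (verit) mult_nonneg_nonneg)

lemma app_Cons:
  "app I (G (x # xs)) y k = app I (G xs) y k
     - w * app I (G xs) x k * dot I x (app I (G xs) y) / (1 + w * quad I (G xs) x)"
proof -
  have "dot I x (app I (G xs) y) = dot I y (app I (G xs) x)"
    by (rule dot_app_commute[OF resolvent_sym])
  moreover have "app I (G (x # xs)) y k = (\<Sum>j\<in>I. G xs k j * y j
      - w * app I (G xs) x k * (y j * app I (G xs) x j) / (1 + w * quad I (G xs) x))"
    unfolding app_def[of I "G (x # xs)" y]
    by (intro sum.cong refl) (simp add: algebra_simps)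
  ultimately show ?thesis
    by (simp add: sum_subtractf app_def[of I "G xs" y] dot_def[of I y] sum_distrib_left
        flip: sum_divide_distrib)
qed

text \<open>The Sherman--Morrison formula is valid once its denominator is nonzero. The induction
  hypothesis makes \<open>quad I (G xs) x\<close> nonnegative, so the denominator is at least
  1.\<close>

lemma is_inv: "is_inv xs"
proof (induction xs)
  case Nil
  then show ?case using t_pos by (simp add: is_inv_def)
next
  case (Cons x xs)
  define D where "D = 1 + w * quad I (G xs) x"
  define g where "g = app I (G xs) x"
  have D: "D > 0"
    using is_inv_quad_nonneg[OF Cons, of x] w_nonneg by (simp add: D_def add_pos_nonneg)
  show ?case unfolding is_inv_def
  proof (intro ballI)
    fix i k assume ik: "i \<in> I" "k \<in> I"
    define S where "S = (\<Sum>y\<leftarrow>xs. y i * dot I y g)"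
    define R where "R = (\<Sum>y\<leftarrow>xs. y i * app I (G xs) y k)"
    have 1: "t * g i + w * S = x i"
      using is_inv_app[OF Cons ik(1), of x] by (simp add: g_def S_def)
    have 2: "t * G xs i k + w * R = (if i = k then 1 else 0)"
      using Cons ik by (simp add: is_inv_def R_def)
    have a: "app I (G (x # xs)) y k = app I (G xs) y k - w * g k * dot I y g / D" for y
      unfolding app_Cons g_def D_def by (simp add: dot_app_commute[OF resolvent_sym, of _ x])
    have q: "dot I x g = quad I (G xs) x" by (simp add: quad_def g_def)
    have Ssum: "(\<Sum>y\<leftarrow>xs. y i * app I (G (x # xs)) y k) = R - w * g k * S / D"
    proof -
      have "(\<Sum>y\<leftarrow>xs. y i * app I (G (x # xs)) y k)
          = (\<Sum>y\<leftarrow>xs. y i * app I (G xs) y k - w * g k / D * (y i * dot I y g))"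
        unfolding a by (intro arg_cong[of _ _ sum_list] map_cong) (auto simp: field_simps)
      then show ?thesis
        unfolding R_def S_def
        by (simp only: sum_list_subtractf sum_list_const_mult) simp
    qed
    have "t * G (x # xs) i k + w * (\<Sum>y\<leftarrow>x # xs. y i * app I (G (x # xs)) y k)
      = t * (G xs i k - w * g i * g k / D)
        + w * (x i * (g k - w * g k * quad I (G xs) x / D) + (R - w * g k * S / D))"
    proof -
      have "G (x # xs) i k = G xs i k - w * g i * g k / D"
        by (simp add: g_def D_def)
      then show ?thesis by (simp add: a[of x] q g_def[symmetric] Ssum del: resolvent.simps)
    qed
    \<comment> \<open>The terms are regrouped so that the two equations for the shorter list apply:
      2 gives the unit matrix, and 1 turns the rest into multiples of \<open>x i\<close> that
      cancel.\<close>
    also have "\<dots> = (t * G xs i k + w * R) - w * g k * (t * g i + w * S) / D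
        + w * x i * g k * (1 - w * quad I (G xs) x / D)"
      by (simp add: algebra_simps add_divide_distrib)
    also have "1 - w * quad I (G xs) x / D = 1 / D"
      using D by (simp add: field_simps) (simp add: D_def)
    also have "(t * G xs i k + w * R) - w * g k * (t * g i + w * S) / D + w * x i * g k * (1 / D)
        = (if i = k then 1 else 0)"
      unfolding 1 2 by simp
    finally show "t * G (x # xs) i k + w * (\<Sum>y\<leftarrow>x # xs. y i * app I (G (x # xs)) y k)
        = (if i = k then 1 else 0)" .
  qed
qed

lemma quad_nonneg: "quad I (G xs) v \<ge> 0"
  by (rule is_inv_quad_nonneg[OF is_inv])

lemma denom_pos: "1 + w * quad I (G xs) x > 0"
  using quad_nonneg w_nonneg by (simp add: add_pos_nonneg)

text \<open>\<open>G_xs = G_xs (t + w \<Sum> y y^T) G_ys\<close>, the middle factor being the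
  inverse of the last; a device for comparing two lists.\<close>

lemma resolvent_expand:
  assumes "i \<in> I" "k \<in> I"
  shows "G xs i k = t * (\<Sum>l\<in>I. G xs i l * G ys l k)
    + w * (\<Sum>y\<leftarrow>ys. app I (G xs) y i * app I (G ys) y k)"
proof -
  have "G xs i k = (\<Sum>l\<in>I. G xs i l * (if l = k then 1 else 0))"
    using fin assms by (simp add: if_distrib cong: if_cong)
  also have "\<dots> = (\<Sum>l\<in>I. G xs i l * (t * G ys l k + w * (\<Sum>y\<leftarrow>ys. y l * app I (G ys) y k)))"
    using is_inv[of ys] assms by (intro sum.cong) (auto simp: is_inv_def)
  also have "\<dots> = t * (\<Sum>l\<in>I. G xs i l * G ys l k)
      + w * (\<Sum>l\<in>I. G xs i l * (\<Sum>y\<leftarrow>ys. y l * app I (G ys) y k))"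
    by (simp add: algebra_simps sum.distrib sum_distrib_left)
  also have "(\<Sum>l\<in>I. G xs i l * (\<Sum>y\<leftarrow>ys. y l * app I (G ys) y k))
      = (\<Sum>y\<leftarrow>ys. app I (G xs) y i * app I (G ys) y k)"
    unfolding sum_list_const_mult[symmetric] sum_list_sum_swap
    by (simp add: app_def[of I "G xs"] sum_distrib_right mult.assoc)
  finally show ?thesis .
qed

text \<open>The recursion depends on the order of the list, the inverted matrix does not. If both
  lists have the same entries, the expansion of \<open>G xs\<close> through \<open>G ys\<close> is,
  transposed, that of \<open>G ys\<close> through \<open>G xs\<close>: uniqueness of the inverse.
  Any sample can thus be moved to the head and removed.\<close>

lemma resolvent_mset_cong:
  assumes "mset xs = mset ys" "i \<in> I" "k \<in> I"
  shows "G xs i k = G ys i k"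
proof -
  have "G xs i k = t * (\<Sum>l\<in>I. G xs i l * G ys l k)
      + w * (\<Sum>y\<leftarrow>ys. app I (G xs) y i * app I (G ys) y k)"
    by (rule resolvent_expand) fact+
  also have "(\<Sum>y\<leftarrow>ys. app I (G xs) y i * app I (G ys) y k)
      = (\<Sum>y\<leftarrow>xs. app I (G ys) y k * app I (G xs) y i)"
    using assms(1) by (subst (1 2) sum_mset_sum_list[symmetric]) (simp add: mult.commute)
  also have "(\<Sum>l\<in>I. G xs i l * G ys l k) = (\<Sum>l\<in>I. G ys k l * G xs l i)"
    by (intro sum.cong refl) (metis resolvent_sym mult.commute)
  also have "t * \<dots> + w * (\<Sum>y\<leftarrow>xs. app I (G ys) y k * app I (G xs) y i) = G ys k i"
    by (rule resolvent_expand[symmetric]) fact+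
  finally show ?thesis by (metis resolvent_sym)
qed

lemma trace_mset_cong: "mset xs = mset ys \<Longrightarrow> trace_on I (G xs) = trace_on I (G ys)"
  unfolding trace_on_def by (intro sum.cong resolvent_mset_cong) auto

lemma quad_mset_cong: "mset xs = mset ys \<Longrightarrow> quad I (G xs) v = quad I (G ys) v"
  unfolding quad_def dot_def app_def
  by (intro sum.cong arg_cong2[of _ _ _ _ times] resolvent_mset_cong refl) auto

text \<open>At the unit vector \<open>e_i\<close> the quadratic form is \<open>G i i\<close>, and
  \<open>is_inv_quad_ge\<close> bounds it below by \<open>t\<close> times the squared norm of the
  column \<open>G e_i\<close>.\<close>

lemma diag_nonneg: "i \<in> I \<Longrightarrow> G xs i i \<ge> 0"
  and row_norm_le: "i \<in> I \<Longrightarrow> (\<Sum>j\<in>I. (G xs i j)\<^sup>2) \<le> G xs i i / t"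
proof -
  assume i: "i \<in> I"
  let ?e = "\<lambda>j. if j = i then 1 else (0::real)"
  have q: "quad I (G xs) ?e = G xs i i"
    using fin i by (simp add: quad_def dot_def app_unit if_distrib if_distribR cong: if_cong)
  then show "G xs i i \<ge> 0" using quad_nonneg by metis
  have "dot I (app I (G xs) ?e) (app I (G xs) ?e) = (\<Sum>j\<in>I. (G xs i j)\<^sup>2)"
    unfolding dot_def app_unit[OF i] power2_eq_square
    by (intro sum.cong refl) (metis resolvent_sym)
  with is_inv_quad_ge[OF is_inv, of xs ?e] q have "t * (\<Sum>j\<in>I. (G xs i j)\<^sup>2) \<le> G xs i i" by simp
  then show "(\<Sum>j\<in>I. (G xs i j)\<^sup>2) \<le> G xs i i / t" using t_pos by (simp add: field_simps)
qed

text \<open>The diagonal entry is part of its own row, so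
  \<open>(G i i)^2 <= G i i / t\<close>.\<close>

lemma diag_le: assumes i: "i \<in> I" shows "G xs i i \<le> 1 / t"
proof -
  have "(G xs i i)\<^sup>2 \<le> (\<Sum>j\<in>I. (G xs i j)\<^sup>2)"
    using fin i by (intro member_le_sum) auto
  with row_norm_le[OF i] have "G xs i i * G xs i i \<le> (1 / t) * G xs i i"
    by (simp add: power2_eq_square) (meson order_trans)
  then have "G xs i i \<noteq> 0 \<Longrightarrow> G xs i i \<le> 1 / t"
    using diag_nonneg[OF i, of xs] mult_right_le_imp_le[of "G xs i i" "G xs i i" "1 / t"]
    by (simp add: order_less_le)
  then show ?thesis using t_pos by force
qed

lemma row_norm_le':
  assumes i: "i \<in> I"
  shows "(\<Sum>j\<in>I. (G xs i j)\<^sup>2) \<le> (1 / t)\<^sup>2"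
proof -
  have "G xs i i / t \<le> (1 / t) / t"
    using diag_le[OF i] t_pos by (intro divide_right_mono) auto
  with row_norm_le[OF i, of xs] show ?thesis by (simp add: power2_eq_square)
qed

lemma trace_nonneg: "trace_on I (G xs) \<ge> 0"
  by (auto simp: trace_on_def intro!: sum_nonneg diag_nonneg)

lemma trace_le: "trace_on I (G xs) \<le> card I / t"
  using sum_mono[of I "\<lambda>i. G xs i i" "\<lambda>_. 1 / t"] by (simp add: trace_on_def diag_le)

text \<open>The trace drops by \<open>w |g|^2 / (1 + w q)\<close> with \<open>g = G x\<close> and
  \<open>q = x^T G x\<close>. Since \<open>t |g|^2 <= q\<close>, the drop is at most
  \<open>1 / t\<close> however large \<open>x\<close> is; the bounded differences rest on this
  uniformity.\<close>

lemma trace_Cons: "trace_on I (G (x # xs)) \<le> trace_on I (G xs)"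
  "trace_on I (G xs) \<le> trace_on I (G (x # xs)) + 1 / t"
proof -
  let ?g = "app I (G xs) x" and ?D = "1 + w * quad I (G xs) x"
  have eq: "trace_on I (G xs) - trace_on I (G (x # xs)) = w * dot I ?g ?g / ?D"
    by (simp add: trace_on_def dot_def sum_subtractf sum_distrib_left sum_divide_distrib mult_ac)
  have "w * dot I ?g ?g / ?D \<ge> 0"
    by (intro divide_nonneg_pos mult_nonneg_nonneg w_nonneg dot_self_nonneg denom_pos)
  with eq show "trace_on I (G (x # xs)) \<le> trace_on I (G xs)" by simp
  have "t * (w * dot I ?g ?g) \<le> w * quad I (G xs) x"
    using mult_left_mono[OF is_inv_quad_ge[OF is_inv, of xs x] w_nonneg] by (simp add: mult_ac)
  also have "\<dots> \<le> ?D" by simp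
  finally have "w * dot I ?g ?g / ?D \<le> 1 / t"
    using t_pos denom_pos[of xs x] by (simp add: field_simps)
  with eq show "trace_on I (G xs) \<le> trace_on I (G (x # xs)) + 1 / t" by simp
qed

text \<open>Trades the resolvent containing \<open>x\<close>, which depends on it, for the one
  without it.\<close>

lemma quad_Cons: "quad I (G (x # xs)) x = quad I (G xs) x / (1 + w * quad I (G xs) x)"
proof -
  define q where "q = quad I (G xs) x"
  have D: "1 + w * q > 0" using denom_pos by (simp add: q_def)
  have "quad I (G (x # xs)) x = q - w * q * q / (1 + w * q)"
    unfolding quad_def[of I "G (x # xs)"] dot_def app_Cons
    by (simp add: right_diff_distrib sum_subtractf)
      (simp add: quad_def dot_def q_def sum_distrib_left sum_distrib_right sum_divide_distrib mult_ac)
  also have "\<dots> = q / (1 + w * q)" using D by (simp add: field_simps)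
  finally show ?thesis by (simp add: q_def)
qed

text \<open>The trace of \<open>(t + w \<Sum> x x^T) G = 1\<close>.\<close>

lemma trace_identity: "t * trace_on I (G xs) + w * (\<Sum>x\<leftarrow>xs. quad I (G xs) x) = card I"
proof -
  have "real (card I) = (\<Sum>i\<in>I. t * G xs i i + w * (\<Sum>x\<leftarrow>xs. x i * app I (G xs) x i))"
    using is_inv[of xs] by (simp add: is_inv_def)
  also have "\<dots> = t * trace_on I (G xs) + w * (\<Sum>i\<in>I. \<Sum>x\<leftarrow>xs. x i * app I (G xs) x i)"
    by (simp add: trace_on_def sum.distrib sum_distrib_left)
  also have "(\<Sum>i\<in>I. \<Sum>x\<leftarrow>xs. x i * app I (G xs) x i) = (\<Sum>x\<leftarrow>xs. \<Sum>i\<in>I. x i * app I (G xs) x i)"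
    by (rule sum_list_sum_swap)
  also have "\<dots> = (\<Sum>x\<leftarrow>xs. quad I (G xs) x)"
    by (simp add: quad_def dot_def)
  finally show ?thesis by simp
qed

end

text \<open>With \<open>q k = w * quad I (H k) (y k)\<close>, \<open>trace_identity\<close> and
  \<open>quad_Cons\<close> give exactly \<open>t s + (1/p) \<Sum> q k / (1 + q k) = 1\<close>.
  Replacing every \<open>q k\<close> by \<open>w\<close> times the trace of the full resolvent,
  which is \<open>(p/m) s\<close>, costs at most the difference, because \<open>a / (1 + a)\<close>
  is 1-Lipschitz on the nonnegative reals.\<close>

lemma self_consistent_error:
  fixes y :: "nat \<Rightarrow> 'i \<Rightarrow> real"
  assumes fin: "finite I" and ne: "I \<noteq> {}" and m: "m > 0" and t: "t > 0"
  defines "p \<equiv> real (card I)" and "w \<equiv> 1 / real m"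
  defines "s \<equiv> trace_on I (resolvent I w t (map y [1..<Suc m])) / p"
  defines "H \<equiv> \<lambda>k. resolvent I w t (map y (remove1 k [1..<Suc m]))"
  shows "\<bar>t * s + s / (1 + p / m * s) - 1\<bar>
    \<le> (\<Sum>k=1..m. w * \<bar>quad I (H k) (y k) - trace_on I (H k)\<bar>) / p + 1 / (t * p)"
proof -
  interpret resolvent_setting I w t
    using assms by unfold_locales (auto simp: w_def)
  let ?xs = "map y [1..<Suc m]"
  have p: "p > 0" using fin ne by (simp add: p_def card_gt_0_iff)
  have mm: "real m > 0" using m by simp
  have w: "w > 0" using m by (simp add: w_def)
  have s: "s \<ge> 0" using trace_nonneg p by (simp add: s_def)
  define c where "c = p / m"
  have c: "c > 0" using p m by (simp add: c_def)
  have cs: "c * s = w * trace_on I (G ?xs)"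
    using p by (simp add: c_def s_def w_def)
  have perm: "mset ?xs = mset (y k # map y (remove1 k [1..<Suc m]))" if "k \<in> {1..m}" for k
  proof -
    have "mset [1..<Suc m] = mset (k # remove1 k [1..<Suc m])"
      using that by (simp del: upt_Suc)
    then show ?thesis by (metis (no_types) list.simps(9) mset_map)
  qed
  define q where "q = (\<lambda>k. w * quad I (H k) (y k))"
  have q0: "q k \<ge> 0" for k
    using quad_nonneg w by (simp add: q_def H_def)
  have qk: "w * quad I (G ?xs) (y k) = q k / (1 + q k)" if "k \<in> {1..m}" for k
    using quad_mset_cong[OF perm[OF that], of "y k"] quad_Cons[of "y k" "map y (remove1 k [1..<Suc m])"]
    by (simp add: q_def H_def)
  have "(\<Sum>x\<leftarrow>?xs. w * quad I (G ?xs) x) = (\<Sum>k=1..m. w * quad I (G ?xs) (y k))"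
    by (simp add: sum_list_distinct_conv_sum_set comp_def atLeastLessThanSuc_atLeastAtMost
        del: upt_Suc)
  then have "w * (\<Sum>x\<leftarrow>?xs. quad I (G ?xs) x) = (\<Sum>k=1..m. q k / (1 + q k))"
    using qk by (simp add: sum_list_const_mult comp_def del: upt_Suc)
  with trace_identity[of ?xs] have "t * trace_on I (G ?xs) + (\<Sum>k=1..m. q k / (1 + q k)) = p"
    by (simp add: p_def)
  then have 1: "t * s + (\<Sum>k=1..m. q k / (1 + q k)) / p = 1"
    using p by (simp add: s_def field_simps)
  have "s / (1 + c * s) = m * (c * s / (1 + c * s)) / p"
    using p m by (simp add: c_def)
  then have "s / (1 + c * s) = (\<Sum>k=1..m. c * s / (1 + c * s)) / p" by simp
  then have "t * s + s / (1 + c * s) - 1 = (\<Sum>k=1..m. c * s / (1 + c * s) - q k / (1 + q k)) / p"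
    using 1 by (simp add: sum_subtractf diff_divide_distrib)
  then have "\<bar>t * s + s / (1 + c * s) - 1\<bar>
      \<le> (\<Sum>k=1..m. \<bar>c * s / (1 + c * s) - q k / (1 + q k)\<bar>) / p"
    using p by (simp add: divide_right_mono sum_abs)
  also have "\<dots> \<le> (\<Sum>k=1..m. w * \<bar>quad I (H k) (y k) - trace_on I (H k)\<bar> + w / t) / p"
  proof (intro divide_right_mono sum_mono)
    fix k assume k: "k \<in> {1..m}"
    have lip: "\<bar>a / (1 + a) - b / (1 + b)\<bar> \<le> \<bar>a - b\<bar>" if "a \<ge> 0" "b \<ge> 0" for a b :: real
    proof -
      have "a / (1 + a) - b / (1 + b) = (a - b) / ((1 + a) * (1 + b))"
        using that by (simp add: field_simps)
      moreover have "1 \<le> (1 + a) * (1 + b)" using that by (simp add: algebra_simps)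
      moreover have "\<bar>a - b\<bar> * 1 \<le> \<bar>a - b\<bar> * ((1 + a) * (1 + b))"
        using calculation by (intro mult_left_mono) auto
      ultimately show ?thesis using that by (simp add: divide_le_eq)
    qed
    have "\<bar>c * s / (1 + c * s) - q k / (1 + q k)\<bar> \<le> \<bar>c * s - q k\<bar>"
      using lip s c q0 by simp
    also have "\<dots> = w * \<bar>trace_on I (G ?xs) - quad I (H k) (y k)\<bar>"
      using w unfolding cs q_def by (simp add: abs_mult flip: right_diff_distrib)
    \<comment> \<open>Putting sample \<open>k\<close> back changes the trace by at most
      \<open>1 / t\<close>; the \<open>m\<close> corrections \<open>w / t\<close> add up to
      \<open>1 / t\<close>.\<close>
    also have "\<dots> \<le> w * (\<bar>quad I (H k) (y k) - trace_on I (H k)\<bar> + 1 / t)"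
      using trace_Cons[where x = "y k" and xs = "map y (remove1 k [1..<Suc m])"] trace_mset_cong[OF perm[OF k]] w
      by (intro mult_left_mono) (auto simp: H_def)
    finally show "\<bar>c * s / (1 + c * s) - q k / (1 + q k)\<bar>
        \<le> w * \<bar>quad I (H k) (y k) - trace_on I (H k)\<bar> + w / t"
      by (simp add: algebra_simps)
  qed (use p in simp)
  also have "\<dots> = (\<Sum>k=1..m. w * \<bar>quad I (H k) (y k) - trace_on I (H k)\<bar>) / p + 1 / (t * p)"
    using m by (simp add: sum.distrib add_divide_distrib w_def)
  finally show ?thesis by (simp add: c_def)
qed

section \<open>Spectral distribution of sample covariance matrices\<close>

text \<open>For an eigenvector \<open>v\<close>, pairing \<open>K v = a v\<close> with the conjugate
  of \<open>v\<close> gives \<open>a |v|^2 = w \<Sum>k |\<Sum>j y k j v j|^2\<close>. Stated over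
  the complex numbers, where the characteristic polynomial splits.\<close>

lemma gram_eigenvalue_nonneg:
  fixes y :: "nat \<Rightarrow> nat \<Rightarrow> real" and a :: complex
  assumes w: "w \<ge> 0"
    and K: "K = Matrix.mat p p (\<lambda>(i, j). w * (\<Sum>k\<in>S. y k i * y k j))"
    and ev: "eigenvalue (map_mat complex_of_real K) a"
  obtains r where "a = complex_of_real r" "r \<ge> 0"
proof -
  let ?A = "map_mat complex_of_real K"
  have carr: "?A \<in> carrier_mat p p" using K by auto
  from ev carr obtain v where v: "v \<in> carrier_vec p" "v \<noteq> 0\<^sub>v p" "?A *\<^sub>v v = a \<cdot>\<^sub>v v"
    unfolding eigenvalue_def eigenvector_def by auto
  define N where "N = (\<Sum>i<p. (cmod (v $ i))\<^sup>2)"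
  define R where "R = w * (\<Sum>k\<in>S. (cmod (\<Sum>j<p. of_real (y k j) * v $ j))\<^sup>2)"
  have Rnn: "R \<ge> 0" using w by (auto simp: R_def intro!: mult_nonneg_nonneg sum_nonneg)
  obtain i0 where i0: "i0 < p" "v $ i0 \<noteq> 0"
    using v(1,2) by (metis carrier_vecD eq_vecI index_zero_vec(1) index_zero_vec(2))
  have "0 < (cmod (v $ i0))\<^sup>2" using i0 by simp
  also have "\<dots> \<le> N" unfolding N_def using i0 by (intro member_le_sum) auto
  finally have Npos: "N > 0" .
  have row: "(\<Sum>j<p. complex_of_real (K $$ (i, j)) * v $ j) = a * v $ i" if "i < p" for i
  proof -
    have "(?A *\<^sub>v v) $ i = (\<Sum>j<p. complex_of_real (K $$ (i, j)) * v $ j)"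
      using that v(1) K by (auto simp: scalar_prod_def lessThan_atLeast0 intro!: sum.cong)
    then show ?thesis using v(1,3) that by simp
  qed
  have "a * of_real N = (\<Sum>i<p. cnj (v $ i) * (a * v $ i))"
    unfolding N_def of_real_sum sum_distrib_left
    by (intro sum.cong refl) (simp only: complex_norm_square mult_ac)
  also have "\<dots> = (\<Sum>i<p. cnj (v $ i) * (\<Sum>j<p. complex_of_real (K $$ (i, j)) * v $ j))"
    by (intro sum.cong) (auto simp: row)
  also have "\<dots> = (\<Sum>i<p. \<Sum>j<p. \<Sum>k\<in>S. of_real w *
      (cnj (of_real (y k i) * v $ i) * (of_real (y k j) * v $ j)))"
    unfolding sum_distrib_left
    by (intro sum.cong refl)
      (simp add: K sum_distrib_left sum_distrib_right mult_ac)
  also have "\<dots> = (\<Sum>i<p. \<Sum>k\<in>S. \<Sum>j<p. of_real w *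
      (cnj (of_real (y k i) * v $ i) * (of_real (y k j) * v $ j)))"
    by (intro sum.cong refl sum.swap)
  also have "\<dots> = (\<Sum>k\<in>S. \<Sum>i<p. \<Sum>j<p. of_real w *
      (cnj (of_real (y k i) * v $ i) * (of_real (y k j) * v $ j)))"
    by (rule sum.swap)
  also have "\<dots> = (\<Sum>k\<in>S. of_real w *
      (cnj (\<Sum>i<p. of_real (y k i) * v $ i) * (\<Sum>j<p. of_real (y k j) * v $ j)))"
    by (simp only: cnj_sum sum_product) (simp only: sum_distrib_left)
  also have "\<dots> = of_real R"
    unfolding R_def of_real_mult of_real_sum[of _ S] sum_distrib_left[of _ _ S]
    by (intro sum.cong refl arg_cong2[of _ _ _ _ times])
      (subst complex_norm_square, rule mult.commute)
  finally have "a = of_real (R / N)"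
    using Npos by (simp add: field_simps)
  moreover have "R / N \<ge> 0" using Rnn Npos by simp
  ultimately show ?thesis using that by blast
qed

text \<open>The complex characteristic polynomial splits, its roots are real and nonnegative by the
  previous lemma, and \<open>map_poly complex_of_real\<close> is injective, so the factorisation
  descends to the reals.\<close>

lemma gram_char_poly:
  fixes y :: "nat \<Rightarrow> nat \<Rightarrow> real"
  assumes w: "w \<ge> 0"
    and K: "K = Matrix.mat p p (\<lambda>(i, j). w * (\<Sum>k\<in>S. y k i * y k j))"
  obtains rs where "char_poly K = (\<Prod>r\<leftarrow>rs. [:- r, 1:])" "length rs = p" "\<forall>r\<in>set rs. r \<ge> 0"
proof -
  let ?A = "map_mat complex_of_real K"
  have carrK: "K \<in> carrier_mat p p" and carr: "?A \<in> carrier_mat p p" using K by auto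
  have h: "comm_ring_hom complex_of_real" by unfold_locales auto
  interpret mh: map_poly_inj_comm_ring_hom complex_of_real ..
  obtain as where as: "char_poly ?A = (\<Prod>a\<leftarrow>as. [:- a, 1:])" "length as = p"
    using char_poly_factorized[OF carr] by blast
  have "\<exists>r. a = complex_of_real r \<and> r \<ge> 0" if "a \<in> set as" for a
  proof -
    have "poly (char_poly ?A) a = 0"
      unfolding as(1) poly_prod_list using that
      by (auto simp: prod_list_zero_iff poly_prod_list image_iff intro!: bexI[of _ a])
    then have "eigenvalue ?A a" using eigenvalue_root_char_poly[OF carr] by simp
    then show ?thesis using gram_eigenvalue_nonneg[OF w K] by metis
  qed
  then have "\<exists>f. \<forall>a\<in>set as. a = complex_of_real (f a) \<and> f a \<ge> 0" by metis
  then obtain f where f: "\<forall>a\<in>set as. a = complex_of_real (f a) \<and> f a \<ge> 0" by blast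
  define rs where "rs = map f as"
  have "map complex_of_real rs = as"
    unfolding rs_def using f by (simp add: map_idI comp_def)
  then have "map_poly complex_of_real (char_poly K)
      = (\<Prod>a\<leftarrow>map complex_of_real rs. [:- a, 1:])"
    using as(1) comm_ring_hom.char_poly_hom[OF h carrK] by simp
  also have "\<dots> = map_poly complex_of_real (\<Prod>r\<leftarrow>rs. [:- r, 1:])"
    by (induction rs) (simp_all add: mh.hom_mult del: mult_pCons_left)
  finally have "char_poly K = (\<Prod>r\<leftarrow>rs. [:- r, 1:])"
    by (simp only: mh.eq_iff)
  moreover have "length rs = p" "\<forall>r\<in>set rs. r \<ge> 0" using as(2) f by (auto simp: rs_def)
  ultimately show ?thesis using that by blast
qed

text \<open>Logarithmic derivative of a product of linear factors.\<close>

lemma pderiv_prod_linear: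
  fixes rs :: "real list"
  assumes "\<forall>r\<in>set rs. z \<noteq> r"
  shows "poly (pderiv (\<Prod>r\<leftarrow>rs. [:- r, 1:])) z
    = poly (\<Prod>r\<leftarrow>rs. [:- r, 1:]) z * (\<Sum>r\<leftarrow>rs. 1 / (z - r))"
  using assms
proof (induction rs)
  case (Cons r rs)
  define P where "P = (\<Prod>r\<leftarrow>rs. [:- r, 1:])"
  have "z - r \<noteq> 0" using Cons.prems by auto
  moreover have "poly (pderiv P) z = poly P z * (\<Sum>r\<leftarrow>rs. 1 / (z - r))"
    using Cons by (simp add: P_def)
  moreover have "poly (pderiv ([:- r, 1:] * P)) z = poly P z + (z - r) * poly (pderiv P) z"
    unfolding pderiv_mult by (simp add: pderiv_pCons algebra_simps)
  moreover have "poly ([:- r, 1:] * P) z = (z - r) * poly P z" by (simp add: algebra_simps)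
  ultimately show ?case
    by (simp only: list.map prod_list.Cons sum_list.Cons P_def[symmetric]) (simp add: field_simps)
qed simp

text \<open>No diagonalisation is involved: the derivative of the characteristic polynomial at
  \<open>-t\<close> is the sum of the principal cofactors of \<open>F = -t - K\<close>, hence the
  trace of its adjugate, which is \<open>det F\<close> times the trace of the inverse
  \<open>-g\<close> of \<open>F\<close>. Dividing by \<open>det F = char_poly K (-t)\<close> and
  comparing with the logarithmic derivative yields the sum over the roots.\<close>

lemma trace_inverse_eq_sum_roots:
  fixes K :: "real mat" and g :: "nat \<Rightarrow> nat \<Rightarrow> real"
  assumes K: "K \<in> carrier_mat p p" and rs: "char_poly K = (\<Prod>r\<leftarrow>rs. [:- r, 1:])"
    and nn: "\<forall>r\<in>set rs. r \<ge> 0" and t: "t > 0"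
    and inv: "\<And>i k. i < p \<Longrightarrow> k < p \<Longrightarrow>
      (\<Sum>j<p. (K $$ (i, j) + (if i = j then t else 0)) * g j k) = (if i = k then 1 else 0)"
  shows "(\<Sum>i<p. g i i) = (\<Sum>r\<leftarrow>rs. 1 / (r + t))"
proof -
  define F where "F = - char_matrix K (- t)"
  define H where "H = Matrix.mat p p (\<lambda>(i, j). - g i j)"
  have F: "F \<in> carrier_mat p p" using K by (simp add: F_def)
  have H: "H \<in> carrier_mat p p" by (simp add: H_def)
  have "F * H = 1\<^sub>m p"
  proof (rule eq_matI)
    fix i k assume "i < dim_row (1\<^sub>m p :: real mat)" "k < dim_col (1\<^sub>m p :: real mat)"
    then have ik: "i < p" "k < p" by auto
    then have "(F * H) $$ (i, k) = (\<Sum>j<p. F $$ (i, j) * H $$ (j, k))"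
      using F H by (auto simp: scalar_prod_def lessThan_atLeast0 intro!: sum.cong)
    also have "\<dots> = (\<Sum>j<p. (K $$ (i, j) + (if i = j then t else 0)) * g j k)"
      using ik K by (intro sum.cong) (auto simp: F_def H_def char_matrix_def algebra_simps)
    finally show "(F * H) $$ (i, k) = 1\<^sub>m p $$ (i, k)" using inv ik by simp
  qed (use F H in auto)
  moreover have aF: "adj_mat F \<in> carrier_mat p p" by (rule adj_mat(1)[OF F])
  ultimately have "adj_mat F = adj_mat F * (F * H)"
    using right_mult_one_mat[OF aF] by simp
  also have "\<dots> = (adj_mat F * F) * H"
    by (rule assoc_mult_mat[OF aF F H, symmetric])
  also have "\<dots> = (Determinant.det F \<cdot>\<^sub>m 1\<^sub>m p) * H"
    by (simp only: adj_mat(3)[OF F])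
  also have "\<dots> = Determinant.det F \<cdot>\<^sub>m (1\<^sub>m p * H)"
    by (rule mult_smult_assoc_mat[OF one_carrier_mat H])
  also have "\<dots> = Determinant.det F \<cdot>\<^sub>m H"
    using left_mult_one_mat[OF H] by simp
  finally have adj: "adj_mat F = Determinant.det F \<cdot>\<^sub>m H" .
  \<comment> \<open>Deleting row and column \<open>i\<close> commutes with forming the
    characteristic matrix.\<close>
  have cof: "cofactor F i i = poly (char_poly (mat_delete K i i)) (- t)" if "i < p" for i
  proof -
    have 1: "mat_delete K i i \<in> carrier_mat (p - 1) (p - 1)"
      by (rule mat_delete_carrier[OF K])
    have "mat_delete F i i = - char_matrix (mat_delete K i i) (- t)"
      using K that by (intro eq_matI) (auto simp: F_def char_matrix_def mat_delete_def)
    then show ?thesis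
      by (simp add: Determinant.cofactor_def char_poly_matrix[OF 1])
  qed
  have det: "Determinant.det F = poly (char_poly K) (- t)"
    by (simp add: F_def char_poly_matrix[OF K])
  have "poly (pderiv (char_poly K)) (- t) = (\<Sum>i<p. cofactor F i i)"
    unfolding pderiv_char_poly[OF K] poly_sum using cof by (intro sum.cong) auto
  also have "\<dots> = (\<Sum>i<p. adj_mat F $$ (i, i))"
    using F by (intro sum.cong) (auto simp: adj_mat_def)
  also have "\<dots> = - poly (char_poly K) (- t) * (\<Sum>i<p. g i i)"
    unfolding adj det[symmetric] by (simp add: H_def sum_negf sum_distrib_left)
  finally have 1: "poly (pderiv (char_poly K)) (- t) = - poly (char_poly K) (- t) * (\<Sum>i<p. g i i)" .
  have ne: "\<forall>r\<in>set rs. - t \<noteq> r" using nn t by force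
  have nz: "poly (char_poly K) (- t) \<noteq> 0"
    unfolding rs using ne
  proof (induction rs)
    case (Cons r rs)
    have "poly [:- r, 1:] (- t) \<noteq> 0" using Cons.prems by simp
    with Cons show ?case
      by (simp only: list.map prod_list.Cons poly_mult mult_eq_0_iff) simp
  qed simp
  have "poly (char_poly K) (- t) * (\<Sum>r\<leftarrow>rs. 1 / (- t - r))
      = poly (char_poly K) (- t) * (- (\<Sum>i<p. g i i))"
    using 1 pderiv_prod_linear[OF ne] unfolding rs by simp
  then have "(\<Sum>r\<leftarrow>rs. 1 / (- t - r)) = - (\<Sum>i<p. g i i)"
    by (rule mult_left_cancel[OF nz, THEN iffD1])
  then have "(\<Sum>i<p. g i i) = - (\<Sum>r\<leftarrow>rs. 1 / (- t - r))" by simp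
  also have "\<dots> = (\<Sum>r\<leftarrow>rs. 1 / (r + t))"
  proof (induction rs)
    case (Cons r rs)
    have "- (1 / (- t - r)) = 1 / (r + t)"
      by (metis add.commute minus_diff_eq minus_divide_right diff_minus_eq_add minus_minus)
    with Cons show ?case by simp
  qed simp
  finally show ?thesis .
qed

text \<open>The sorted list of eigenvalues has the roots as its multiset, and integrals against the
  uniform measure do not see the order.\<close>

lemma ESD_of_char_poly_roots:
  fixes K :: "real mat"
  assumes K: "K \<in> carrier_mat p p" and p: "p > 0"
    and rs: "char_poly K = (\<Prod>r\<leftarrow>rs. [:- r, 1:])" "length rs = p" "\<forall>r\<in>set rs. r \<ge> 0"
  shows "real_distribution (ESD K)" "AE z in ESD K. z \<ge> 0"
    "f \<in> borel_measurable borel \<Longrightarrow> (\<integral>z. f z \<partial>ESD K) = (\<Sum>r\<leftarrow>rs. f r :: real) / real p"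
proof -
  let ?U = "uniform_count_measure {..<p}"
  have dim: "dim_row K = p" using K by auto
  have "proots (char_poly K) = mset rs"
    unfolding rs(1)
  proof (induction rs)
    case (Cons r rs)
    have "(\<Prod>r\<leftarrow>rs. [:- r, 1:]) \<noteq> 0" by (auto simp: prod_list_zero_iff)
    then have "proots ([:- r, 1:] * (\<Prod>r\<leftarrow>rs. [:- r, 1:]))
        = proots [:- r, 1:] + proots (\<Prod>r\<leftarrow>rs. [:- r, 1:])"
      by (intro proots_mult) auto
    with Cons show ?case by (simp del: mult_pCons_left)
  qed simp
  then have ev: "mset (real_eigenvalues K) = mset rs"
    by (simp add: real_eigenvalues_def)
  then have len: "length (real_eigenvalues K) = p" and set: "set (real_eigenvalues K) = set rs"
    using rs(2) by (metis mset_eq_length, metis mset_eq_setD)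
  have meas [measurable]: "(\<lambda>j. real_eigenvalues K ! j) \<in> measurable ?U borel"
    by (auto simp: measurable_def sets_uniform_count_measure space_uniform_count_measure)
  have pU: "prob_space ?U"
    using p by (intro prob_space_uniform_count_measure) auto
  show "real_distribution (ESD K)"
    unfolding ESD_def dim by (intro real_distribution.intro prob_space.prob_space_distr[OF pU])
      (auto simp: real_distribution_axioms_def)
  show "AE z in ESD K. z \<ge> 0"
    unfolding ESD_def dim
    by (subst AE_distr_iff[OF meas])
      (use rs(3) set len in \<open>auto simp: space_uniform_count_measure intro!: AE_I2 dest!: nth_mem\<close>)
  assume f [measurable]: "f \<in> borel_measurable borel"
  have "(\<integral>z. f z \<partial>ESD K) = (\<integral>j. f (real_eigenvalues K ! j) \<partial>?U)"
    unfolding ESD_def dim by (rule integral_distr) auto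
  then have 1: "(\<integral>z. f z \<partial>ESD K) = (\<Sum>j<p. f (real_eigenvalues K ! j)) / p"
    by (simp add: integral_uniform_count_measure)
  have "(\<Sum>j<p. f (real_eigenvalues K ! j)) = sum_list (map f (real_eigenvalues K))"
    using len by (simp add: sum_list_sum_nth lessThan_atLeast0)
  also have "\<dots> = sum_mset (mset (map f (real_eigenvalues K)))"
    by (rule sum_mset_sum_list[symmetric])
  also have "\<dots> = sum_mset (mset (map f rs))"
    using ev by simp
  also have "\<dots> = sum_list (map f rs)"
    by (rule sum_mset_sum_list)
  finally show "(\<integral>z. f z \<partial>ESD K) = (\<Sum>r\<leftarrow>rs. f r) / real p"
    by (simp add: 1)
qed

text \<open>The matrix is indexed by numbers and \<open>resolvent\<close> by subsets; the
  enumeration \<open>e\<close> carries one to the other, and \<open>is_inv\<close> is the inverse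
  that \<open>trace_inverse_eq_sum_roots\<close> asks for.\<close>

lemma ESD_sample_cov:
  fixes x :: "nat \<Rightarrow> nat set \<Rightarrow> real" and n d m :: nat
  assumes p: "n choose d > 0" and t: "t > 0"
  defines "K \<equiv> sample_cov n d m x"
  shows "real_distribution (ESD K)" "AE z in ESD K. z \<ge> 0"
    "(\<integral>z. 1 / (z + t) \<partial>ESD K) = trace_on (dsubsets n d)
       (resolvent (dsubsets n d) (1 / real m) t (map x [1..<Suc m])) / real (n choose d)"
proof -
  define p' where "p' = n choose d"
  define I where "I = dsubsets n d"
  define e where "e = (\<lambda>a. dsubsets_list n d ! a)"
  define w where "w = 1 / real m"
  have fin: "finite I" by (auto simp: I_def dsubsets_def)
  interpret resolvent_setting I w t using fin t by unfold_locales (auto simp: w_def)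
  have bij: "bij_betw e {..<p'} I"
    using bij_betw_nth[OF distinct_dsubsets_list, of "{..<p'}" n d "I"]
    by (simp add: set_dsubsets_list length_dsubsets_list p'_def I_def e_def)
  have K: "K = Matrix.mat p' p' (\<lambda>(i, j). w * (\<Sum>k\<in>{1..m}. x k (e i) * x k (e j)))"
    by (simp add: K_def sample_cov_def p'_def w_def e_def)
  have carr: "K \<in> carrier_mat p' p'" using K by simp
  have w0: "w \<ge> 0" by (simp add: w_def)
  obtain rs where rs: "char_poly K = (\<Prod>r\<leftarrow>rs. [:- r, 1:])" "length rs = p'" "\<forall>r\<in>set rs. r \<ge> 0"
    by (rule gram_char_poly[OF w0 K])
  have p0: "p' > 0" using p by (simp add: p'_def)
  show "real_distribution (ESD K)" "AE z in ESD K. z \<ge> 0"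
    using ESD_of_char_poly_roots[OF carr p0 rs] by auto
  let ?xs = "map x [1..<Suc m]"
  have "(\<Sum>i<p'. G ?xs (e i) (e i)) = (\<Sum>r\<leftarrow>rs. 1 / (r + t))"
  proof (rule trace_inverse_eq_sum_roots[where g = "\<lambda>i j. G ?xs (e i) (e j)", OF carr rs(1,3) t])
    fix i k assume ik: "i < p'" "k < p'"
    then have eI: "e i \<in> I" "e k \<in> I" using bij by (auto simp: bij_betw_def)
    have inj: "e i = e j \<longleftrightarrow> i = j" if "i < p'" "j < p'" for i j
      using bij that by (auto simp: bij_betw_def inj_on_def)
    define gk where "gk = G ?xs (e k)"
    have gs: "G ?xs (e j) (e k) = gk (e j)" for j
      unfolding gk_def by (rule resolvent_sym)
    have "(\<Sum>j<p'. (K $$ (i, j) + (if i = j then t else 0)) * G ?xs (e j) (e k))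
        = (\<Sum>j<p'. (\<Sum>l=1..m. w * (x l (e i) * (gk (e j) * x l (e j))))
            + (if i = j then t * gk (e j) else 0))"
    proof (rule sum.cong)
      fix j assume "j \<in> {..<p'}"
      then have "K $$ (i, j) * gk (e j) = (\<Sum>l=1..m. w * (x l (e i) * (gk (e j) * x l (e j))))"
        using ik by (simp add: K sum_distrib_left sum_distrib_right mult_ac)
      then show "(K $$ (i, j) + (if i = j then t else 0)) * G ?xs (e j) (e k)
          = (\<Sum>l=1..m. w * (x l (e i) * (gk (e j) * x l (e j)))) + (if i = j then t * gk (e j) else 0)"
        unfolding gs by (cases "i = j") (simp_all only: distrib_right if_True if_False refl add_0_right)
    qed (rule refl)
    also have "\<dots> = (\<Sum>j<p'. \<Sum>l=1..m. w * (x l (e i) * (gk (e j) * x l (e j)))) + t * gk (e i)"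
      using ik by (simp add: sum.distrib)
    finally have 1: "(\<Sum>j<p'. (K $$ (i, j) + (if i = j then t else 0)) * G ?xs (e j) (e k))
      = (\<Sum>j<p'. \<Sum>l=1..m. w * (x l (e i) * (gk (e j) * x l (e j)))) + t * gk (e i)" .
    have 2: "(\<Sum>j<p'. \<Sum>l=1..m. w * (x l (e i) * (gk (e j) * x l (e j))))
        = w * (\<Sum>l=1..m. x l (e i) * (\<Sum>j<p'. gk (e j) * x l (e j)))"
      by (subst sum.swap) (simp only: sum_distrib_left)
    have 3: "(\<Sum>j<p'. gk (e j) * x l (e j)) = app I (G ?xs) (x l) (e k)" for l
      unfolding app_def gk_def
      by (rule sum.reindex_bij_betw[OF bij, of "\<lambda>j. G ?xs (e k) j * x l j"])
    have 4: "(\<Sum>v\<leftarrow>?xs. v (e i) * app I (G ?xs) v (e k))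
        = (\<Sum>l=1..m. x l (e i) * app I (G ?xs) (x l) (e k))"
      by (simp add: sum_list_distinct_conv_sum_set comp_def atLeastLessThanSuc_atLeastAtMost
        del: upt_Suc)
    have "t * G ?xs (e i) (e k) + w * (\<Sum>v\<leftarrow>?xs. v (e i) * app I (G ?xs) v (e k))
        = (if e i = e k then 1 else 0)"
      by (rule is_inv[of ?xs, unfolded is_inv_def, rule_format, OF eI])
    then show "(\<Sum>j<p'. (K $$ (i, j) + (if i = j then t else 0)) * G ?xs (e j) (e k))
      = (if i = k then 1 else 0)"
      unfolding 1 2 3 4 using inj[OF ik] gs[of i] by (simp add: add.commute)
  qed
  moreover have "(\<Sum>i<p'. G ?xs (e i) (e i)) = trace_on I (G ?xs)"
    unfolding trace_on_def by (rule sum.reindex_bij_betw[OF bij, of "\<lambda>j. G ?xs j j"])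
  moreover have "(\<integral>z. 1 / (z + t) \<partial>ESD K) = (\<Sum>r\<leftarrow>rs. 1 / (r + t)) / real p'"
    by (rule ESD_of_char_poly_roots(3)[OF carr p0 rs]) measurable
  ultimately show "(\<integral>z. 1 / (z + t) \<partial>ESD K) = trace_on (dsubsets n d)
       (resolvent (dsubsets n d) (1 / real m) t (map x [1..<Suc m])) / real (n choose d)"
    by (simp add: p'_def I_def w_def)
qed

section \<open>The Marchenko--Pastur law\<close>

text \<open>The antiderivative is
  \<open>sqrt R + (\<alpha> + \<beta>) / 2 * arcsin z\<^sub>1 - sqrt (\<alpha> \<beta>) * arcsin z\<^sub>2\<close> with
  \<open>R = (\<beta> - u) (u - \<alpha>)\<close>; it is only continuous at the end points.\<close>

lemma integral_semicircle_over_linear: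
  fixes \<alpha> \<beta> :: real
  assumes \<alpha>: "\<alpha> \<ge> 0" and \<alpha>\<beta>: "\<alpha> < \<beta>"
  shows "((\<lambda>u. sqrt ((\<beta> - u) * (u - \<alpha>)) / u) has_integral pi * ((\<alpha> + \<beta>) / 2 - sqrt (\<alpha> * \<beta>))) {\<alpha>..\<beta>}"
proof -
  define z1 where "z1 = (\<lambda>u. (2 * u - \<alpha> - \<beta>) / (\<beta> - \<alpha>))"
  define z2 where "z2 = (\<lambda>u. ((\<alpha> + \<beta>) * u - 2 * \<alpha> * \<beta>) / (u * (\<beta> - \<alpha>)))"
  \<comment> \<open>For \<alpha> = 0 the coefficient of the second arcsine vanishes, while
    \<open>z2\<close> jumps at \<open>u = 0\<close>; the case split keeps \<open>F\<close> visibly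
    continuous.\<close>
  define h where "h = (\<lambda>u. if \<alpha> = 0 then 0 else sqrt (\<alpha> * \<beta>) * arcsin (z2 u))"
  define F where "F = (\<lambda>u. sqrt ((\<beta> - u) * (u - \<alpha>)) + (\<alpha> + \<beta>) / 2 * arcsin (z1 u) - h u)"
  have d: "\<beta> - \<alpha> > 0" using \<alpha>\<beta> by simp
  \<comment> \<open>\<open>1 - z1^2\<close> and \<open>1 - z2^2\<close> are nonnegative multiples of
    \<open>R\<close>. This gives the range of the arguments of the arcsine and, through
    \<open>sqrt (1 - z^2)\<close>, the derivatives.\<close>
  have id1: "1 - (z1 u)\<^sup>2 = 4 * ((\<beta> - u) * (u - \<alpha>)) / (\<beta> - \<alpha>)\<^sup>2" for u
  proof -
    have "1 - (z1 u)\<^sup>2 = ((\<beta> - \<alpha>)\<^sup>2 - (2 * u - \<alpha> - \<beta>)\<^sup>2) / (\<beta> - \<alpha>)\<^sup>2"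
      unfolding z1_def power_divide using d by (simp add: diff_divide_distrib)
    also have "(\<beta> - \<alpha>)\<^sup>2 - (2 * u - \<alpha> - \<beta>)\<^sup>2 = 4 * ((\<beta> - u) * (u - \<alpha>))"
      by (simp add: power2_eq_square algebra_simps)
    finally show ?thesis .
  qed
  have id2: "1 - (z2 u)\<^sup>2 = 4 * (\<alpha> * \<beta>) * ((\<beta> - u) * (u - \<alpha>)) / (u * (\<beta> - \<alpha>))\<^sup>2"
    if "u > 0" for u
  proof -
    have "1 - (z2 u)\<^sup>2 = ((u * (\<beta> - \<alpha>))\<^sup>2 - ((\<alpha> + \<beta>) * u - 2 * \<alpha> * \<beta>)\<^sup>2) / (u * (\<beta> - \<alpha>))\<^sup>2"
      unfolding z2_def power_divide using d that by (simp add: diff_divide_distrib)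
    also have "(u * (\<beta> - \<alpha>))\<^sup>2 - ((\<alpha> + \<beta>) * u - 2 * \<alpha> * \<beta>)\<^sup>2
        = 4 * (\<alpha> * \<beta>) * ((\<beta> - u) * (u - \<alpha>))"
      by (simp add: power2_eq_square algebra_simps)
    finally show ?thesis .
  qed
  have sq_le: "-1 \<le> z \<and> z \<le> 1" if "1 - z\<^sup>2 \<ge> 0" for z :: real
    using that abs_square_le_1[of z] by (auto simp: abs_le_iff)
  have sq_less: "-1 < z \<and> z < 1" if "1 - z\<^sup>2 > 0" for z :: real
    using that abs_square_less_1[of z] by (auto simp: abs_less_iff)
  have rg1: "-1 \<le> z1 u \<and> z1 u \<le> 1" if "u \<in> {\<alpha>..\<beta>}" for u
    by (rule sq_le) (use that d in \<open>auto simp: id1\<close>)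
  have rg2: "-1 \<le> z2 u \<and> z2 u \<le> 1" if "u \<in> {\<alpha>..\<beta>}" "\<alpha> \<noteq> 0" for u
    by (rule sq_le, subst id2) (use that \<alpha> d in auto)
  have "((\<lambda>u. sqrt ((\<beta> - u) * (u - \<alpha>)) / u) has_integral F \<beta> - F \<alpha>) {\<alpha>..\<beta>}"
  proof (rule fundamental_theorem_of_calculus_interior)
    have "continuous_on {\<alpha>..\<beta>} h"
    proof (cases "\<alpha> = 0")
      case False
      have "continuous_on {\<alpha>..\<beta>} z2"
        unfolding z2_def using \<alpha> False d by (intro continuous_intros) auto
      then show ?thesis
        unfolding h_def using rg2 False by (auto intro!: continuous_intros)
    qed (simp add: h_def)
    moreover have "continuous_on {\<alpha>..\<beta>} z1"
      unfolding z1_def using d by (intro continuous_intros) auto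
    ultimately show "continuous_on {\<alpha>..\<beta>} F"
      unfolding F_def using rg1 by (auto intro!: continuous_intros)
  next
    fix u assume u: "u \<in> {\<alpha><..<\<beta>}"
    define r where "r = sqrt ((\<beta> - u) * (u - \<alpha>))"
    have R: "(\<beta> - u) * (u - \<alpha>) > 0" using u by auto
    have r: "r > 0" using R by (simp add: r_def)
    have r2: "r * r = (\<beta> - u) * (u - \<alpha>)" using R by (simp add: r_def)
    have u0: "u > 0" using u \<alpha> by auto
    have D0: "((\<lambda>u. sqrt ((\<beta> - u) * (u - \<alpha>))) has_real_derivative ((\<alpha> + \<beta>) / 2 - u) / r) (at u)"
      using R r by (auto intro!: derivative_eq_intros simp: r_def field_simps)
    have D1: "((\<lambda>u. arcsin (z1 u)) has_real_derivative 1 / r) (at u)"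
    proof -
      have s: "sqrt (1 - (z1 u)\<^sup>2) = 2 * r / (\<beta> - \<alpha>)"
        unfolding id1 r_def using d by (simp add: real_sqrt_divide real_sqrt_mult)
      have "-1 < z1 u \<and> z1 u < 1"
        by (rule sq_less) (use R d in \<open>auto simp: id1\<close>)
      moreover have "(z1 has_real_derivative 2 / (\<beta> - \<alpha>)) (at u)"
      proof -
        have "((\<lambda>u. (2 * u - \<alpha> - \<beta>) / e) has_real_derivative 2 / e) (at u)" if "e > 0" for e
          using that by (auto intro!: derivative_eq_intros)
        from this[OF d] show ?thesis unfolding z1_def .
      qed
      ultimately have "((\<lambda>u. arcsin (z1 u)) has_real_derivative
          inverse (sqrt (1 - (z1 u)\<^sup>2)) * (2 / (\<beta> - \<alpha>))) (at u)"
        by (intro DERIV_chain2[OF DERIV_arcsin]) auto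
      moreover have "inverse (2 * r / e) * (2 / e) = 1 / r" if "e > 0" for e
        using that r by (simp add: field_simps)
      ultimately show ?thesis using d unfolding s by metis
    qed
    have D2: "(h has_real_derivative \<alpha> * \<beta> / (u * r)) (at u)"
    proof (cases "\<alpha> = 0")
      case False
      with \<alpha> \<alpha>\<beta> have pos: "\<alpha> * \<beta> > 0" by (simp add: zero_less_mult_iff)
      define q where "q = sqrt (\<alpha> * \<beta>)"
      have q: "q > 0" "q * q = \<alpha> * \<beta>" using pos by (auto simp: q_def)
      have s: "sqrt (1 - (z2 u)\<^sup>2) = 2 * q * r / (u * (\<beta> - \<alpha>))"
        unfolding id2[OF u0] r_def q_def using d u0
        by (simp add: real_sqrt_divide real_sqrt_mult power_mult_distrib)
      have "-1 < z2 u \<and> z2 u < 1"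
        by (rule sq_less, subst id2[OF u0]) (use R d u0 pos in auto)
      moreover have "(z2 has_real_derivative 2 * (\<alpha> * \<beta>) / (u\<^sup>2 * (\<beta> - \<alpha>))) (at u)"
      proof -
        have "((\<lambda>u. ((\<alpha> + \<beta>) * u - 2 * \<alpha> * \<beta>) / (u * e)) has_real_derivative 2 * (\<alpha> * \<beta>) / (u\<^sup>2 * e)) (at u)"
          if "e > 0" for e
          using that u0 by (auto intro!: derivative_eq_intros simp: divide_simps power2_eq_square)
            (simp add: algebra_simps)?
        from this[OF d] show ?thesis unfolding z2_def .
      qed
      ultimately have "((\<lambda>u. arcsin (z2 u)) has_real_derivative
          inverse (sqrt (1 - (z2 u)\<^sup>2)) * (2 * (\<alpha> * \<beta>) / (u\<^sup>2 * (\<beta> - \<alpha>)))) (at u)"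
        by (intro DERIV_chain2[OF DERIV_arcsin]) auto
      then have "((\<lambda>u. q * arcsin (z2 u)) has_real_derivative
          q * (inverse (sqrt (1 - (z2 u)\<^sup>2)) * (2 * (\<alpha> * \<beta>) / (u\<^sup>2 * (\<beta> - \<alpha>))))) (at u)"
        by (rule DERIV_cmult)
      moreover have "q * (inverse (sqrt (1 - (z2 u)\<^sup>2)) * (2 * (\<alpha> * \<beta>) / (u\<^sup>2 * (\<beta> - \<alpha>))))
          = \<alpha> * \<beta> / (u * r)"
      proof -
        have "q * (inverse (2 * q * r / (u * e)) * (2 * (\<alpha> * \<beta>) / (u * u * e))) = \<alpha> * \<beta> / (u * r)"
          if "e > 0" for e using that q(1) u0 r by (simp add: field_simps)
        from this[OF d] show ?thesis unfolding s by (simp add: power2_eq_square)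
      qed
      ultimately show ?thesis using False unfolding h_def q_def by (simp only: if_False)
    qed (simp add: h_def)
    have "(F has_real_derivative ((\<alpha> + \<beta>) / 2 - u) / r + (\<alpha> + \<beta>) / 2 * (1 / r) - \<alpha> * \<beta> / (u * r)) (at u)"
      unfolding F_def by (intro DERIV_diff DERIV_add DERIV_cmult D0 D1 D2)
    moreover have "((\<alpha> + \<beta>) / 2 - u) / r + (\<alpha> + \<beta>) / 2 * (1 / r) - \<alpha> * \<beta> / (u * r) = r / u"
    proof -
      have "((\<alpha> + \<beta>) / 2 - u) / r + (\<alpha> + \<beta>) / 2 * (1 / r) - \<alpha> * \<beta> / (u * r)
          = ((\<beta> - u) * (u - \<alpha>)) / (u * r)"
        using u0 r by (simp add: field_simps)
      also have "\<dots> = r / u" using u0 r by (simp flip: r2)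
      finally show ?thesis .
    qed
    ultimately show "(F has_vector_derivative sqrt ((\<beta> - u) * (u - \<alpha>)) / u) (at u)"
      by (simp add: has_real_derivative_iff_has_vector_derivative r_def)
  qed (use \<alpha>\<beta> in simp)
  moreover have "F \<beta> - F \<alpha> = pi * ((\<alpha> + \<beta>) / 2 - sqrt (\<alpha> * \<beta>))"
  proof -
    have z: "z1 \<alpha> = -1" "z1 \<beta> = 1" using d by (auto simp: z1_def field_simps)
    have "h \<beta> - h \<alpha> = pi * sqrt (\<alpha> * \<beta>)"
    proof (cases "\<alpha> = 0")
      case False
      then have "z2 \<beta> = 1" "z2 \<alpha> = -1"
        using d \<alpha> \<alpha>\<beta> by (auto simp: z2_def divide_simps algebra_simps)
      then show ?thesis using False by (simp add: h_def algebra_simps)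
    qed (simp add: h_def)
    then have "h \<beta> = h \<alpha> + pi * sqrt (\<alpha> * \<beta>)" by simp
    then show ?thesis by (simp add: F_def z field_simps)
  qed
  ultimately show ?thesis by simp
qed

text \<open>\<open>MP_law\<close> is given by its values on sets, so the integral formula is proved
  by induction on measurable functions.\<close>

lemma nn_integral_MP_law:
  assumes "f \<in> borel_measurable borel"
  shows "(\<integral>\<^sup>+x. f x \<partial>MP_law c)
    = ennreal (max 0 (1 - 1 / c)) * f 0 + (\<integral>\<^sup>+x. f x * ennreal (MP_density c x) \<partial>lborel)"
  using assms
proof (induction f rule: borel_measurable_induct)
  case (cong f g)
  then have "f = g" by (auto simp: space_borel)
  with cong show ?case by simp
next
  case (set A)
  then show ?case
    by (simp add: emeasure_MP_law mult.commute)
next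
  case (mult u c')
  have [measurable]: "(\<lambda>x. ennreal (MP_density c x)) \<in> borel_measurable borel"
    unfolding MP_density_def Let_def by measurable
  note [measurable] = mult(2)
  have "(\<integral>\<^sup>+x. c' * u x \<partial>MP_law c) = c' * (\<integral>\<^sup>+x. u x \<partial>MP_law c)"
    by (intro nn_integral_cmult) (simp cong: measurable_cong_sets)
  moreover have "(\<integral>\<^sup>+x. c' * u x * ennreal (MP_density c x) \<partial>lborel)
      = c' * (\<integral>\<^sup>+x. u x * ennreal (MP_density c x) \<partial>lborel)"
    by (simp add: mult.assoc nn_integral_cmult)
  ultimately show ?case using mult by (simp add: distrib_left mult.left_commute)
next
  case (add u v)
  have [measurable]: "(\<lambda>x. ennreal (MP_density c x)) \<in> borel_measurable borel"
    unfolding MP_density_def Let_def by measurable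
  note [measurable] = add(1,3)
  have "(\<integral>\<^sup>+x. v x + u x \<partial>MP_law c) = (\<integral>\<^sup>+x. v x \<partial>MP_law c) + (\<integral>\<^sup>+x. u x \<partial>MP_law c)"
    by (intro nn_integral_add) (simp_all cong: measurable_cong_sets)
  moreover have "(\<integral>\<^sup>+x. (v x + u x) * ennreal (MP_density c x) \<partial>lborel)
      = (\<integral>\<^sup>+x. v x * ennreal (MP_density c x) \<partial>lborel)
        + (\<integral>\<^sup>+x. u x * ennreal (MP_density c x) \<partial>lborel)"
    by (simp add: distrib_right nn_integral_add)
  ultimately show ?case using add by (simp add: distrib_left distrib_right ac_simps)
next
  case (seq U)
  have [measurable]: "(\<lambda>x. ennreal (MP_density c x)) \<in> borel_measurable borel"
    unfolding MP_density_def Let_def by measurable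
  note [measurable] = seq(1)
  have u: "(SUP i. U i) x = (SUP i. U i x)" for x by (simp add: image_comp)
  have "(\<integral>\<^sup>+x. (SUP i. U i) x \<partial>MP_law c) = (SUP i. (\<integral>\<^sup>+x. U i x \<partial>MP_law c))"
    unfolding u using seq by (intro nn_integral_monotone_convergence_SUP) (auto cong: measurable_cong_sets)
  also have "\<dots> = (SUP i. ennreal (max 0 (1 - 1 / c)) * U i 0
      + (\<integral>\<^sup>+x. U i x * ennreal (MP_density c x) \<partial>lborel))"
    using seq by (intro SUP_cong) auto
  also have "\<dots> = (SUP i. ennreal (max 0 (1 - 1 / c)) * U i 0)
      + (SUP i. (\<integral>\<^sup>+x. U i x * ennreal (MP_density c x) \<partial>lborel))"
    using seq(3) by (intro ennreal_SUP_add)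
      (auto simp: incseq_def le_fun_def intro!: mult_left_mono nn_integral_mono mult_right_mono)
  also have "(SUP i. ennreal (max 0 (1 - 1 / c)) * U i 0) = ennreal (max 0 (1 - 1 / c)) * (SUP i. U i 0)"
    by (simp add: SUP_mult_left_ennreal)
  also have "(SUP i. (\<integral>\<^sup>+x. U i x * ennreal (MP_density c x) \<partial>lborel))
      = (\<integral>\<^sup>+x. (SUP i. U i x * ennreal (MP_density c x)) \<partial>lborel)"
    using seq(3) by (intro nn_integral_monotone_convergence_SUP[symmetric])
      (auto simp: incseq_def le_fun_def intro!: mult_right_mono)
  also have "\<dots> = (\<integral>\<^sup>+x. (SUP i. U i x) * ennreal (MP_density c x) \<partial>lborel)"
    by (simp add: SUP_mult_right_ennreal)
  finally show ?case unfolding u .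
qed

text \<open>Everything comes from \<open>J\<close>, the integral of
  \<open>sqrt ((b - x) (x - a)) / (x + t)\<close> over \<open>[a, b]\<close>, obtained by shifting
  the interval by \<open>t\<close>. Its value at \<open>t = 0\<close> gives the total mass. The
  transform is a difference of two values, and its closed form is the nonnegative root of the
  quadratic equation got by clearing denominators in \<open>t s + s / (1 + c s) = 1\<close>.\<close>

lemma
  assumes c: "c > 0"
  shows real_distribution_MP_law: "real_distribution (MP_law c)"
    and AE_MP_law_nonneg: "AE x in MP_law c. x \<ge> 0"
    and MP_law_stieltjes_nonneg: "t > 0 \<Longrightarrow> (\<integral>x. 1 / (x + t) \<partial>MP_law c) \<ge> 0"
    and MP_law_stieltjes_equation: "t > 0 \<Longrightarrow> let s = (\<integral>x. 1 / (x + t) \<partial>MP_law c) in t * s + s / (1 + c * s) = 1"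
proof -
  define a where "a = (1 - sqrt c)\<^sup>2"
  define b where "b = (1 + sqrt c)\<^sup>2"
  have a0: "a \<ge> 0" by (simp add: a_def)
  have sc: "sqrt c * sqrt c = c" using c by simp
  have apb: "a + b = 2 * (1 + c)" and amb: "a * b = (1 - c)\<^sup>2"
    using sc by (simp_all add: a_def b_def power2_eq_square algebra_simps)
  have ab: "a < b" using c by (simp add: a_def b_def power2_eq_square algebra_simps)
  have dens: "MP_density c x = sqrt ((b - x) * (x - a)) / (2 * pi * c * x) * indicator {a..b} x" for x
    unfolding MP_density_def Let_def a_def b_def by simp
  have dnn: "MP_density c x \<ge> 0" for x
    using c a0 by (auto simp: dens indicator_def intro!: divide_nonneg_nonneg mult_nonneg_nonneg)
  have dm [measurable]: "MP_density c \<in> borel_measurable borel"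
    unfolding MP_density_def[abs_def] Let_def by measurable
  have J: "((\<lambda>x. sqrt ((b - x) * (x - a)) / (x + t)) has_integral
      pi * (1 + c + t - sqrt ((1 - c + t)\<^sup>2 + 4 * c * t))) {a..b}" if "t \<ge> 0" for t
  proof -
    have "((\<lambda>u. sqrt ((b + t - u) * (u - (a + t))) / u) has_integral
        pi * ((a + t + (b + t)) / 2 - sqrt ((a + t) * (b + t)))) {a + t..b + t}"
      using a0 that ab by (intro integral_semicircle_over_linear) auto
    then have "((\<lambda>x. sqrt ((b + t - (x + t)) * ((x + t) - (a + t))) / (x + t)) has_integral
        pi * ((a + t + (b + t)) / 2 - sqrt ((a + t) * (b + t)))) {a..b}"
      using has_integral_shift_real_ivl[of "\<lambda>u. sqrt ((b + t - u) * (u - (a + t))) / u" _ "a + t" "b + t" t]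
      by simp
    moreover have "(a + t) * (b + t) = (1 - c + t)\<^sup>2 + 4 * c * t"
    proof -
      have "(a + t) * (b + t) = a * b + t * (a + b) + t * t" by (simp add: algebra_simps)
      then show ?thesis unfolding apb amb by (simp add: power2_eq_square algebra_simps)
    qed
    moreover have "(a + t + (b + t)) / 2 = 1 + c + t" using apb by simp
    ultimately show ?thesis by (simp only: add_diff_cancel_right add_diff_cancel_right')
  qed
  have I: "(\<integral>\<^sup>+x. ennreal (f x) * ennreal (MP_density c x) \<partial>lborel) = ennreal i"
    if "((\<lambda>x. f x * (sqrt ((b - x) * (x - a)) / (2 * pi * c * x))) has_integral i) {a..b}"
      "\<And>x. x \<ge> 0 \<Longrightarrow> f x \<ge> 0" for f i
  proof -
    have "(\<integral>\<^sup>+x. ennreal (indicator {a..b} x * (f x * (sqrt ((b - x) * (x - a)) / (2 * pi * c * x)))) \<partial>lborel)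
        = ennreal i"
      using that a0 c by (intro nn_integral_has_integral_lebesgue)
        (auto intro!: mult_nonneg_nonneg divide_nonneg_nonneg)
    moreover have "ennreal (f x) * ennreal (MP_density c x)
        = ennreal (indicator {a..b} x * (f x * (sqrt ((b - x) * (x - a)) / (2 * pi * c * x))))" for x
      using that(2)[of x] a0 dnn[of x] by (auto simp: dens indicator_def simp flip: ennreal_mult')
    ultimately show ?thesis by simp
  qed
  \<comment> \<open>For \<open>c > 1\<close> the density has mass \<open>1 / c\<close> and the atom
    supplies the rest.\<close>
  have mass: "emeasure (MP_law c) UNIV = 1"
  proof -
    have "((\<lambda>x. 1 * (sqrt ((b - x) * (x - a)) / (2 * pi * c * x))) has_integral
        (1 / (2 * pi * c)) * (pi * (1 + c - \<bar>1 - c\<bar>))) {a..b}"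
      using has_integral_mult_right[OF J[of 0], of "1 / (2 * pi * c)"] by (simp add: mult_ac)
    from I[OF this] have "(\<integral>\<^sup>+x. ennreal (MP_density c x) \<partial>lborel) = ennreal ((1 + c - \<bar>1 - c\<bar>) / (2 * c))"
      using c by (simp add: mult.assoc)
    then have "emeasure (MP_law c) UNIV = ennreal (max 0 (1 - 1 / c) + (1 + c - \<bar>1 - c\<bar>) / (2 * c))"
      using c by (simp add: emeasure_MP_law ennreal_plus)
    also have "max 0 (1 - 1 / c) + (1 + c - \<bar>1 - c\<bar>) / (2 * c) = 1"
      using c by (auto simp: max_def abs_if field_simps)
    finally show ?thesis by simp
  qed
  have sp: "space (MP_law c) = UNIV"
    using sets_eq_imp_space_eq[OF sets_MP_law] by simp
  show rd: "real_distribution (MP_law c)"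
    by (intro real_distribution.intro prob_spaceI) (auto simp: real_distribution_axioms_def mass sp)
  have "emeasure (MP_law c) {..<0} = 0"
  proof -
    have "indicator {..<0::real} x * MP_density c x = 0" for x
      using a0 by (auto simp: dens indicator_def)
    then have "ennreal (MP_density c x) * indicator {..<0} x = 0" for x
      using a0 by (cases "x < 0") (auto simp: dens)
    then have "(\<integral>\<^sup>+x\<in>{..<0}. ennreal (MP_density c x) \<partial>lborel) = 0"
      by (simp only: nn_integral_const mult_zero_left)
    then show ?thesis by (simp add: emeasure_MP_law)
  qed
  then show "AE x in MP_law c. x \<ge> 0"
    by (intro AE_I[of _ _ "{..<0}"]) (auto simp: sp)
  show "(\<integral>x. 1 / (x + t) \<partial>MP_law c) \<ge> 0" if "t > 0"
    by (rule integral_nonneg_AE, rule eventually_mono[OF \<open>AE x in MP_law c. x \<ge> 0\<close>]) (use that in auto)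
  show "let s = (\<integral>x. 1 / (x + t) \<partial>MP_law c) in t * s + s / (1 + c * s) = 1" if t: "t > 0"
  proof -
    define rt where "rt = sqrt ((1 - c + t)\<^sup>2 + 4 * c * t)"
    \<comment> \<open>Partial fractions:
      \<open>1 / (x (x + t)) = (1 / t) (1 / x - 1 / (x + t))\<close>, integrated with
      \<open>J\<close> at 0 and at \<open>t\<close>.\<close>
    define i where "i = (1 / (2 * pi * c * t)) * (pi * (1 + c - \<bar>1 - c\<bar>) - pi * (1 + c + t - rt))"
    have "((\<lambda>x. (1 / (2 * pi * c * t)) * (sqrt ((b - x) * (x - a)) / (x + 0) - sqrt ((b - x) * (x - a)) / (x + t)))
        has_integral i) {a..b}"
      unfolding i_def rt_def using has_integral_diff[OF J[of 0] J[of t]] t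
      by (intro has_integral_mult_right) simp
    then have "((\<lambda>x. 1 / (x + t) * (sqrt ((b - x) * (x - a)) / (2 * pi * c * x))) has_integral i) {a..b}"
    proof (rule has_integral_eq[rotated])
      fix x assume x: "x \<in> {a..b}"
      show "1 / (2 * pi * c * t) * (sqrt ((b - x) * (x - a)) / (x + 0) - sqrt ((b - x) * (x - a)) / (x + t))
          = 1 / (x + t) * (sqrt ((b - x) * (x - a)) / (2 * pi * c * x))"
      proof (cases "x = 0")
        \<comment> \<open>Possible only if \<open>a = 0\<close>; then the square root vanishes as
          well.\<close>
        case True
        then show ?thesis using x a0 by simp
      next
        case False
        then have "x > 0" using x a0 by auto
        then show ?thesis using t c by (simp add: divide_simps) (simp add: algebra_simps)
      qed
    qed
    from I[OF this] have i: "(\<integral>\<^sup>+x. ennreal (1 / (x + t)) * ennreal (MP_density c x) \<partial>lborel) = ennreal i"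
      using t by simp
    have rt: "rt * rt = (1 - c + t)\<^sup>2 + 4 * c * t" "rt \<ge> 0"
      using c t by (auto simp: rt_def)
    have i0: "i \<ge> 0"
    proof -
      have "rt \<ge> t + \<bar>1 - c\<bar>"
        unfolding rt_def using c t
        by (intro real_le_rsqrt) (auto simp: power2_eq_square algebra_simps abs_if)
      then show ?thesis using c t unfolding i_def by (auto simp flip: right_diff_distrib)
    qed
    \<comment> \<open>The atom at 0 contributes its mass divided by \<open>t\<close>. It also
      compensates \<open>|1 - c|\<close>, so that one formula for \<open>s\<close> covers
      \<open>c <= 1\<close> and \<open>c > 1\<close>.\<close>
    define s where "s = max 0 (1 - 1 / c) / t + i"
    have seq: "s = (rt - (1 - c + t)) / (2 * c * t)"
      using c t unfolding s_def i_def by (auto simp: max_def abs_if field_simps)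
    have "(\<integral>\<^sup>+x. ennreal (1 / (x + t)) \<partial>MP_law c) = ennreal s"
    proof -
      have "(\<integral>\<^sup>+x. ennreal (1 / (x + t)) \<partial>MP_law c) = ennreal (max 0 (1 - 1 / c)) * ennreal (1 / t) + ennreal i"
        using nn_integral_MP_law[of "\<lambda>x. ennreal (1 / (x + t))" c] i by simp
      also have "\<dots> = ennreal s"
        using i0 t by (simp add: s_def ennreal_plus) (auto simp: max_def ennreal_neg field_simps simp flip: ennreal_mult'')
      finally show ?thesis .
    qed
    moreover have s0: "s \<ge> 0" using i0 t by (simp add: s_def)
    ultimately have int: "(\<integral>x. 1 / (x + t) \<partial>MP_law c) = s"
      using \<open>AE x in MP_law c. x \<ge> 0\<close> t
      by (subst integral_eq_nn_integral) (auto cong: measurable_cong_sets elim!: eventually_mono)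
    have "(2 * c * t * s + (1 - c + t))\<^sup>2 = (1 - c + t)\<^sup>2 + 4 * c * t"
      using rt(1) c t unfolding seq by (simp add: power2_eq_square)
    then have "4 * c * t * (c * t * s * s + (1 - c + t) * s - 1) = 0"
      by (simp add: power2_eq_square algebra_simps)
    then have "c * t * s * s + (1 - c + t) * s = 1" using c t by simp
    moreover have "1 + c * s > 0" using c s0 by (simp add: add_pos_nonneg)
    ultimately have "t * s + s / (1 + c * s) = 1" by (simp add: field_simps)
    then show ?thesis by (simp add: int)
  qed
qed

section \<open>Weak convergence from Stieltjes transforms\<close>

text \<open>The remainder of the geometric expansion of \<open>y / (1 + u y)\<close> in powers of
  \<open>-u\<close>. Letting \<open>u\<close> tend to 0 isolates \<open>y ^ Suc k\<close> once the
  lower powers are known.\<close>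

lemma power_remainder_geometric:
  fixes u y :: real
  assumes u: "u > 0" and y: "y \<ge> 0"
  shows "(y / (1 + u * y) - (\<Sum>i<k. (- u) ^ i * y ^ Suc i)) / (- u) ^ k = y ^ Suc k / (1 + u * y)"
proof -
  have p: "1 + u * y > 0" using u y by (simp add: add_pos_nonneg)
  define S where "S = (\<Sum>i<k. (- u) ^ i * y ^ Suc i)"
  define P where "P = (- u) ^ k"
  have P: "P \<noteq> 0" using u by (simp add: P_def)
  have "(1 + u * y) * (\<Sum>i<k. (- u * y) ^ i) = 1 - (- u * y) ^ k"
    using one_diff_power_eq[of "- u * y" k] by simp
  moreover have "S = y * (\<Sum>i<k. (- u * y) ^ i)"
    unfolding S_def sum_distrib_left
    by (intro sum.cong refl) (simp only: power_mult_distrib power_Suc mult_ac)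
  moreover have "(- u * y) ^ k = P * y ^ k"
    by (simp only: P_def power_mult_distrib)
  ultimately have "(1 + u * y) * S = y * (1 - P * y ^ k)"
    by (metis mult.left_commute)
  then have "S = y * (1 - P * y ^ k) / (1 + u * y)"
    using p by (simp add: field_simps)
  then have "y / (1 + u * y) - S = P * (y * y ^ k) / (1 + u * y)"
    by (simp add: right_diff_distrib diff_divide_distrib mult_ac)
  then show ?thesis unfolding S_def[symmetric] P_def[symmetric] using P by simp
qed

text \<open>Stieltjes transforms at \<open>-t\<close> for \<open>t\<close> accumulating at 1 determine the integrals of all
  powers of \<open>1 / (1 + z)\<close>, hence by Weierstrass those of all continuous functions of it.\<close>

lemma weak_conv_of_stieltjes:
  fixes \<mu> :: "nat \<Rightarrow> real measure" and \<nu> :: "real measure"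
  assumes \<mu>: "\<And>n. real_distribution (\<mu> n)" "\<And>n. AE z in \<mu> n. z \<ge> 0"
    and \<nu>: "real_distribution \<nu>" "AE z in \<nu>. z \<ge> 0"
    and conv: "\<And>j. (\<lambda>n. \<integral>z. 1 / (z + (1 + 1 / real (Suc j))) \<partial>\<mu> n)
      \<longlonglongrightarrow> (\<integral>z. 1 / (z + (1 + 1 / real (Suc j))) \<partial>\<nu>)"
  shows "weak_conv_m \<mu> \<nu>"
proof -
  \<comment> \<open>\<open>max z 0\<close> makes \<open>Y\<close> continuous on the whole line with
    values in \<open>(0, 1]\<close>; it is \<open>1 / (1 + z)\<close> where the measures
    live.\<close>
  define Y :: "real \<Rightarrow> real" where "Y = (\<lambda>z. 1 / (1 + max z 0))"
  have Y01: "Y z \<in> {0..1}" and Ypos: "Y z > 0" for z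
    by (auto simp: Y_def divide_le_eq_1)
  have contY: "continuous_on UNIV Y"
    unfolding Y_def by (intro continuous_intros) (auto simp: add_pos_nonneg add_nonneg_eq_0_iff)
  have meas: "(\<lambda>z. f (Y z)) \<in> borel_measurable borel" if "continuous_on {0..1} f" for f :: "real \<Rightarrow> real"
    by (intro borel_measurable_continuous_onI continuous_on_compose2[OF that contY]) (use Y01 in auto)
  have bnd: "\<exists>B. \<forall>z. \<bar>f (Y z)\<bar> \<le> B" if f: "continuous_on {0..1} f" for f :: "real \<Rightarrow> real"
  proof -
    obtain B where "\<forall>x\<in>{0..1}. \<bar>f x\<bar> \<le> B"
      using compact_imp_bounded[OF compact_continuous_image[OF f compact_Icc]]
      by (auto simp: bounded_iff)
    then show ?thesis using Y01 by blast
  qed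
  have int: "integrable M (\<lambda>z. f (Y z))"
    if f: "continuous_on {0..1} f" and M: "real_distribution M" for f :: "real \<Rightarrow> real" and M
  proof -
    interpret real_distribution M by (rule M)
    obtain B where "\<forall>z. \<bar>f (Y z)\<bar> \<le> B" using bnd[OF f] by blast
    then show ?thesis using meas[OF f]
      by (intro integrable_const_bound[of _ B]) (auto cong: measurable_cong_sets)
  qed
  have mass1: "measure M UNIV = 1" if "real_distribution M" for M
  proof -
    interpret real_distribution M by fact
    show ?thesis using prob_space space_eq_univ by metis
  qed
  \<comment> \<open>The class of test functions for which convergence holds. It is a vector space
    closed under uniform limits (\<open>C_unif\<close>); as \<open>Y\<close> never vanishes,
    approximation on \<open>(0, 1]\<close> is enough.\<close>
  define C where "C = (\<lambda>f::real \<Rightarrow> real. continuous_on {0..1} f \<and>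
    (\<lambda>n. \<integral>z. f (Y z) \<partial>\<mu> n) \<longlonglongrightarrow> (\<integral>z. f (Y z) \<partial>\<nu>))"
  have C_const: "C (\<lambda>_. a)" for a
  proof -
    have "(\<integral>z. a \<partial>M) = a" if "real_distribution M" for M
    proof -
      interpret real_distribution M by fact
      show ?thesis using mass1[OF that] by simp
    qed
    then show ?thesis unfolding C_def using \<mu>(1) \<nu>(1) by (simp del: Bochner_Integration.lebesgue_integral_const)
  qed
  have C_add: "C (\<lambda>y. f y + g y)" if "C f" "C g" for f g
    using that \<mu>(1) \<nu>(1) by (auto simp: C_def int intro!: continuous_intros tendsto_add)
  have C_scale: "C (\<lambda>y. a * f y)" if "C f" for a f
    using that by (auto simp: C_def intro!: continuous_intros tendsto_mult_left)
  have C_sum: "C (\<lambda>y. \<Sum>i\<in>A. f i y)" if "finite A" "\<And>i. i \<in> A \<Longrightarrow> C (f i)" for A :: "nat set" and f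
    using that by (induction A rule: finite_induct) (auto intro: C_const C_add)
  have C_unif: "C f" if f: "continuous_on {0..1} f"
    and app: "\<And>e. e > 0 \<Longrightarrow> \<exists>g. C g \<and> (\<forall>y\<in>{0<..1}. \<bar>f y - g y\<bar> \<le> e)" for f
    unfolding C_def
  proof (intro conjI f LIMSEQ_I)
    fix e :: real assume "e > 0"
    then obtain g where g: "C g" "\<forall>y\<in>{0<..1}. \<bar>f y - g y\<bar> \<le> e / 4" using app[of "e / 4"] by auto
    have gc: "continuous_on {0..1} g" using g by (simp add: C_def)
    have cl: "\<bar>(\<integral>z. f (Y z) \<partial>M) - (\<integral>z. g (Y z) \<partial>M)\<bar> \<le> e / 4" if M: "real_distribution M" for M
    proof -
      interpret real_distribution M by fact
      have "\<bar>(\<integral>z. f (Y z) \<partial>M) - (\<integral>z. g (Y z) \<partial>M)\<bar> = \<bar>\<integral>z. f (Y z) - g (Y z) \<partial>M\<bar>"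
        using int[OF f M] int[OF gc M] by simp
      also have "\<dots> \<le> (\<integral>z. \<bar>f (Y z) - g (Y z)\<bar> \<partial>M)" by (rule integral_abs_bound)
      also have "\<dots> \<le> (\<integral>z. e / 4 \<partial>M)"
        using int[OF f M] int[OF gc M] g(2) Y01 Ypos by (intro integral_mono) auto
      finally show ?thesis using mass1[OF M] by simp
    qed
    have "(\<lambda>n. \<integral>z. g (Y z) \<partial>\<mu> n) \<longlonglongrightarrow> (\<integral>z. g (Y z) \<partial>\<nu>)" using g by (simp add: C_def)
    then obtain N where N: "\<And>n. n \<ge> N \<Longrightarrow> \<bar>(\<integral>z. g (Y z) \<partial>\<mu> n) - (\<integral>z. g (Y z) \<partial>\<nu>)\<bar> < e / 4"
      using \<open>e > 0\<close> LIMSEQ_D[of _ _ "e / 4"] by (metis divide_pos_pos real_norm_def zero_less_numeral)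
    show "\<exists>N. \<forall>n\<ge>N. norm ((\<integral>z. f (Y z) \<partial>\<mu> n) - (\<integral>z. f (Y z) \<partial>\<nu>)) < e"
      using N cl[OF \<mu>(1)] cl[OF \<nu>(1)] \<open>e > 0\<close>
      by (intro exI[of _ N]) (auto simp: abs_le_iff abs_less_iff, (smt (verit) field_sum_of_halves)+)
  qed
  \<comment> \<open>With \<open>y = 1 / (1 + z)\<close>,
    \<open>1 / (z + 1 + u) = y / (1 + u y)\<close>: this is what the hypothesis supplies, for
    \<open>u = 1 / Suc j\<close>.\<close>
  have C_stieltjes: "C (\<lambda>y. y / (1 + 1 / real (Suc j) * y))" for j
  proof -
    let ?t = "1 + 1 / real (Suc j)"
    have eq: "(\<integral>z. 1 / (z + ?t) \<partial>M) = (\<integral>z. Y z / (1 + 1 / real (Suc j) * Y z) \<partial>M)"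
      if "real_distribution M" "AE z in M. z \<ge> 0" for M
    proof -
      interpret real_distribution M by fact
      have "1 / (z + ?t) = Y z / (1 + 1 / real (Suc j) * Y z)" if "z \<ge> 0" for z
      proof -
        have "Y z / (1 + 1 / real (Suc j) * Y z) = 1 / (1 / Y z + 1 / real (Suc j))"
          using Ypos[of z] by (simp add: divide_simps)
        then show ?thesis using that by (simp add: Y_def)
      qed
      with that(2) have "AE z in M. 1 / (z + ?t) = Y z / (1 + 1 / real (Suc j) * Y z)"
        by (auto elim: eventually_mono)
      then show ?thesis
        by (intro integral_cong_AE) (auto simp: Y_def cong: measurable_cong_sets)
    qed
    have pos: "1 + 1 / real (Suc j) * y \<noteq> 0" if "y \<in> {0..1}" for y :: real
      using that by (auto simp: add_nonneg_eq_0_iff)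
    show ?thesis unfolding C_def
      using conv[of j] eq[OF \<mu>] eq[OF \<nu>] pos by (auto intro!: continuous_intros)
  qed
  have C_power: "C (\<lambda>y. y ^ k)" for k
  proof (induction k rule: less_induct)
    case (less k)
    show ?case
    proof (cases k)
      case 0
      then show ?thesis using C_const by simp
    next
      case (Suc k')
      show ?thesis
      proof (rule C_unif)
        fix e :: real assume "e > 0"
        then obtain j where j: "1 / real (Suc j) < e" using nat_approx_posE by blast
        define u where "u = 1 / real (Suc j)"
        have u: "u > 0" by (simp add: u_def)
        \<comment> \<open>By \<open>power_remainder_geometric\<close>,
          \<open>g y = y ^ k / (1 + u y)\<close>, which is within \<open>u\<close> of
          \<open>y ^ k\<close> on \<open>(0, 1]\<close>; the powers in \<open>g\<close> are below
          \<open>k\<close> and so covered by the induction hypothesis.\<close>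
        define g where "g = (\<lambda>y. (1 / (- u) ^ k') * (y / (1 + u * y) + (\<Sum>i<k'. - ((- u) ^ i) * y ^ Suc i)))"
        have "C g" unfolding g_def
        proof (intro C_scale C_add C_sum)
          show "C (\<lambda>y. y / (1 + u * y))" using C_stieltjes[of j] by (simp add: u_def)
          show "C (\<lambda>y. y ^ Suc i)" if "i \<in> {..<k'}" for i
            using less.IH[of "Suc i"] that Suc by simp
        qed auto
        moreover have "\<bar>y ^ k - g y\<bar> \<le> e" if y: "y \<in> {0<..1}" for y
        proof -
          have "g y = (y / (1 + u * y) - (\<Sum>i<k'. (- u) ^ i * y ^ Suc i)) / (- u) ^ k'"
            by (simp add: g_def sum_negf)
          also have "\<dots> = y ^ k / (1 + u * y)"
            using power_remainder_geometric[OF u, of y k'] y Suc by simp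
          finally have gy: "g y = y ^ k / (1 + u * y)" .
          have "y ^ k - g y = y ^ k * (u * y) / (1 + u * y)"
          proof -
            have "1 + u * y > 0" using u y by (simp add: add_pos_pos)
            then have "y ^ k - y ^ k / (1 + u * y) = y ^ k * (u * y) / (1 + u * y)"
              by (simp add: divide_simps) (simp add: algebra_simps)
            then show ?thesis by (simp add: gy)
          qed
          moreover have "0 \<le> y ^ k * (u * y) / (1 + u * y)" using u y by simp
          moreover have "y ^ k * (u * y) / (1 + u * y) \<le> u"
          proof -
            have "y ^ k * (u * y) \<le> 1 * (u * 1)"
              using y u by (intro mult_mono power_le_one) auto
            also have "\<dots> \<le> u * (1 + u * y)" using u y by simp
            finally show ?thesis using u y by (simp add: divide_le_eq add_pos_pos)
          qed
          ultimately show ?thesis using j unfolding u_def[symmetric] by linarith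
        qed
        ultimately show "\<exists>g. C g \<and> (\<forall>y\<in>{0<..1}. \<bar>y ^ k - g y\<bar> \<le> e)" by blast
      qed (intro continuous_intros)
    qed
  qed
  have C_all: "C f" if f: "continuous_on {0..1} f" for f
  proof (rule C_unif[OF f])
    fix e :: real assume "e > 0"
    obtain g where g: "real_polynomial_function g" "\<And>x. x \<in> {0..1} \<Longrightarrow> \<bar>f x - g x\<bar> < e"
      using Stone_Weierstrass_real_polynomial_function[OF compact_Icc f \<open>e > 0\<close>] by blast
    from g(1) obtain a n where "g = (\<lambda>x. \<Sum>i\<le>n. a i * x ^ i)"
      by (auto simp: real_polynomial_function_iff_sum)
    then have "C g" by (auto intro!: C_sum C_scale C_power)
    with g(2) show "\<exists>g. C g \<and> (\<forall>y\<in>{0<..1}. \<bar>f y - g y\<bar> \<le> e)"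
      by (intro exI[of _ g]) (auto intro: less_imp_le)
  qed
  show ?thesis
  proof (rule integral_cts_step_conv_imp_weak_conv[OF \<mu>(1) \<nu>(1)])
    fix a b :: real assume ab: "a < b"
    \<comment> \<open>For \<open>z >= 0\<close>, \<open>Y z < \<delta>\<close> means
      \<open>z > 1 + |b|\<close>, where the step function is already 0; cutting off at \<delta>
      removes the singularity of \<open>1 / y\<close> at 0.\<close>
    define \<delta> where "\<delta> = 1 / (2 + \<bar>b\<bar>)"
    have \<delta>: "\<delta> > 0" by (simp add: \<delta>_def add_pos_nonneg)
    define g where "g = (\<lambda>y. cts_step a b (1 / max y \<delta> - 1))"
    have "continuous_on {0..1} g"
      unfolding g_def
    proof (rule continuous_on_compose2[OF uniformly_continuous_imp_continuous[OF cts_step_uniformly_continuous[OF ab]]])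
      show "continuous_on {0..1} (\<lambda>y. 1 / max y \<delta> - 1)"
        using \<delta> by (intro continuous_intros) auto
    qed simp
    then have "C g" by (rule C_all)
    moreover have "(\<integral>z. g (Y z) \<partial>M) = (\<integral>z. cts_step a b z \<partial>M)"
      if "real_distribution M" "AE z in M. z \<ge> 0" for M
    proof -
      interpret real_distribution M by fact
      have "g (Y z) = cts_step a b z" if "z \<ge> 0" for z
      proof (cases "Y z \<ge> \<delta>")
        case True
        then show ?thesis using that by (simp add: g_def Y_def max_def)
      next
        case False
        then have "1 / (1 + z) < 1 / (2 + \<bar>b\<bar>)" using that by (simp add: Y_def \<delta>_def)
        then have "2 + \<bar>b\<bar> < 1 + z" using that by (simp add: field_simps)
        then have "z \<ge> b" by linarith
        moreover have "1 / max (Y z) \<delta> - 1 = 1 + \<bar>b\<bar>" using False by (simp add: max_def \<delta>_def)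
        ultimately show ?thesis using ab by (auto simp: g_def cts_step_def)
      qed
      with that(2) have "AE z in M. g (Y z) = cts_step a b z" by (auto elim: eventually_mono)
      then show ?thesis
        using meas[OF \<open>continuous_on {0..1} g\<close>] integrable_cts_step[OF ab]
        by (intro integral_cong_AE) (auto cong: measurable_cong_sets dest: borel_measurable_integrable)
    qed
    ultimately show "(\<lambda>n. integral\<^sup>L (\<mu> n) (cts_step a b)) \<longlonglongrightarrow> integral\<^sup>L \<nu> (cts_step a b)"
      using \<mu> \<nu> by (simp add: C_def)
  qed
qed

section \<open>Moments of exchangeable unconditional vectors\<close>

locale sym_vector = prob_space N for N :: "'b measure" +
  fixes n :: nat and X :: "nat \<Rightarrow> 'b \<Rightarrow> real"
  assumes X_meas: "\<And>i. i \<in> {1..n} \<Longrightarrow> X i \<in> borel_measurable N"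
    and exch: "exchangeable N n X"
    and uncond: "unconditional N n X"
begin

abbreviation vec_space :: "(nat \<Rightarrow> real) measure" where
  "vec_space \<equiv> Pi\<^sub>M {1..n} (\<lambda>_. borel)"

text \<open>Moments of nonnegative quantities are nonnegative integrals, so that products of sums
  can be expanded before finiteness is known.\<close>

abbreviation E :: "('b \<Rightarrow> ennreal) \<Rightarrow> ennreal" where
  "E f \<equiv> (\<integral>\<^sup>+\<omega>. f \<omega> \<partial>N)"

lemma X_vec_meas: "\<sigma> permutes {1..n} \<Longrightarrow> (\<lambda>\<omega>. \<lambda>i\<in>{1..n}. X (\<sigma> i) \<omega>) \<in> measurable N vec_space"
  by (intro measurable_restrict X_meas) (auto dest: permutes_in_image)

lemma X_vec_meas_id: "(\<lambda>\<omega>. \<lambda>i\<in>{1..n}. X i \<omega>) \<in> measurable N vec_space"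
  by (intro measurable_restrict X_meas)

lemma nn_integral_permute:
  assumes h: "h \<in> borel_measurable vec_space" and \<sigma>: "\<sigma> permutes {1..n}"
  shows "E (\<lambda>\<omega>. h (\<lambda>i\<in>{1..n}. X i \<omega>)) = E (\<lambda>\<omega>. h (\<lambda>i\<in>{1..n}. X (\<sigma> i) \<omega>))"
proof -
  have "E (\<lambda>\<omega>. h (\<lambda>i\<in>{1..n}. X i \<omega>))
      = (\<integral>\<^sup>+z. h z \<partial>distr N vec_space (\<lambda>\<omega>. \<lambda>i\<in>{1..n}. X i \<omega>))"
    using h by (intro nn_integral_distr[OF X_vec_meas_id, symmetric]) simp
  also have "distr N vec_space (\<lambda>\<omega>. \<lambda>i\<in>{1..n}. X i \<omega>)
      = distr N vec_space (\<lambda>\<omega>. \<lambda>i\<in>{1..n}. X (\<sigma> i) \<omega>)"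
    using exch \<sigma> by (simp add: exchangeable_def)
  also have "(\<integral>\<^sup>+z. h z \<partial>distr N vec_space (\<lambda>\<omega>. \<lambda>i\<in>{1..n}. X (\<sigma> i) \<omega>))
      = E (\<lambda>\<omega>. h (\<lambda>i\<in>{1..n}. X (\<sigma> i) \<omega>))"
    using h by (intro nn_integral_distr[OF X_vec_meas[OF \<sigma>]]) simp
  finally show ?thesis .
qed

text \<open>A symmetric weight carried along by the expansions below; it holds the factors not yet
  expanded. The case of the identity permutation says that coordinates outside \<open>{1..n}\<close>
  do not matter.\<close>

definition symf :: "((nat \<Rightarrow> real) \<Rightarrow> ennreal) \<Rightarrow> bool" where
  "symf Z \<longleftrightarrow> Z \<in> borel_measurable vec_space \<and>
    (\<forall>z \<sigma>. \<sigma> permutes {1..n} \<longrightarrow> Z (\<lambda>i\<in>{1..n}. z (\<sigma> i)) = Z z)"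

lemma symfD: "symf Z \<Longrightarrow> \<sigma> permutes {1..n} \<Longrightarrow> Z (\<lambda>i\<in>{1..n}. z (\<sigma> i)) = Z z"
  and symf_meas: "symf Z \<Longrightarrow> Z \<in> borel_measurable vec_space"
  by (auto simp: symf_def)

lemma symf_restrict: "symf Z \<Longrightarrow> Z (\<lambda>i\<in>{1..n}. z i) = Z z"
  using symfD[of Z id] by (simp add: permutes_id)

lemma symf_X_meas:
  assumes Z: "symf Z"
  shows "(\<lambda>\<omega>. Z (\<lambda>i. X i \<omega>)) \<in> borel_measurable N"
  using measurable_compose[OF X_vec_meas_id symf_meas[OF Z]] unfolding symf_restrict[OF Z] .

lemma symf_const: "symf (\<lambda>_. a)"
  and symf_mult: "symf Z \<Longrightarrow> symf W \<Longrightarrow> symf (\<lambda>z. Z z * W z)"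
  and symf_power: "symf Z \<Longrightarrow> symf (\<lambda>z. Z z ^ k)"
  by (auto simp: symf_def)

lemma symf_sum:
  assumes [measurable]: "u \<in> borel_measurable borel"
  shows "symf (\<lambda>z. \<Sum>i=1..n. u (z i))"
  unfolding symf_def
proof (intro conjI allI impI)
  fix z :: "nat \<Rightarrow> real" and \<sigma> assume "\<sigma> permutes {1..n}"
  then have "bij_betw \<sigma> {1..n} {1..n}" by (rule permutes_imp_bij)
  then have "(\<Sum>i=1..n. u (z (\<sigma> i))) = (\<Sum>i=1..n. u (z i))"
    by (rule sum.reindex_bij_betw)
  then show "(\<Sum>i=1..n. u ((\<lambda>i\<in>{1..n}. z (\<sigma> i)) i)) = (\<Sum>i=1..n. u (z i))" by simp
qed measurable

lemma component_meas:
  assumes "u \<in> borel_measurable borel" "i \<in> {1..n}"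
  shows "(\<lambda>z. u (z i) :: ennreal) \<in> borel_measurable vec_space"
  by (rule measurable_compose[OF measurable_component_singleton[OF assms(2)] assms(1)])

lemma prod_X_meas:
  assumes "B \<subseteq> {1..n}" "\<And>i. v i \<in> borel_measurable borel"
  shows "(\<lambda>\<omega>. \<Prod>i\<in>B. v i (X i \<omega>) :: ennreal) \<in> borel_measurable N"
  using assms by (intro borel_measurable_prod_ennreal measurable_compose[OF X_meas]) auto

text \<open>The transposition of \<open>Suc j\<close> and \<alpha> leaves the first \<open>j\<close>
  coordinates alone.\<close>

lemma swap_index:
  fixes v :: "nat \<Rightarrow> real \<Rightarrow> ennreal"
  assumes Z: "symf Z" and v: "\<And>i. v i \<in> borel_measurable borel"
    and u: "u \<in> borel_measurable borel" and j: "j < n" and \<alpha>: "\<alpha> \<in> {Suc j..n}"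
  shows "E (\<lambda>\<omega>. (\<Prod>i=1..j. v i (X i \<omega>)) * u (X \<alpha> \<omega>) * Z (\<lambda>i. X i \<omega>))
    = E (\<lambda>\<omega>. (\<Prod>i=1..j. v i (X i \<omega>)) * u (X (Suc j) \<omega>) * Z (\<lambda>i. X i \<omega>))"
proof -
  let ?\<sigma> = "Transposition.transpose (Suc j) \<alpha>"
  define h where "h = (\<lambda>z. (\<Prod>i=1..j. v i (z i)) * u (z (Suc j)) * Z z)"
  have \<sigma>: "?\<sigma> permutes {1..n}" using j \<alpha> by (intro permutes_swap_id) auto
  have h: "h \<in> borel_measurable vec_space"
    unfolding h_def using j
    by (intro borel_measurable_times_ennreal borel_measurable_prod_ennreal symf_meas[OF Z]
        component_meas v u) auto
  have 1: "h (\<lambda>i\<in>{1..n}. X i \<omega>) = (\<Prod>i=1..j. v i (X i \<omega>)) * u (X (Suc j) \<omega>) * Z (\<lambda>i. X i \<omega>)" for \<omega>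
    using j unfolding h_def symf_restrict[OF Z]
    by (intro arg_cong2[of _ _ _ _ times] prod.cong) auto
  have 2: "h (\<lambda>i\<in>{1..n}. X (?\<sigma> i) \<omega>) = (\<Prod>i=1..j. v i (X i \<omega>)) * u (X \<alpha> \<omega>) * Z (\<lambda>i. X i \<omega>)" for \<omega>
    using j \<alpha> unfolding h_def symfD[OF Z \<sigma>, of "\<lambda>i. X i \<omega>"]
    by (intro arg_cong2[of _ _ _ _ times] prod.cong) (auto simp: Transposition.transpose_def)
  show ?thesis using nn_integral_permute[OF h \<sigma>] unfolding 1 2 by simp
qed

text \<open>One factor \<open>\<Sum> u (X \<alpha>)\<close> is expanded: the \<open>n - j\<close>
  indices not yet used contribute equally, the others repeat an index.\<close>

lemma nn_integral_prod_sum_split: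
  fixes v :: "nat \<Rightarrow> real \<Rightarrow> ennreal"
  assumes Z: "symf Z" and v: "\<And>i. v i \<in> borel_measurable borel"
    and u: "u \<in> borel_measurable borel" and j: "j < n"
  shows "E (\<lambda>\<omega>. (\<Prod>i=1..j. v i (X i \<omega>)) * (\<Sum>\<alpha>=1..n. u (X \<alpha> \<omega>)) * Z (\<lambda>i. X i \<omega>))
    = of_nat (n - j) * E (\<lambda>\<omega>. (\<Prod>i=1..j. v i (X i \<omega>)) * u (X (Suc j) \<omega>) * Z (\<lambda>i. X i \<omega>))
      + (\<Sum>\<alpha>=1..j. E (\<lambda>\<omega>. (\<Prod>i=1..j. v i (X i \<omega>)) * u (X \<alpha> \<omega>) * Z (\<lambda>i. X i \<omega>)))"
proof -
  let ?f = "\<lambda>\<alpha>. E (\<lambda>\<omega>. (\<Prod>i=1..j. v i (X i \<omega>)) * u (X \<alpha> \<omega>) * Z (\<lambda>i. X i \<omega>))"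
  have "E (\<lambda>\<omega>. (\<Prod>i=1..j. v i (X i \<omega>)) * (\<Sum>\<alpha>=1..n. u (X \<alpha> \<omega>)) * Z (\<lambda>i. X i \<omega>))
      = E (\<lambda>\<omega>. \<Sum>\<alpha>=1..n. (\<Prod>i=1..j. v i (X i \<omega>)) * u (X \<alpha> \<omega>) * Z (\<lambda>i. X i \<omega>))"
    by (simp add: sum_distrib_left sum_distrib_right)
  also have "\<dots> = (\<Sum>\<alpha>=1..n. ?f \<alpha>)"
    using j by (intro nn_integral_sum borel_measurable_times_ennreal prod_X_meas v symf_X_meas[OF Z]
      measurable_compose[OF X_meas u]) auto
  also have "\<dots> = (\<Sum>\<alpha>\<in>{1..j} \<union> {Suc j..n}. ?f \<alpha>)"
    using j by (intro sum.cong) auto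
  also have "\<dots> = (\<Sum>\<alpha>=1..j. ?f \<alpha>) + (\<Sum>\<alpha>=Suc j..n. ?f \<alpha>)"
    by (intro sum.union_disjoint) auto
  also have "(\<Sum>\<alpha>=Suc j..n. ?f \<alpha>) = (\<Sum>\<alpha>=Suc j..n. ?f (Suc j))"
    by (intro sum.cong refl swap_index Z v u j)
  finally show ?thesis by (simp add: add.commute)
qed

text \<open>Dropping the repeated indices in each of the \<open>k\<close> factors leaves the falling
  product \<open>(n - j) (n - j - 1) ...\<close>. The factors still to be expanded are absorbed into
  \<open>Z\<close>, which is therefore arbitrary in the induction.\<close>

lemma nn_integral_falling_le:
  fixes v :: "nat \<Rightarrow> real \<Rightarrow> ennreal"
  assumes v: "\<And>i. v i \<in> borel_measurable borel" and u: "u \<in> borel_measurable borel"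
    and Z: "symf Z" and jk: "j + k \<le> n"
  shows "(\<Prod>i<k. of_nat (n - j - i)) *
      E (\<lambda>\<omega>. (\<Prod>i=1..j. v i (X i \<omega>)) * (\<Prod>i=Suc j..j + k. u (X i \<omega>)) * Z (\<lambda>i. X i \<omega>))
    \<le> E (\<lambda>\<omega>. (\<Prod>i=1..j. v i (X i \<omega>)) * (\<Sum>i=1..n. u (X i \<omega>)) ^ k * Z (\<lambda>i. X i \<omega>))"
  using Z jk
proof (induction k arbitrary: Z)
  case (Suc k)
  define v' where "v' = (\<lambda>i. if i \<le> j then v i else u)"
  have v': "v' i \<in> borel_measurable borel" for i using v u by (simp add: v'_def)
  have pv: "(\<Prod>i=1..j + k. v' i (X i \<omega>)) = (\<Prod>i=1..j. v i (X i \<omega>)) * (\<Prod>i=Suc j..j + k. u (X i \<omega>))" for \<omega>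
  proof -
    have "(\<Prod>i=1..j + k. v' i (X i \<omega>)) = (\<Prod>i\<in>{1..j} \<union> {Suc j..j + k}. v' i (X i \<omega>))"
      by (intro prod.cong) auto
    also have "\<dots> = (\<Prod>i=1..j. v' i (X i \<omega>)) * (\<Prod>i=Suc j..j + k. v' i (X i \<omega>))"
      by (intro prod.union_disjoint) auto
    also have "\<dots> = (\<Prod>i=1..j. v i (X i \<omega>)) * (\<Prod>i=Suc j..j + k. u (X i \<omega>))"
      by (intro arg_cong2[of _ _ _ _ times] prod.cong) (auto simp: v'_def)
    finally show ?thesis .
  qed
  have ZS: "symf (\<lambda>z. (\<Sum>i=1..n. u (z i)) * Z z)"
    by (intro symf_mult symf_sum u Suc.prems)
  have "of_nat (n - (j + k)) * E (\<lambda>\<omega>. (\<Prod>i=1..j + k. v' i (X i \<omega>)) * u (X (Suc (j + k)) \<omega>) * Z (\<lambda>i. X i \<omega>))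
      \<le> E (\<lambda>\<omega>. (\<Prod>i=1..j + k. v' i (X i \<omega>)) * (\<Sum>\<alpha>=1..n. u (X \<alpha> \<omega>)) * Z (\<lambda>i. X i \<omega>))"
    using Suc.prems by (subst nn_integral_prod_sum_split[OF Suc.prems(1) v' u]) auto
  then have step: "of_nat (n - j - k) * E (\<lambda>\<omega>. (\<Prod>i=1..j. v i (X i \<omega>)) * (\<Prod>i=Suc j..j + Suc k. u (X i \<omega>)) * Z (\<lambda>i. X i \<omega>))
      \<le> E (\<lambda>\<omega>. (\<Prod>i=1..j. v i (X i \<omega>)) * (\<Prod>i=Suc j..j + k. u (X i \<omega>)) * ((\<Sum>\<alpha>=1..n. u (X \<alpha> \<omega>)) * Z (\<lambda>i. X i \<omega>)))"
    unfolding pv by (simp add: mult_ac)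
  have "(\<Prod>i<Suc k. of_nat (n - j - i)) *
      E (\<lambda>\<omega>. (\<Prod>i=1..j. v i (X i \<omega>)) * (\<Prod>i=Suc j..j + Suc k. u (X i \<omega>)) * Z (\<lambda>i. X i \<omega>))
    = (\<Prod>i<k. of_nat (n - j - i)) * (of_nat (n - j - k) *
      E (\<lambda>\<omega>. (\<Prod>i=1..j. v i (X i \<omega>)) * (\<Prod>i=Suc j..j + Suc k. u (X i \<omega>)) * Z (\<lambda>i. X i \<omega>)))"
    by (simp only: prod.lessThan_Suc mult.assoc)
  also have "\<dots> \<le> (\<Prod>i<k. of_nat (n - j - i)) *
      E (\<lambda>\<omega>. (\<Prod>i=1..j. v i (X i \<omega>)) * (\<Prod>i=Suc j..j + k. u (X i \<omega>)) * ((\<Sum>\<alpha>=1..n. u (X \<alpha> \<omega>)) * Z (\<lambda>i. X i \<omega>)))"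
    by (intro mult_left_mono step) auto
  also have "\<dots> \<le> E (\<lambda>\<omega>. (\<Prod>i=1..j. v i (X i \<omega>)) * (\<Sum>i=1..n. u (X i \<omega>)) ^ k * ((\<Sum>\<alpha>=1..n. u (X \<alpha> \<omega>)) * Z (\<lambda>i. X i \<omega>)))"
    using Suc.IH[OF ZS] Suc.prems by simp
  finally show ?case by (simp add: mult_ac)
qed simp

lemma exists_permutation_onto:
  assumes B: "B \<subseteq> {1..n}" "card B = k"
  shows "\<exists>\<sigma>. \<sigma> permutes {1..n} \<and> \<sigma> ` {1..k} = B"
proof -
  have fB: "finite B" using B(1) finite_subset by blast
  have k: "k \<le> n" using card_mono[OF _ B(1)] B(2) by simp
  obtain f where f: "bij_betw f {1..k} B"
    using finite_same_card_bij[of "{1..k}" B] fB B(2) by auto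
  have "card {Suc k..n} = card ({1..n} - B)" using B fB by (simp add: card_Diff_subset)
  then obtain g where g: "bij_betw g {Suc k..n} ({1..n} - B)"
    using finite_same_card_bij[of "{Suc k..n}" "{1..n} - B"] by auto
  define \<sigma> where "\<sigma> = (\<lambda>i. if i \<in> {1..k} then f i else if i \<in> {Suc k..n} then g i else i)"
  have 1: "bij_betw \<sigma> {1..k} B" using f by (rule bij_betw_cong[THEN iffD1, rotated]) (auto simp: \<sigma>_def)
  have 2: "bij_betw \<sigma> {Suc k..n} ({1..n} - B)"
    using g by (rule bij_betw_cong[THEN iffD1, rotated]) (auto simp: \<sigma>_def)
  have "bij_betw \<sigma> ({1..k} \<union> {Suc k..n}) (B \<union> ({1..n} - B))"
    by (rule bij_betw_combine[OF 1 2]) auto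
  moreover have "{1..k} \<union> {Suc k..n} = {1..n}" "B \<union> ({1..n} - B) = {1..n}" using k B by auto
  ultimately have "\<sigma> permutes {1..n}"
    by (intro bij_imp_permutes) (auto simp: \<sigma>_def)
  then show ?thesis using 1 by (auto simp: bij_betw_def)
qed

lemma nn_integral_prod_set:
  assumes Z: "symf Z" and u: "u \<in> borel_measurable borel" and B: "B \<subseteq> {1..n}" "card B = k"
  shows "E (\<lambda>\<omega>. (\<Prod>i\<in>B. u (X i \<omega>)) * Z (\<lambda>i. X i \<omega>))
    = E (\<lambda>\<omega>. (\<Prod>i=1..k. u (X i \<omega>)) * Z (\<lambda>i. X i \<omega>))"
proof -
  obtain \<sigma> where \<sigma>: "\<sigma> permutes {1..n}" "\<sigma> ` {1..k} = B" using exists_permutation_onto[OF B] by blast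
  have k: "k \<le> n" using card_mono[OF _ B(1)] B(2) by simp
  define h where "h = (\<lambda>z. (\<Prod>i=1..k. u (z i)) * Z z)"
  have h: "h \<in> borel_measurable vec_space"
    unfolding h_def using k
    by (intro borel_measurable_times_ennreal borel_measurable_prod_ennreal symf_meas[OF Z]
        component_meas u) auto
  have 1: "h (\<lambda>i\<in>{1..n}. X i \<omega>) = (\<Prod>i=1..k. u (X i \<omega>)) * Z (\<lambda>i. X i \<omega>)" for \<omega>
    using k unfolding h_def symf_restrict[OF Z]
    by (intro arg_cong2[of _ _ _ _ times] prod.cong) auto
  have 2: "h (\<lambda>i\<in>{1..n}. X (\<sigma> i) \<omega>) = (\<Prod>i\<in>B. u (X i \<omega>)) * Z (\<lambda>i. X i \<omega>)" for \<omega>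
  proof -
    have "(\<Prod>i=1..k. u ((\<lambda>i\<in>{1..n}. X (\<sigma> i) \<omega>) i)) = (\<Prod>i=1..k. u (X (\<sigma> i) \<omega>))"
      using k by (intro prod.cong) auto
    also have "\<dots> = (\<Prod>i\<in>B. u (X i \<omega>))"
      using prod.reindex[of \<sigma> "{1..k}" "\<lambda>i. u (X i \<omega>)"] permutes_inj_on[OF \<sigma>(1)] \<sigma>(2) by simp
    finally show ?thesis unfolding h_def symfD[OF Z \<sigma>(1), of "\<lambda>i. X i \<omega>"] by simp
  qed
  show ?thesis using nn_integral_permute[OF h \<sigma>(1)] unfolding 1 2 by simp
qed

definition sq :: "real \<Rightarrow> ennreal" where "sq x = ennreal (x\<^sup>2)"

lemma sq_meas [measurable]: "sq \<in> borel_measurable borel"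
  unfolding sq_def[abs_def] by measurable

lemma sq2_meas [measurable]: "(\<lambda>x. sq x ^ k) \<in> borel_measurable borel"
  by measurable

text \<open>\<open>S\<close> is \<open>||X||_2^2\<close> and \<open>T\<close> is
  \<open>||X||_4^4\<close>.\<close>

definition S :: "'b \<Rightarrow> ennreal" where "S \<omega> = (\<Sum>i=1..n. sq (X i \<omega>))"
definition T :: "'b \<Rightarrow> ennreal" where "T \<omega> = (\<Sum>i=1..n. sq (X i \<omega>) ^ 2)"

lemma symf_S: "symf (\<lambda>z. (\<Sum>i=1..n. sq (z i)) ^ k)"
  by (intro symf_power symf_sum sq_meas)

lemma symf_T: "symf (\<lambda>z. (\<Sum>i=1..n. sq (z i) ^ 2))"
  by (intro symf_sum sq2_meas)

lemma S_meas [measurable]: "S \<in> borel_measurable N"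
  using symf_X_meas[OF symf_S[of 1]] by (simp add: S_def[abs_def])

lemma T_meas [measurable]: "T \<in> borel_measurable N"
  using symf_X_meas[OF symf_T] by (simp add: T_def[abs_def])

text \<open>Falling factorial of \<open>n\<close>, the number of ordered \<open>k\<close>-tuples of
  distinct indices.\<close>

definition ff :: "nat \<Rightarrow> nat" where "ff k = (\<Prod>i<k. n - i)"

definition mom :: "nat \<Rightarrow> ennreal" where "mom k = E (\<lambda>\<omega>. \<Prod>i=1..k. sq (X i \<omega>))"

text \<open>The \<open>ff k\<close> ordered \<open>k\<close>-tuples of distinct indices in the
  expansion of \<open>S ^ k\<close> contribute equally, and \<open>B\<close> may serve as
  representative.\<close>

lemma moment_set_le:
  assumes "B \<subseteq> {1..n}" "card B = k"
  shows "of_nat (ff k) * E (\<lambda>\<omega>. (\<Prod>i\<in>B. sq (X i \<omega>)) * S \<omega> ^ l) \<le> E (\<lambda>\<omega>. S \<omega> ^ (k + l))"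
proof -
  have k: "k \<le> n" using card_mono[of "{1..n}" B] assms by simp
  have "of_nat (ff k) * E (\<lambda>\<omega>. (\<Prod>i\<in>B. sq (X i \<omega>)) * S \<omega> ^ l)
      = of_nat (ff k) * E (\<lambda>\<omega>. (\<Prod>i=1..k. sq (X i \<omega>)) * S \<omega> ^ l)"
    using nn_integral_prod_set[OF symf_S sq_meas assms, of l] by (simp add: S_def)
  also have "\<dots> \<le> E (\<lambda>\<omega>. S \<omega> ^ k * S \<omega> ^ l)"
    using nn_integral_falling_le[of "\<lambda>_. sq" sq "\<lambda>z. (\<Sum>i=1..n. sq (z i)) ^ l" 0 k, OF _ _ symf_S] k
    by (simp add: ff_def S_def)
  finally show ?thesis by (simp add: power_add)
qed

text \<open>The terms of \<open>S\<^sup>k\<close> with a repeated index are controlled by \<open>T S\<^sup>k\<^sup>-\<^sup>2\<close>.\<close>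

lemma repeated_index_step:
  assumes j: "Suc j \<le> k" and k: "k \<le> n"
  shows "of_nat (ff j) * E (\<lambda>\<omega>. (\<Prod>i=1..j. sq (X i \<omega>)) * S \<omega> ^ (k - j))
    \<le> of_nat (ff (Suc j)) * E (\<lambda>\<omega>. (\<Prod>i=1..Suc j. sq (X i \<omega>)) * S \<omega> ^ (k - Suc j))
      + of_nat j * E (\<lambda>\<omega>. T \<omega> * S \<omega> ^ (k - 2))"
proof -
  let ?Z = "\<lambda>z. (\<Sum>i=1..n. sq (z i)) ^ (k - Suc j)"
  let ?D = "E (\<lambda>\<omega>. T \<omega> * S \<omega> ^ (k - 2))"
  have kj: "k - j = Suc (k - Suc j)" using j by simp
  have "E (\<lambda>\<omega>. (\<Prod>i=1..j. sq (X i \<omega>)) * S \<omega> ^ (k - j))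
      = of_nat (n - j) * E (\<lambda>\<omega>. (\<Prod>i=1..j. sq (X i \<omega>)) * sq (X (Suc j) \<omega>) * S \<omega> ^ (k - Suc j))
      + (\<Sum>\<alpha>=1..j. E (\<lambda>\<omega>. (\<Prod>i=1..j. sq (X i \<omega>)) * sq (X \<alpha> \<omega>) * S \<omega> ^ (k - Suc j)))"
    using nn_integral_prod_sum_split[of ?Z "\<lambda>_. sq" sq j, OF symf_S] j k by (simp add: kj S_def mult_ac)
  then have "of_nat (ff j) * E (\<lambda>\<omega>. (\<Prod>i=1..j. sq (X i \<omega>)) * S \<omega> ^ (k - j))
      = of_nat (ff (Suc j)) * E (\<lambda>\<omega>. (\<Prod>i=1..Suc j. sq (X i \<omega>)) * S \<omega> ^ (k - Suc j))
      + (\<Sum>\<alpha>=1..j. of_nat (ff j) * E (\<lambda>\<omega>. (\<Prod>i=1..j. sq (X i \<omega>)) * sq (X \<alpha> \<omega>) * S \<omega> ^ (k - Suc j)))"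
    by (simp add: distrib_left sum_distrib_left ff_def mult_ac)
  also have "(\<Sum>\<alpha>=1..j. of_nat (ff j) * E (\<lambda>\<omega>. (\<Prod>i=1..j. sq (X i \<omega>)) * sq (X \<alpha> \<omega>) * S \<omega> ^ (k - Suc j)))
      \<le> (\<Sum>\<alpha>=1..j. ?D)"
  proof (rule sum_mono)
    fix \<alpha> assume \<alpha>: "\<alpha> \<in> {1..j}"
    then obtain j' where j': "j = Suc j'" by (cases j) auto
    \<comment> \<open>Moving \<alpha> to position \<open>j\<close> turns the term into
      \<open>X_1^2 ... X_{j-1}^2 X_j^4\<close>. Of \<open>ff j = ff j' (n - j')\<close>, the factor
      \<open>n - j'\<close> sums the fourth power to at most \<open>T\<close>, and
      \<open>ff j'\<close> sums the squares to at most \<open>S ^ j'\<close>.\<close>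
    let ?B = "{1..j} - {\<alpha>}"
    let ?\<sigma> = "Transposition.transpose j \<alpha>"
    define h where "h = (\<lambda>z. (\<Prod>i=1..j'. sq (z i)) * sq (z j) ^ 2 * ?Z z)"
    have \<sigma>: "?\<sigma> permutes {1..n}" using j k \<alpha> by (intro permutes_swap_id) auto
    have hm: "h \<in> borel_measurable vec_space"
      unfolding h_def using j k j'
      by (intro borel_measurable_times_ennreal borel_measurable_prod_ennreal symf_meas[OF symf_S]
          component_meas sq_meas component_meas[of "\<lambda>x. sq x ^ 2", OF sq2_meas]) auto
    have h1: "h (\<lambda>i\<in>{1..n}. X i \<omega>) = (\<Prod>i=1..j'. sq (X i \<omega>)) * sq (X (Suc j') \<omega>) ^ 2 * S \<omega> ^ (k - Suc j)" for \<omega>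
      using j k j' unfolding h_def symf_restrict[OF symf_S] S_def
      by (intro arg_cong2[of _ _ _ _ times] prod.cong) auto
    have h2: "h (\<lambda>i\<in>{1..n}. X (?\<sigma> i) \<omega>)
        = (\<Prod>i\<in>?B. sq (X i \<omega>)) * sq (X \<alpha> \<omega>) ^ 2 * S \<omega> ^ (k - Suc j)" for \<omega>
    proof -
      have "(\<Prod>i=1..j'. sq ((\<lambda>i\<in>{1..n}. X (?\<sigma> i) \<omega>) i)) = (\<Prod>i=1..j'. sq (X (?\<sigma> i) \<omega>))"
        using j k j' by (intro prod.cong) auto
      also have "\<dots> = (\<Prod>i\<in>?\<sigma> ` {1..j'}. sq (X i \<omega>))"
        by (subst prod.reindex) (use permutes_inj_on[OF \<sigma>] in auto)
      also have "?\<sigma> ` {1..j'} = ?B"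
      proof (intro equalityI subsetI)
        fix i assume "i \<in> ?\<sigma> ` {1..j'}"
        then show "i \<in> ?B" using \<alpha> j' by (auto simp: Transposition.transpose_def split: if_splits)
      next
        fix i assume i: "i \<in> ?B"
        then have "?\<sigma> i \<in> {1..j'}" using \<alpha> j' by (auto simp: Transposition.transpose_def)
        moreover have "i = ?\<sigma> (?\<sigma> i)" by simp
        ultimately show "i \<in> ?\<sigma> ` {1..j'}" by blast
      qed
      finally have P: "(\<Prod>i=1..j'. sq ((\<lambda>i\<in>{1..n}. X (?\<sigma> i) \<omega>) i)) = (\<Prod>i\<in>?B. sq (X i \<omega>))" .
      then show ?thesis
        using j k j' unfolding h_def symfD[OF symf_S \<sigma>, of "\<lambda>i. X i \<omega>"] P S_def by simp
    qed
    have "E (\<lambda>\<omega>. (\<Prod>i=1..j. sq (X i \<omega>)) * sq (X \<alpha> \<omega>) * S \<omega> ^ (k - Suc j))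
        = E (\<lambda>\<omega>. (\<Prod>i\<in>?B. sq (X i \<omega>)) * sq (X \<alpha> \<omega>) ^ 2 * S \<omega> ^ (k - Suc j))"
      using \<alpha> by (subst prod.remove[of _ \<alpha>]) (auto simp: power2_eq_square mult_ac)
    also have "\<dots> = E (\<lambda>\<omega>. (\<Prod>i=1..j'. sq (X i \<omega>)) * sq (X (Suc j') \<omega>) ^ 2 * S \<omega> ^ (k - Suc j))"
      using nn_integral_permute[OF hm \<sigma>] unfolding h1 h2 by simp
    finally have "of_nat (ff j) * E (\<lambda>\<omega>. (\<Prod>i=1..j. sq (X i \<omega>)) * sq (X \<alpha> \<omega>) * S \<omega> ^ (k - Suc j))
      = of_nat (ff j') * (of_nat (n - j') * E (\<lambda>\<omega>. (\<Prod>i=1..j'. sq (X i \<omega>)) * sq (X (Suc j') \<omega>) ^ 2 * S \<omega> ^ (k - Suc j)))"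
      by (simp add: ff_def j' mult_ac)
    also have "\<dots> \<le> of_nat (ff j') * E (\<lambda>\<omega>. (\<Prod>i=1..j'. sq (X i \<omega>)) * T \<omega> * S \<omega> ^ (k - Suc j))"
      using nn_integral_prod_sum_split[of ?Z "\<lambda>_. sq" "\<lambda>x. sq x ^ 2" j', OF symf_S] j k j'
      by (intro mult_left_mono) (auto simp: S_def T_def)
    also have "\<dots> \<le> E (\<lambda>\<omega>. S \<omega> ^ j' * (T \<omega> * S \<omega> ^ (k - Suc j)))"
      using nn_integral_falling_le[of "\<lambda>_. sq" sq "\<lambda>z. (\<Sum>i=1..n. sq (z i) ^ 2) * ?Z z" 0 j', OF _ _ symf_mult[OF symf_T symf_S]] j k j'
      by (simp add: ff_def S_def T_def mult_ac)
    also have "\<dots> = ?D"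
    proof -
      have "k - 2 = j' + (k - Suc j)" using j j' by simp
      then show ?thesis by (simp add: power_add mult_ac)
    qed
    finally show "of_nat (ff j) * E (\<lambda>\<omega>. (\<Prod>i=1..j. sq (X i \<omega>)) * sq (X \<alpha> \<omega>) * S \<omega> ^ (k - Suc j)) \<le> ?D" .
  qed
  finally show ?thesis by (simp add: add_left_mono)
qed

text \<open>Iterates the previous step from \<open>j = 0\<close> to \<open>k\<close>; each of the
  \<open>k\<close> steps costs at most \<open>k - 1\<close> copies of the repeated-index
  term.\<close>

lemma power_sum_le:
  assumes k: "k \<le> n"
  shows "E (\<lambda>\<omega>. S \<omega> ^ k) \<le> of_nat (ff k) * mom k + of_nat (k * (k - 1)) * E (\<lambda>\<omega>. T \<omega> * S \<omega> ^ (k - 2))"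
proof -
  let ?D = "E (\<lambda>\<omega>. T \<omega> * S \<omega> ^ (k - 2))"
  have "E (\<lambda>\<omega>. S \<omega> ^ k) \<le> of_nat (ff j) * E (\<lambda>\<omega>. (\<Prod>i=1..j. sq (X i \<omega>)) * S \<omega> ^ (k - j))
      + of_nat (j * (k - 1)) * ?D" if "j \<le> k" for j
    using that
  proof (induction j)
    case 0
    then show ?case by (simp add: ff_def)
  next
    case (Suc j)
    let ?a = "\<lambda>j. of_nat (ff j) * E (\<lambda>\<omega>. (\<Prod>i=1..j. sq (X i \<omega>)) * S \<omega> ^ (k - j))"
    have "E (\<lambda>\<omega>. S \<omega> ^ k) \<le> ?a j + of_nat (j * (k - 1)) * ?D" using Suc by simp
    also have "\<dots> \<le> (?a (Suc j) + of_nat j * ?D) + of_nat (j * (k - 1)) * ?D"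
      using Suc.prems k by (intro add_right_mono repeated_index_step) auto
    also have "\<dots> \<le> (?a (Suc j) + of_nat (k - 1) * ?D) + of_nat (j * (k - 1)) * ?D"
      using Suc.prems by (intro add_mono mult_right_mono) auto
    also have "\<dots> = ?a (Suc j) + of_nat (Suc j * (k - 1)) * ?D"
      by (simp add: distrib_right ac_simps)
    finally show ?case .
  qed
  from this[of k] show ?thesis by (simp add: mom_def)
qed

end

section \<open>Algebraic inequalities for the second-moment estimates\<close>

lemma power_add_ge_two_terms:
  fixes s y :: real
  assumes "s \<ge> 0" "y \<ge> 0"
  shows "s ^ Suc k + real (Suc k) * y * s ^ k \<le> (s + y) ^ Suc k"
proof (induction k)
  case (Suc k)
  have "s ^ Suc (Suc k) + real (Suc (Suc k)) * y * s ^ Suc k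
      \<le> (s + y) * (s ^ Suc k + real (Suc k) * y * s ^ k)"
    using assms by (simp add: algebra_simps)
  also have "\<dots> \<le> (s + y) * (s + y) ^ Suc k"
    using Suc assms by (intro mult_left_mono) auto
  finally show ?case by simp
qed simp

text \<open>\<open>k! e_k <= e_1^k\<close>, by adding one variable at a time: \<open>e_k\<close>
  gains \<open>q a e_{k-1}\<close>, and the first two binomial terms of \<open>(s + q a)^k\<close>
  pay for it.\<close>

lemma elementary_symmetric_le:
  fixes q :: "'i \<Rightarrow> real"
  assumes "finite A" "\<And>i. i \<in> A \<Longrightarrow> q i \<ge> 0"
  shows "fact k * (\<Sum>B\<in>{B. B \<subseteq> A \<and> card B = k}. \<Prod>i\<in>B. q i) \<le> (\<Sum>i\<in>A. q i) ^ k"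
  using assms
proof (induction A arbitrary: k rule: finite_induct)
  case empty
  show ?case
  proof (cases k)
    case 0
    then have e: "{B. B \<subseteq> {} \<and> card B = k} = {{}}" by auto
    show ?thesis unfolding e by (simp add: 0)
  next
    case (Suc k')
    then have e: "{B. B \<subseteq> {} \<and> card B = k} = {}" by auto
    show ?thesis unfolding e by (simp add: Suc)
  qed
next
  case (insert a A)
  let ?e = "\<lambda>A k. \<Sum>B\<in>{B. B \<subseteq> A \<and> card B = k}. \<Prod>i\<in>B. q i"
  have finB: "finite B" if "B \<subseteq> insert a A" for B
    using finite_subset[OF that] insert.hyps(1) by simp
  have fin: "finite {B. B \<subseteq> A \<and> card B = k}" for k
    using insert.hyps(1) by (auto intro: finite_subset[of _ "Pow A"])
  show ?case
  proof (cases k)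
    case 0
    have "{B. B \<subseteq> insert a A \<and> card B = 0} = {{}}"
      using finB by fastforce
    then show ?thesis using 0 by simp
  next
    case (Suc k')
    let ?F = "{B. B \<subseteq> A \<and> card B = k'}"
    have "{B. B \<subseteq> insert a A \<and> card B = Suc k'} = {B. B \<subseteq> A \<and> card B = Suc k'} \<union> insert a ` ?F"
    proof (intro equalityI subsetI)
      fix B assume B: "B \<in> {B. B \<subseteq> insert a A \<and> card B = Suc k'}"
      show "B \<in> {B. B \<subseteq> A \<and> card B = Suc k'} \<union> insert a ` ?F"
      proof (cases "a \<in> B")
        case True
        have "finite B" using B finB by blast
        then have "B - {a} \<in> ?F" using B True by auto
        moreover have "B = insert a (B - {a})" using True by auto
        ultimately show ?thesis by blast
      qed (use B in auto)
    next
      fix B assume B: "B \<in> {B. B \<subseteq> A \<and> card B = Suc k'} \<union> insert a ` ?F"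
      show "B \<in> {B. B \<subseteq> insert a A \<and> card B = Suc k'}"
      proof (cases "B \<subseteq> A \<and> card B = Suc k'")
        case False
        with B obtain C where C: "B = insert a C" "C \<subseteq> A" "card C = k'" by auto
        have "finite C" using C(2) finB by blast
        moreover have "a \<notin> C" using C(2) insert.hyps(2) by blast
        ultimately show ?thesis using C by auto
      qed auto
    qed
    then have "?e (insert a A) (Suc k') = ?e A (Suc k') + (\<Sum>B\<in>insert a ` ?F. \<Prod>i\<in>B. q i)"
      using insert.hyps(2) fin[of k'] fin[of "Suc k'"]
      by (simp only:) (rule sum.union_disjoint, auto)
    also have "(\<Sum>B\<in>insert a ` ?F. \<Prod>i\<in>B. q i) = (\<Sum>B\<in>?F. \<Prod>i\<in>insert a B. q i)"
      using insert.hyps(2) by (intro sum.reindex_cong[of "insert a"]) (auto simp: inj_on_def)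
    also have "\<dots> = (\<Sum>B\<in>?F. q a * (\<Prod>i\<in>B. q i))"
    proof (intro sum.cong refl prod.insert)
      fix B assume "B \<in> ?F"
      then show "finite B" "a \<notin> B" using finB[of B] insert.hyps(2) by blast+
    qed
    finally have e: "?e (insert a A) (Suc k') = ?e A (Suc k') + q a * ?e A k'"
      by (simp add: sum_distrib_left)
    have s: "(\<Sum>i\<in>A. q i) \<ge> 0" and qa: "q a \<ge> 0" using insert.prems by (auto intro: sum_nonneg)
    have "fact (Suc k') * ?e (insert a A) (Suc k')
        = fact (Suc k') * ?e A (Suc k') + real (Suc k') * q a * (fact k' * ?e A k')"
      unfolding e by (simp add: algebra_simps)
    also have "\<dots> \<le> (\<Sum>i\<in>A. q i) ^ Suc k' + real (Suc k') * q a * (\<Sum>i\<in>A. q i) ^ k'"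
      using insert.IH[of "Suc k'"] insert.IH[of k'] insert.prems qa by (intro add_mono mult_left_mono) auto
    also have "\<dots> \<le> ((\<Sum>i\<in>A. q i) + q a) ^ Suc k'"
      by (rule power_add_ge_two_terms[OF s qa])
    finally show ?thesis using insert.hyps Suc by (simp add: add.commute)
  qed
qed

text \<open>Schur's test: a symmetric nonnegative kernel is controlled by its row sums, from
  \<open>2 a u a v <= (a u)^2 + (a v)^2\<close>.\<close>

lemma bilinear_sum_le:
  fixes a :: "'i \<Rightarrow> real" and c :: "'i \<Rightarrow> 'i \<Rightarrow> real"
  assumes nn: "\<And>u v. u \<in> P \<Longrightarrow> v \<in> P \<Longrightarrow> c u v \<ge> 0"
    and sym: "\<And>u v. u \<in> P \<Longrightarrow> v \<in> P \<Longrightarrow> c u v = c v u"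
  shows "(\<Sum>u\<in>P. \<Sum>v\<in>P. a u * a v * c u v) \<le> (\<Sum>u\<in>P. (a u)\<^sup>2 * (\<Sum>v\<in>P. c u v))"
proof -
  have "(\<Sum>u\<in>P. \<Sum>v\<in>P. a u * a v * c u v) \<le> (\<Sum>u\<in>P. \<Sum>v\<in>P. ((a u)\<^sup>2 * c u v + (a v)\<^sup>2 * c u v) / 2)"
  proof (intro sum_mono)
    fix u v assume uv: "u \<in> P" "v \<in> P"
    have "a u * a v \<le> ((a u)\<^sup>2 + (a v)\<^sup>2) / 2"
      using sum_squares_bound[of "a u" "a v"] by simp
    then have "a u * a v * c u v \<le> ((a u)\<^sup>2 + (a v)\<^sup>2) / 2 * c u v"
      using nn uv by (intro mult_right_mono) auto
    then show "a u * a v * c u v \<le> ((a u)\<^sup>2 * c u v + (a v)\<^sup>2 * c u v) / 2"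
      by (simp add: algebra_simps)
  qed
  also have "\<dots> = ((\<Sum>u\<in>P. \<Sum>v\<in>P. (a u)\<^sup>2 * c u v) + (\<Sum>u\<in>P. \<Sum>v\<in>P. (a v)\<^sup>2 * c u v)) / 2"
    by (simp add: sum.distrib flip: sum_divide_distrib)
  also have "(\<Sum>u\<in>P. \<Sum>v\<in>P. (a v)\<^sup>2 * c u v) = (\<Sum>u\<in>P. \<Sum>v\<in>P. (a u)\<^sup>2 * c u v)"
    by (subst sum.swap) (intro sum.cong refl, simp add: sym)
  also have "((\<Sum>u\<in>P. \<Sum>v\<in>P. (a u)\<^sup>2 * c u v) + (\<Sum>u\<in>P. \<Sum>v\<in>P. (a u)\<^sup>2 * c u v)) / 2
      = (\<Sum>u\<in>P. \<Sum>v\<in>P. (a u)\<^sup>2 * c u v)" by simp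
  finally show ?thesis by (simp only: sum_distrib_left)
qed

lemma integral_rademacher_power: "integrable rademacher (\<lambda>x. x ^ k)"
  "odd k \<Longrightarrow> (\<integral>x. x ^ k \<partial>rademacher) = 0"
  unfolding rademacher_def
  by (auto intro!: integrable_measure_pmf_finite simp: integral_pmf_of_set)

section \<open>Products of tensor coordinates\<close>

context sym_vector
begin

text \<open>Unconditionality inserts independent signs; integrated first by Fubini, the sign at
  \<alpha> has a vanishing odd moment.\<close>

lemma odd_moment_zero:
  fixes e :: "nat \<Rightarrow> nat"
  assumes int: "integrable N (\<lambda>\<omega>. \<Prod>\<alpha>=1..n. X \<alpha> \<omega> ^ e \<alpha>)"
    and \<alpha>: "\<alpha> \<in> {1..n}" "odd (e \<alpha>)"
  shows "(\<integral>\<omega>. (\<Prod>\<alpha>=1..n. X \<alpha> \<omega> ^ e \<alpha>) \<partial>N) = 0"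
proof -
  define h where "h = (\<lambda>z::nat \<Rightarrow> real. \<Prod>\<alpha>=1..n. z \<alpha> ^ e \<alpha>)"
  let ?R = "Pi\<^sub>M {1..n} (\<lambda>_. rademacher)"
  let ?f = "\<lambda>(\<omega>, \<epsilon>). \<lambda>i\<in>{1..n}. \<epsilon> i * X i \<omega>"
  have setsR: "sets rademacher = UNIV" by (simp add: rademacher_def)
  have pr: "prob_space rademacher" unfolding rademacher_def by unfold_locales
  interpret R: product_prob_space "\<lambda>_::nat. rademacher" "{1..n}"
    using pr by (intro product_prob_spaceI)
  interpret pp: pair_sigma_finite N ?R
    by (intro pair_sigma_finite.intro sigma_finite_measure_axioms R.P.sigma_finite_measure_axioms)
  have comp: "(\<lambda>\<epsilon>. \<epsilon> i) \<in> borel_measurable ?R" if "i \<in> {1..n}" for i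
  proof -
    have "(\<lambda>x. x) \<in> measurable rademacher borel" by (simp add: rademacher_def)
    from measurable_compose[OF measurable_component_singleton[OF that] this] show ?thesis .
  qed
  have fm: "?f \<in> measurable (N \<Otimes>\<^sub>M ?R) vec_space"
    unfolding split_beta'
    by (intro measurable_restrict borel_measurable_times measurable_compose[OF measurable_snd comp]
        measurable_compose[OF measurable_fst X_meas])
  have hm: "h \<in> borel_measurable vec_space"
    unfolding h_def by (intro borel_measurable_prod borel_measurable_power measurable_component_singleton)
  have h1: "h (\<lambda>i\<in>{1..n}. X i \<omega>) = (\<Prod>\<alpha>=1..n. X \<alpha> \<omega> ^ e \<alpha>)" for \<omega>
    unfolding h_def by (intro prod.cong) auto
  have h2: "h (?f (\<omega>, \<epsilon>)) = (\<Prod>\<alpha>=1..n. X \<alpha> \<omega> ^ e \<alpha>) * (\<Prod>\<alpha>=1..n. \<epsilon> \<alpha> ^ e \<alpha>)" for \<omega> \<epsilon>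
    unfolding h_def prod.distrib[symmetric] by (intro prod.cong) (auto simp: power_mult_distrib mult.commute)
  have eq: "distr N vec_space (\<lambda>\<omega>. \<lambda>i\<in>{1..n}. X i \<omega>) = distr (N \<Otimes>\<^sub>M ?R) vec_space ?f"
    using uncond by (simp add: unconditional_def)
  have "integrable (distr N vec_space (\<lambda>\<omega>. \<lambda>i\<in>{1..n}. X i \<omega>)) h"
    using int hm by (subst integrable_distr_eq[OF X_vec_meas_id]) (simp_all only: h1)
  then have i2: "integrable (N \<Otimes>\<^sub>M ?R) (\<lambda>z. h (?f z))"
    unfolding eq using hm by (subst (asm) integrable_distr_eq[OF fm]) simp_all
  have "(\<integral>\<omega>. (\<Prod>\<alpha>=1..n. X \<alpha> \<omega> ^ e \<alpha>) \<partial>N) = (\<integral>z. h z \<partial>distr N vec_space (\<lambda>\<omega>. \<lambda>i\<in>{1..n}. X i \<omega>))"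
    using hm by (subst integral_distr[OF X_vec_meas_id]) (simp_all only: h1)
  also have "\<dots> = (\<integral>z. h (?f z) \<partial>(N \<Otimes>\<^sub>M ?R))"
    unfolding eq by (rule integral_distr[OF fm hm])
  also have "\<dots> = (\<integral>\<omega>. (\<integral>\<epsilon>. h (?f (\<omega>, \<epsilon>)) \<partial>?R) \<partial>N)"
    by (rule pp.integral_fst'[OF i2, symmetric])
  also have "\<dots> = (\<integral>\<omega>. (\<Prod>\<alpha>=1..n. X \<alpha> \<omega> ^ e \<alpha>) * (\<integral>\<epsilon>. (\<Prod>\<alpha>=1..n. \<epsilon> \<alpha> ^ e \<alpha>) \<partial>?R) \<partial>N)"
    unfolding h2 by simp
  also have "(\<integral>\<epsilon>. (\<Prod>\<alpha>=1..n. \<epsilon> \<alpha> ^ e \<alpha>) \<partial>?R) = (\<Prod>\<alpha>=1..n. (\<integral>x. x ^ e \<alpha> \<partial>rademacher))"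
    by (rule R.product_integral_prod) (auto intro: integral_rademacher_power)
  also have "\<dots> = 0"
    using \<alpha> integral_rademacher_power(2)[of "e \<alpha>"] by (intro prod_zero bexI[of _ \<alpha>]) auto
  finally show ?thesis by simp
qed

definition tens :: "nat set \<Rightarrow> 'b \<Rightarrow> real" where "tens i \<omega> = (\<Prod>\<alpha>\<in>i. X \<alpha> \<omega>)"

lemma tens_meas [measurable]: "i \<subseteq> {1..n} \<Longrightarrow> tens i \<in> borel_measurable N"
  unfolding tens_def[abs_def] by (intro borel_measurable_prod X_meas) auto

text \<open>Monomial form with exponents 0 and 1, as \<open>odd_moment_zero\<close> expects.\<close>

lemma tens_eq_power:
  assumes "i \<subseteq> {1..n}"
  shows "tens i \<omega> = (\<Prod>\<alpha>=1..n. X \<alpha> \<omega> ^ of_bool (\<alpha> \<in> i))"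
proof -
  have "(\<Prod>\<alpha>=1..n. X \<alpha> \<omega> ^ of_bool (\<alpha> \<in> i)) = (\<Prod>\<alpha>\<in>i. X \<alpha> \<omega> ^ of_bool (\<alpha> \<in> i))"
    using assms by (intro prod.mono_neutral_right) auto
  then show ?thesis by (simp add: tens_def)
qed

lemma tens_sq: "ennreal ((tens i \<omega>)\<^sup>2) = (\<Prod>\<alpha>\<in>i. sq (X \<alpha> \<omega>))"
  by (simp add: tens_def sq_def prod_power_distrib prod_ennreal)

lemma S_real: "S \<omega> = ennreal (\<Sum>i=1..n. (X i \<omega>)\<^sup>2)"
  by (simp add: S_def sq_def sum_ennreal)

lemma sum_tens_sq_le:
  "ennreal (fact k) * (\<Sum>C\<in>dsubsets n k. \<Prod>\<alpha>\<in>C. sq (X \<alpha> \<omega>)) \<le> S \<omega> ^ k"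
proof -
  have "(\<Sum>C\<in>dsubsets n k. \<Prod>\<alpha>\<in>C. sq (X \<alpha> \<omega>)) = ennreal (\<Sum>C\<in>dsubsets n k. \<Prod>\<alpha>\<in>C. (X \<alpha> \<omega>)\<^sup>2)"
    by (simp add: sq_def prod_ennreal sum_ennreal prod_nonneg)
  then have "ennreal (fact k) * (\<Sum>C\<in>dsubsets n k. \<Prod>\<alpha>\<in>C. sq (X \<alpha> \<omega>))
      = ennreal (fact k * (\<Sum>C\<in>dsubsets n k. \<Prod>\<alpha>\<in>C. (X \<alpha> \<omega>)\<^sup>2))"
    by (simp add: ennreal_mult sum_nonneg prod_nonneg)
  also have "\<dots> \<le> ennreal ((\<Sum>\<alpha>=1..n. (X \<alpha> \<omega>)\<^sup>2) ^ k)"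
    using elementary_symmetric_le[of "{1..n}" "\<lambda>\<alpha>. (X \<alpha> \<omega>)\<^sup>2" k]
    by (intro ennreal_leI) (auto simp: dsubsets_def)
  also have "\<dots> = S \<omega> ^ k" by (simp add: S_real ennreal_power sum_nonneg)
  finally show ?thesis .
qed

text \<open>Real counterpart of \<open>S\<close>, for Bochner integrals.\<close>

definition Sr :: "'b \<Rightarrow> real" where "Sr \<omega> = (\<Sum>i=1..n. (X i \<omega>)\<^sup>2)"

lemma Sr_nonneg: "Sr \<omega> \<ge> 0" by (simp add: Sr_def sum_nonneg)

lemma S_eq_Sr: "S \<omega> = ennreal (Sr \<omega>)" by (simp add: S_real Sr_def)

lemma Sr_meas [measurable]: "Sr \<in> borel_measurable N"
  unfolding Sr_def[abs_def] by (intro borel_measurable_sum borel_measurable_power X_meas)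

lemma integrable_Sr_power:
  assumes "E (\<lambda>\<omega>. S \<omega> ^ k) = ennreal M"
  shows "integrable N (\<lambda>\<omega>. Sr \<omega> ^ k)"
proof (rule integrableI_nonneg)
  show "E (\<lambda>\<omega>. ennreal (Sr \<omega> ^ k)) < \<infinity>"
    using assms by (simp add: S_eq_Sr ennreal_power Sr_nonneg)
qed (auto simp: Sr_nonneg)

lemma tens_sq_le:
  assumes "i \<in> dsubsets n k"
  shows "(tens i \<omega>)\<^sup>2 \<le> Sr \<omega> ^ k"
proof -
  have "(tens i \<omega>)\<^sup>2 = (\<Prod>\<alpha>\<in>i. (X \<alpha> \<omega>)\<^sup>2)" by (simp add: tens_def prod_power_distrib)
  also have "\<dots> \<le> (\<Prod>\<alpha>\<in>i. Sr \<omega>)"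
  proof (intro prod_mono conjI)
    fix \<alpha> assume "\<alpha> \<in> i"
    then have "\<alpha> \<in> {1..n}" using assms by (auto simp: dsubsets_def)
    then show "(X \<alpha> \<omega>)\<^sup>2 \<le> Sr \<omega>" unfolding Sr_def by (intro member_le_sum) auto
  qed simp
  finally show ?thesis using assms by (simp add: dsubsets_def)
qed

lemma tens_mult_disjoint:
  assumes "i \<subseteq> {1..n}" "j \<subseteq> {1..n}" "i \<inter> j = {}"
  shows "tens (i \<union> j) \<omega> = tens i \<omega> * tens j \<omega>"
  unfolding tens_def using assms by (intro prod.union_disjoint) (auto intro: finite_subset)

definition sdiff :: "nat set \<Rightarrow> nat set \<Rightarrow> nat set" where "sdiff i j = (i - j) \<union> (j - i)"

lemma tens_mult_sdiff:
  assumes "i \<subseteq> {1..n}" "j \<subseteq> {1..n}"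
  shows "tens i \<omega> * tens j \<omega> = tens (sdiff i j) \<omega> * (tens (i \<inter> j) \<omega>)\<^sup>2"
proof -
  have "tens ((i - j) \<union> (i \<inter> j)) \<omega> = tens (i - j) \<omega> * tens (i \<inter> j) \<omega>"
    "tens ((j - i) \<union> (i \<inter> j)) \<omega> = tens (j - i) \<omega> * tens (i \<inter> j) \<omega>"
    using assms by (intro tens_mult_disjoint; blast)+
  moreover have "(i - j) \<union> (i \<inter> j) = i" "(j - i) \<union> (i \<inter> j) = j" by auto
  ultimately have 1: "tens i \<omega> = tens (i - j) \<omega> * tens (i \<inter> j) \<omega>" "tens j \<omega> = tens (j - i) \<omega> * tens (i \<inter> j) \<omega>"
    by simp_all
  have 2: "tens (sdiff i j) \<omega> = tens (i - j) \<omega> * tens (j - i) \<omega>"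
    unfolding sdiff_def using assms by (intro tens_mult_disjoint) auto
  show ?thesis unfolding 2 power2_eq_square by (subst 1(1), subst 1(2)) (simp only: mult_ac)
qed

text \<open>With \<open>D\<close> the common symmetric difference, the product is
  \<open>x_D^2\<close> times the squares belonging to \<open>i \<inter> j\<close> and
  \<open>k \<inter> l\<close>, and \<open>D\<close> with \<open>i \<inter> j\<close> makes up
  \<open>i \<union> j\<close>. Hence the product is nonnegative and \<open>(k, l)\<close> enters
  only through \<open>k \<inter> l\<close>.\<close>

lemma tens_mult4:
  assumes "i \<subseteq> {1..n}" "j \<subseteq> {1..n}" "k \<subseteq> {1..n}" "l \<subseteq> {1..n}" "sdiff i j = sdiff k l"
  shows "tens i \<omega> * tens j \<omega> * (tens k \<omega> * tens l \<omega>) = (tens (i \<union> j) \<omega>)\<^sup>2 * (tens (k \<inter> l) \<omega>)\<^sup>2"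
proof -
  have "tens (sdiff i j \<union> (i \<inter> j)) \<omega> = tens (sdiff i j) \<omega> * tens (i \<inter> j) \<omega>"
    using assms by (intro tens_mult_disjoint) (auto simp: sdiff_def)
  moreover have "sdiff i j \<union> (i \<inter> j) = i \<union> j" by (auto simp: sdiff_def)
  ultimately show ?thesis
    unfolding tens_mult_sdiff[OF assms(1,2)] tens_mult_sdiff[OF assms(3,4)] assms(5)
    by (simp add: power2_eq_square)
qed

end

section \<open>Variance of quadratic forms in the tensor\<close>

locale sym_vector_moments = sym_vector +
  fixes d :: nat and M :: real
  assumes d_le: "2 * d \<le> n" and M: "E (\<lambda>\<omega>. S \<omega> ^ (2 * d)) = ennreal M" and M_nonneg: "M \<ge> 0"
begin

abbreviation "I \<equiv> dsubsets n d"

lemma I_sub: "i \<in> I \<Longrightarrow> i \<subseteq> {1..n}" and I_card: "i \<in> I \<Longrightarrow> card i = d"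
  by (auto simp: dsubsets_def)

lemma I_fin: "finite I" by (auto simp: dsubsets_def)

lemma I_finite: "i \<in> I \<Longrightarrow> finite i"
  using I_sub finite_subset by blast

text \<open>Each squared coordinate is at most \<open>Sr ^ d\<close>, so a product of four is at
  most \<open>Sr ^ (2 * d)\<close> in modulus, whose mean is \<open>M\<close>.\<close>

lemma integrable_tens4:
  assumes "i \<in> I" "j \<in> I" "k \<in> I" "l \<in> I"
  shows "integrable N (\<lambda>\<omega>. tens i \<omega> * tens j \<omega> * (tens k \<omega> * tens l \<omega>))"
proof (rule Bochner_Integration.integrable_bound[OF integrable_Sr_power[OF M]])
  show "AE \<omega> in N. norm (tens i \<omega> * tens j \<omega> * (tens k \<omega> * tens l \<omega>)) \<le> norm (Sr \<omega> ^ (2 * d))"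
  proof (rule AE_I2)
    fix \<omega>
    have "(tens i \<omega> * tens j \<omega> * (tens k \<omega> * tens l \<omega>))\<^sup>2
        = (tens i \<omega>)\<^sup>2 * (tens j \<omega>)\<^sup>2 * ((tens k \<omega>)\<^sup>2 * (tens l \<omega>)\<^sup>2)"
      by (simp add: power_mult_distrib)
    also have "\<dots> \<le> Sr \<omega> ^ d * Sr \<omega> ^ d * (Sr \<omega> ^ d * Sr \<omega> ^ d)"
      using assms by (intro mult_mono tens_sq_le) (auto simp: Sr_nonneg)
    also have "\<dots> = (Sr \<omega> ^ (2 * d))\<^sup>2"
      by (simp only: power_add[symmetric] power_mult[symmetric])
        (rule arg_cong[of _ _ "\<lambda>k. Sr \<omega> ^ k"], simp)
    finally show "norm (tens i \<omega> * tens j \<omega> * (tens k \<omega> * tens l \<omega>)) \<le> norm (Sr \<omega> ^ (2 * d))"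
      by (simp only: real_norm_def abs_le_square_iff)
  qed
qed (use assms I_sub in measurable)

text \<open>Kernel of the second moment of the off-diagonal part, indexed by pairs of
  coordinates.\<close>

definition cov4 :: "nat set \<times> nat set \<Rightarrow> nat set \<times> nat set \<Rightarrow> real" where
  "cov4 u v = (\<integral>\<omega>. tens (fst u) \<omega> * tens (snd u) \<omega> * (tens (fst v) \<omega> * tens (snd v) \<omega>) \<partial>N)"

lemma cov4_commute: "cov4 u v = cov4 v u"
  by (simp add: cov4_def mult.commute)

text \<open>An index in exactly one of the two symmetric differences occurs an odd number of
  times.\<close>

lemma cov4_zero:
  assumes u: "u \<in> I \<times> I" and v: "v \<in> I \<times> I"
    and ne: "sdiff (fst u) (snd u) \<noteq> sdiff (fst v) (snd v)"
  shows "cov4 u v = 0"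
proof -
  obtain i j k l where uv: "u = (i, j)" "v = (k, l)" by (metis surj_pair)
  have ijkl: "i \<in> I" "j \<in> I" "k \<in> I" "l \<in> I" using u v uv by auto
  define e :: "nat \<Rightarrow> nat" where
    "e = (\<lambda>\<alpha>. of_bool (\<alpha> \<in> i) + of_bool (\<alpha> \<in> j) + (of_bool (\<alpha> \<in> k) + of_bool (\<alpha> \<in> l)))"
  obtain \<alpha> where \<alpha>: "\<alpha> \<in> sdiff i j \<longleftrightarrow> \<alpha> \<notin> sdiff k l" using ne uv by auto
  have eq: "tens i \<omega> * tens j \<omega> * (tens k \<omega> * tens l \<omega>) = (\<Prod>\<alpha>=1..n. X \<alpha> \<omega> ^ e \<alpha>)" for \<omega>
    using ijkl I_sub by (simp only: tens_eq_power e_def power_add prod.distrib)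
  have "\<alpha> \<in> {1..n}" using \<alpha> ijkl I_sub unfolding sdiff_def by blast
  moreover have "odd (e \<alpha>)" using \<alpha> by (auto simp: e_def sdiff_def)
  ultimately have "(\<integral>\<omega>. (\<Prod>\<alpha>=1..n. X \<alpha> \<omega> ^ e \<alpha>) \<partial>N) = 0"
    using integrable_tens4[OF ijkl] unfolding eq by (intro odd_moment_zero)
  then show ?thesis by (simp add: cov4_def uv eq)
qed

text \<open>Nonnegativity admits Schur's test, hence estimates by row sums alone.\<close>

lemma cov4_nonneg:
  assumes u: "u \<in> I \<times> I" and v: "v \<in> I \<times> I"
  shows "cov4 u v \<ge> 0"
proof (cases "sdiff (fst u) (snd u) = sdiff (fst v) (snd v)")
  case True
  obtain i j k l where uv: "u = (i, j)" "v = (k, l)" by (metis surj_pair)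
  have ijkl: "i \<in> I" "j \<in> I" "k \<in> I" "l \<in> I" using u v uv by auto
  have "tens i \<omega> * tens j \<omega> * (tens k \<omega> * tens l \<omega>) \<ge> 0" for \<omega>
    using True uv tens_mult4[OF ijkl[THEN I_sub], of \<omega>] by simp
  then show ?thesis unfolding cov4_def uv by (intro Bochner_Integration.integral_nonneg) simp
next
  case False
  then show ?thesis using cov4_zero[OF u v] by simp
qed

text \<open>Given \<open>D = k \<triangle> l\<close>, the pair \<open>(k, l)\<close> is recovered from \<open>k \<inter> D\<close> and \<open>k \<inter> l\<close>.\<close>

lemma sum_pairs_sdiff_le:
  fixes f :: "nat set \<Rightarrow> real"
  assumes f: "\<And>C. f C \<ge> 0" and D: "D \<subseteq> {1..n}" "card D = 2 * s"
  shows "(\<Sum>v\<in>{v \<in> I \<times> I. sdiff (fst v) (snd v) = D}. f (fst v \<inter> snd v))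
    \<le> 4 ^ s * (\<Sum>C\<in>dsubsets n (d - s). f C)"
proof -
  let ?V = "{v \<in> I \<times> I. sdiff (fst v) (snd v) = D}"
  define g where "g = (\<lambda>v::nat set \<times> nat set. (fst v \<inter> D, fst v \<inter> snd v))"
  have finD: "finite D" using D finite_subset by blast
  have inj: "inj_on g ?V"
  proof (rule inj_onI)
    fix v v' assume v: "v \<in> ?V" "v' \<in> ?V" "g v = g v'"
    obtain k l k' l' where kl: "v = (k, l)" "v' = (k', l')" by (metis surj_pair)
    have D1: "(k - l) \<union> (l - k) = D" "(k' - l') \<union> (l' - k') = D"
      and e: "k \<inter> D = k' \<inter> D" "k \<inter> l = k' \<inter> l'"
      using v kl by (auto simp: g_def sdiff_def)
    have "k = (k \<inter> D) \<union> (k \<inter> l)" "k' = (k' \<inter> D) \<union> (k' \<inter> l')"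
      "l = (D - k \<inter> D) \<union> (k \<inter> l)" "l' = (D - k' \<inter> D) \<union> (k' \<inter> l')"
      using D1 by blast+
    then show "v = v'" using e kl by metis
  qed
  have img: "g ` ?V \<subseteq> Pow D \<times> dsubsets n (d - s)"
  proof
    fix z assume "z \<in> g ` ?V"
    then obtain k l where kl: "k \<in> I" "l \<in> I" "sdiff k l = D" "z = (k \<inter> D, k \<inter> l)"
      by (auto simp: g_def)
    have fin: "finite k" "finite l" using kl I_finite by auto
    have "card (k - l) = card k - card (k \<inter> l)" "card (l - k) = card l - card (k \<inter> l)"
      using fin by (simp_all add: card_Diff_subset_Int Int_commute)
    moreover have "card D = card (k - l) + card (l - k)"
      unfolding kl(3)[symmetric] sdiff_def using fin by (intro card_Un_disjoint) auto
    moreover have "card (k \<inter> l) \<le> d" using card_mono[of k "k \<inter> l"] fin I_card kl by auto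
    ultimately have "card (k \<inter> l) = d - s" using D(2) I_card kl by simp
    then show "z \<in> Pow D \<times> dsubsets n (d - s)"
      using kl I_sub by (auto simp: dsubsets_def)
  qed
  have "(\<Sum>v\<in>?V. f (fst v \<inter> snd v)) = (\<Sum>z\<in>g ` ?V. f (snd z))"
    unfolding sum.reindex[OF inj] by (simp add: g_def)
  also have "\<dots> \<le> (\<Sum>z\<in>Pow D \<times> dsubsets n (d - s). f (snd z))"
    using img finD f by (intro sum_mono2) (auto simp: dsubsets_def)
  also have "\<dots> = (\<Sum>D1\<in>Pow D. \<Sum>C\<in>dsubsets n (d - s). f C)"
    by (simp only: sum.cartesian_product split_beta')
  \<comment> \<open>\<open>D\<close> has \<open>2 s\<close> elements, hence \<open>4 ^ s\<close>
    subsets.\<close>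
  also have "\<dots> = 4 ^ s * (\<Sum>C\<in>dsubsets n (d - s). f C)"
    using finD D(2) by (simp add: card_Pow power_mult)
  finally show ?thesis .
qed

text \<open>Only pairs with the symmetric difference of \<open>(i, j)\<close> count, and by
  \<open>tens_mult4\<close> their sum is at most \<open>4 ^ s\<close> times the square belonging to
  \<open>i \<union> j\<close> times \<open>\<Sum> x_C^2\<close> over \<open>C\<close> of size
  \<open>d - s\<close>. As \<open>(d - s)! \<Sum> x_C^2 <= S ^ (d - s)\<close> and
  \<open>i \<union> j\<close> has \<open>d + s\<close> elements, \<open>moment_set_le\<close>
  compares the mean with \<open>M\<close>.\<close>

lemma cov4_row_sum:
  assumes ij: "i \<in> I" "j \<in> I" "i \<noteq> j"
  defines "s \<equiv> card (i - j)"
  shows "(\<Sum>v\<in>I \<times> I. cov4 (i, j) v) \<le> 4 ^ s * M / (real (ff (d + s)) * fact (d - s))"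
    and "s \<in> {1..d}"
proof -
  have fin: "finite i" "finite j" using ij I_finite by auto
  have sub: "i \<subseteq> {1..n}" "j \<subseteq> {1..n}" using ij I_sub by auto
  have ci: "card (i \<inter> j) \<le> d" "card i = d" "card j = d"
    using card_mono[of i "i \<inter> j"] fin I_card ij by auto
  have s1: "s = d - card (i \<inter> j)" and s2: "card (j - i) = s"
    using fin ci by (simp_all add: s_def card_Diff_subset_Int Int_commute)
  have "i - j \<noteq> {}"
    using ij ci card_subset_eq[of j i] fin by auto
  then have "s > 0" using fin by (simp add: s_def card_gt_0_iff)
  then show s: "s \<in> {1..d}" using s1 by simp
  let ?D = "sdiff i j"
  have cD: "card ?D = 2 * s"
    unfolding sdiff_def using fin s2 by (subst card_Un_disjoint) (auto simp: s_def)
  have "card (i \<union> j) = card i + card j - card (i \<inter> j)"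
    using card_Un_Int[of i j] fin by simp
  then have cU: "card (i \<union> j) = d + s" using ci s1 by simp
  let ?V = "{v \<in> I \<times> I. sdiff (fst v) (snd v) = ?D}"
  define F where "F = (\<lambda>\<omega>. (tens (i \<union> j) \<omega>)\<^sup>2 * (\<Sum>C\<in>dsubsets n (d - s). (tens C \<omega>)\<^sup>2))"
  have Fm: "F \<in> borel_measurable N"
    unfolding F_def using sub by (auto simp: dsubsets_def)
  have F0: "F \<omega> \<ge> 0" for \<omega> by (auto simp: F_def intro!: mult_nonneg_nonneg sum_nonneg)
  have ffpos: "real (ff (d + s)) > 0"
    using s d_le by (auto simp: ff_def intro!: prod_pos)
  have Fle: "ennreal (real (ff (d + s)) * fact (d - s)) * E (\<lambda>\<omega>. ennreal (F \<omega>)) \<le> ennreal M"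
  proof -
    have "ennreal (real (ff (d + s)) * fact (d - s)) * E (\<lambda>\<omega>. ennreal (F \<omega>))
        = of_nat (ff (d + s)) * E (\<lambda>\<omega>. ennreal (fact (d - s)) * ennreal (F \<omega>))"
      using Fm by (subst nn_integral_cmult) (auto simp: ennreal_mult' mult.assoc ennreal_of_nat_eq_real_of_nat)
    also have "\<dots> \<le> of_nat (ff (d + s)) * E (\<lambda>\<omega>. (\<Prod>\<alpha>\<in>i \<union> j. sq (X \<alpha> \<omega>)) * S \<omega> ^ (d - s))"
    proof (intro mult_left_mono nn_integral_mono)
      fix \<omega>
      have "ennreal (fact (d - s)) * ennreal (F \<omega>) = (\<Prod>\<alpha>\<in>i \<union> j. sq (X \<alpha> \<omega>)) *
          (ennreal (fact (d - s)) * (\<Sum>C\<in>dsubsets n (d - s). \<Prod>\<alpha>\<in>C. sq (X \<alpha> \<omega>)))"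
        unfolding F_def tens_sq[symmetric]
        by (simp add: ennreal_mult sum_nonneg sum_ennreal mult.left_commute)
      also have "\<dots> \<le> (\<Prod>\<alpha>\<in>i \<union> j. sq (X \<alpha> \<omega>)) * S \<omega> ^ (d - s)"
        by (intro mult_left_mono sum_tens_sq_le) simp
      finally show "ennreal (fact (d - s)) * ennreal (F \<omega>) \<le> (\<Prod>\<alpha>\<in>i \<union> j. sq (X \<alpha> \<omega>)) * S \<omega> ^ (d - s)" .
    qed simp
    also have "\<dots> \<le> E (\<lambda>\<omega>. S \<omega> ^ ((d + s) + (d - s)))"
      using sub cU by (intro moment_set_le) auto
    also have "(d + s) + (d - s) = 2 * d" using s by simp
    finally show ?thesis by (simp add: M)
  qed
  have Fint: "integrable N F"
  proof (rule integrableI_nonneg[OF Fm])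
    show "E (\<lambda>\<omega>. ennreal (F \<omega>)) < \<infinity>"
    proof (rule ccontr)
      assume "\<not> E (\<lambda>\<omega>. ennreal (F \<omega>)) < \<infinity>"
      then have "E (\<lambda>\<omega>. ennreal (F \<omega>)) = \<top>" by (metis less_top infinity_ennreal_def)
      with Fle ffpos show False by (simp add: ennreal_mult_top top_unique)
    qed
  qed (simp add: F0)
  have Freal: "(\<integral>\<omega>. F \<omega> \<partial>N) \<le> M / (real (ff (d + s)) * fact (d - s))"
  proof -
    have "ennreal (real (ff (d + s)) * fact (d - s) * (\<integral>\<omega>. F \<omega> \<partial>N)) \<le> ennreal M"
      using Fle F0 ffpos by (simp add: nn_integral_eq_integral[OF Fint] ennreal_mult')
    then have "real (ff (d + s)) * fact (d - s) * (\<integral>\<omega>. F \<omega> \<partial>N) \<le> M"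
      using M_nonneg by (simp add: ennreal_le_iff)
    then show ?thesis using ffpos by (simp add: field_simps)
  qed
  have tij: "tens i \<omega> * tens j \<omega> * (tens (fst v) \<omega> * tens (snd v) \<omega>)
      = (tens (i \<union> j) \<omega>)\<^sup>2 * (tens (fst v \<inter> snd v) \<omega>)\<^sup>2" if "v \<in> ?V" for v \<omega>
  proof -
    have "fst v \<in> I" "snd v \<in> I" "sdiff i j = sdiff (fst v) (snd v)" using that by auto
    then show ?thesis using sub I_sub by (intro tens_mult4) simp_all
  qed
  have "(\<Sum>v\<in>I \<times> I. cov4 (i, j) v) = (\<Sum>v\<in>?V. cov4 (i, j) v)"
    using I_fin ij cov4_zero[of "(i, j)"] by (intro sum.mono_neutral_right) auto
  also have "\<dots> = (\<integral>\<omega>. (\<Sum>v\<in>?V. tens i \<omega> * tens j \<omega> * (tens (fst v) \<omega> * tens (snd v) \<omega>)) \<partial>N)"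
    unfolding cov4_def using ij
    by (subst Bochner_Integration.integral_sum) (auto intro!: integrable_tens4)
  also have "\<dots> \<le> (\<integral>\<omega>. 4 ^ s * F \<omega> \<partial>N)"
  proof (rule integral_mono)
    show "integrable N (\<lambda>\<omega>. \<Sum>v\<in>?V. tens i \<omega> * tens j \<omega> * (tens (fst v) \<omega> * tens (snd v) \<omega>))"
      using ij by (intro Bochner_Integration.integrable_sum integrable_tens4) auto
    fix \<omega>
    have "(\<Sum>v\<in>?V. tens i \<omega> * tens j \<omega> * (tens (fst v) \<omega> * tens (snd v) \<omega>))
        = (tens (i \<union> j) \<omega>)\<^sup>2 * (\<Sum>v\<in>?V. (tens (fst v \<inter> snd v) \<omega>)\<^sup>2)"
      unfolding sum_distrib_left by (intro sum.cong refl tij)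
    also have "\<dots> \<le> (tens (i \<union> j) \<omega>)\<^sup>2 * (4 ^ s * (\<Sum>C\<in>dsubsets n (d - s). (tens C \<omega>)\<^sup>2))"
      using sub cD by (intro mult_left_mono sum_pairs_sdiff_le) (auto simp: sdiff_def)
    finally show "(\<Sum>v\<in>?V. tens i \<omega> * tens j \<omega> * (tens (fst v) \<omega> * tens (snd v) \<omega>)) \<le> 4 ^ s * F \<omega>"
      by (simp add: F_def mult.left_commute)
  qed (use Fint in simp)
  also have "\<dots> \<le> 4 ^ s * (M / (real (ff (d + s)) * fact (d - s)))"
    using mult_left_mono[OF Freal, of "4 ^ s"] by simp
  finally show "(\<Sum>v\<in>I \<times> I. cov4 (i, j) v) \<le> 4 ^ s * M / (real (ff (d + s)) * fact (d - s))"
    by simp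
qed

text \<open>Schur's test for \<open>cov4\<close>; the squared coefficients are summed row by
  row.\<close>

lemma offdiag_second_moment:
  fixes A :: "nat set \<Rightarrow> nat set \<Rightarrow> real"
  assumes \<rho>: "\<And>s. s \<in> {1..d} \<Longrightarrow> 4 ^ s * M / (real (ff (d + s)) * fact (d - s)) \<le> \<rho>"
    and A: "\<And>i. i \<in> I \<Longrightarrow> (\<Sum>j\<in>I. (A i j)\<^sup>2) \<le> \<tau>\<^sup>2" and \<rho>0: "\<rho> \<ge> 0"
  defines "P \<equiv> {u \<in> I \<times> I. fst u \<noteq> snd u}"
  defines "O' \<equiv> \<lambda>\<omega>. \<Sum>u\<in>P. A (fst u) (snd u) * (tens (fst u) \<omega> * tens (snd u) \<omega>)"
  shows "integrable N (\<lambda>\<omega>. (O' \<omega>)\<^sup>2)" "(\<integral>\<omega>. (O' \<omega>)\<^sup>2 \<partial>N) \<le> \<tau>\<^sup>2 * (real (card I) * \<rho>)"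
proof -
  define a where "a = (\<lambda>u. A (fst u) (snd u))"
  have finP: "finite P" using I_fin by (simp add: P_def)
  have O2: "(O' \<omega>)\<^sup>2 = (\<Sum>u\<in>P. \<Sum>v\<in>P. a u * a v *
      (tens (fst u) \<omega> * tens (snd u) \<omega> * (tens (fst v) \<omega> * tens (snd v) \<omega>)))" for \<omega>
    unfolding power2_eq_square O'_def sum_product a_def by (intro sum.cong refl) (simp add: mult_ac)
  have int: "integrable N (\<lambda>\<omega>. a u * a v *
      (tens (fst u) \<omega> * tens (snd u) \<omega> * (tens (fst v) \<omega> * tens (snd v) \<omega>)))" if "u \<in> P" "v \<in> P" for u v
    using that by (intro integrable_mult_right integrable_tens4) (auto simp: P_def)
  show "integrable N (\<lambda>\<omega>. (O' \<omega>)\<^sup>2)"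
    unfolding O2 by (intro Bochner_Integration.integrable_sum int)
  let ?t = "\<lambda>u v \<omega>. a u * a v * (tens (fst u) \<omega> * tens (snd u) \<omega> * (tens (fst v) \<omega> * tens (snd v) \<omega>))"
  have "(\<integral>\<omega>. (O' \<omega>)\<^sup>2 \<partial>N) = (\<Sum>u\<in>P. (\<integral>\<omega>. (\<Sum>v\<in>P. ?t u v \<omega>) \<partial>N))"
    unfolding O2 by (intro Bochner_Integration.integral_sum Bochner_Integration.integrable_sum int)
  also have "\<dots> = (\<Sum>u\<in>P. \<Sum>v\<in>P. (\<integral>\<omega>. ?t u v \<omega> \<partial>N))"
    by (intro sum.cong refl Bochner_Integration.integral_sum int)
  also have "\<dots> = (\<Sum>u\<in>P. \<Sum>v\<in>P. a u * a v * cov4 u v)"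
    by (simp add: cov4_def)
  also have "\<dots> \<le> (\<Sum>u\<in>P. (a u)\<^sup>2 * (\<Sum>v\<in>P. cov4 u v))"
    by (intro bilinear_sum_le cov4_nonneg cov4_commute) (auto simp: P_def)
  also have "\<dots> \<le> (\<Sum>u\<in>P. (a u)\<^sup>2 * \<rho>)"
  proof (intro sum_mono mult_left_mono)
    fix u assume u: "u \<in> P"
    obtain i j where ij: "u = (i, j)" "i \<in> I" "j \<in> I" "i \<noteq> j" 
      using u by (cases u) (simp add: P_def)
    have "(\<Sum>v\<in>P. cov4 u v) \<le> (\<Sum>v\<in>I \<times> I. cov4 u v)"
      using I_fin u by (intro sum_mono2 cov4_nonneg) (auto simp: P_def)
    also have "\<dots> \<le> \<rho>"
      using cov4_row_sum[OF ij(2,3,4)] \<rho>[of "card (i - j)"] unfolding ij(1) by linarith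
    finally show "(\<Sum>v\<in>P. cov4 u v) \<le> \<rho>" .
  qed simp
  also have "\<dots> = (\<Sum>u\<in>P. (a u)\<^sup>2) * \<rho>" by (simp add: sum_distrib_right)
  also have "\<dots> \<le> (real (card I) * \<tau>\<^sup>2) * \<rho>"
  proof (intro mult_right_mono \<rho>0)
    have "(\<Sum>u\<in>P. (a u)\<^sup>2) \<le> (\<Sum>u\<in>I \<times> I. (a u)\<^sup>2)"
      using I_fin by (intro sum_mono2) (auto simp: P_def)
    also have "\<dots> = (\<Sum>i\<in>I. \<Sum>j\<in>I. (A i j)\<^sup>2)"
      by (simp add: a_def sum.cartesian_product split_beta')
    also have "\<dots> \<le> (\<Sum>i\<in>I. \<tau>\<^sup>2)" by (intro sum_mono A)
    finally show "(\<Sum>u\<in>P. (a u)\<^sup>2) \<le> real (card I) * \<tau>\<^sup>2" by simp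
  qed
  finally show "(\<integral>\<omega>. (O' \<omega>)\<^sup>2 \<partial>N) \<le> \<tau>\<^sup>2 * (real (card I) * \<rho>)" by (simp add: mult_ac)
qed

lemma moment_exch:
  assumes "B \<subseteq> {1..n}" "card B = k"
  shows "E (\<lambda>\<omega>. ennreal ((tens B \<omega>)\<^sup>2)) = mom k"
  using nn_integral_prod_set[OF symf_const[of 1] sq_meas assms] by (simp add: tens_sq mom_def)

text \<open>After expanding the square, disjoint pairs have the exact mean \<beta>. Overlapping ones
  have no bound of their own, but the sum of \<open>E (x_i^2 x_k^2)\<close> over all pairs is at
  most \<open>M / (fact d)^2\<close>, and the share of the disjoint pairs in it is known exactly:
  hence the difference \<open>M / (fact d)^2 - Nd * \<beta>\<close>.\<close>

lemma diag_second_moment: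
  fixes a :: "nat set \<Rightarrow> real"
  assumes \<alpha>: "mom d = ennreal \<alpha>" "\<alpha> \<ge> 0" and \<beta>: "mom (2 * d) = ennreal \<beta>" "\<beta> \<ge> 0"
    and a: "\<And>i. i \<in> I \<Longrightarrow> 0 \<le> a i" "\<And>i. i \<in> I \<Longrightarrow> a i \<le> \<tau>"
  defines "D \<equiv> \<lambda>\<omega>. \<Sum>i\<in>I. a i * ((tens i \<omega>)\<^sup>2 - 1)"
    and "Nd \<equiv> real (card {u \<in> I \<times> I. fst u \<inter> snd u = {}})"
    and "p \<equiv> real (card I)"
  shows "integrable N (\<lambda>\<omega>. (D \<omega>)\<^sup>2)"
    "(\<integral>\<omega>. (D \<omega>)\<^sup>2 \<partial>N) \<le> \<tau>\<^sup>2 * (M / (fact d)\<^sup>2 - Nd * \<beta> + p\<^sup>2 * \<bar>\<beta> - 2 * \<alpha> + 1\<bar> + (p\<^sup>2 - Nd))"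
proof -
  let ?q = "\<lambda>i \<omega>. (tens i \<omega>)\<^sup>2"
  have q2: "integrable N (\<lambda>\<omega>. ?q i \<omega> * ?q k \<omega>)" if "i \<in> I" "k \<in> I" for i k
    using integrable_tens4[OF that(1,1,2,2)] by (simp add: power2_eq_square)
  have q1: "integrable N (?q i)" and Eq1: "(\<integral>\<omega>. ?q i \<omega> \<partial>N) = \<alpha>" if i: "i \<in> I" for i
  proof -
    have e: "E (\<lambda>\<omega>. ennreal (?q i \<omega>)) = ennreal \<alpha>"
      using moment_exch[OF I_sub I_card, OF i i] \<alpha> by simp
    show int: "integrable N (?q i)"
      using e i I_sub by (intro integrableI_nonneg) auto
    show "(\<integral>\<omega>. ?q i \<omega> \<partial>N) = \<alpha>"
      using nn_integral_eq_integral[OF int] e \<alpha> by simp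
  qed
  have Eq2: "(\<integral>\<omega>. ?q i \<omega> * ?q k \<omega> \<partial>N) = \<beta>" if ik: "i \<in> I" "k \<in> I" "i \<inter> k = {}" for i k
  proof -
    have t: "?q i \<omega> * ?q k \<omega> = (tens (i \<union> k) \<omega>)\<^sup>2" for \<omega>
      using tens_mult_disjoint[of i k \<omega>] ik I_sub by (simp add: power_mult_distrib)
    have "card (i \<union> k) = 2 * d"
      using ik I_card I_finite by (subst card_Un_disjoint) auto
    then have "E (\<lambda>\<omega>. ennreal ((tens (i \<union> k) \<omega>)\<^sup>2)) = ennreal \<beta>"
      using moment_exch[of "i \<union> k" "2 * d"] ik I_sub \<beta> by auto
    then show ?thesis
      using nn_integral_eq_integral[OF q2[OF ik(1,2)]] \<beta>(2) unfolding t by simp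
  qed
  define w where "w = (\<lambda>u. (\<integral>\<omega>. ?q (fst u) \<omega> * ?q (snd u) \<omega> \<partial>N))"
  have w0: "w u \<ge> 0" for u by (simp add: w_def)
  let ?t = "\<lambda>u \<omega>. a (fst u) * a (snd u) * (?q (fst u) \<omega> * ?q (snd u) \<omega> - ?q (fst u) \<omega> - ?q (snd u) \<omega> + 1)"
  have D2: "(D \<omega>)\<^sup>2 = (\<Sum>u\<in>I \<times> I. ?t u \<omega>)" for \<omega>
  proof -
    have "(D \<omega>)\<^sup>2 = D \<omega> * D \<omega>" by (rule power2_eq_square)
    also have "\<dots> = (\<Sum>u\<in>I \<times> I. ?t u \<omega>)"
      unfolding D_def sum_product sum.cartesian_product
      by (intro sum.cong refl) (auto simp: algebra_simps)
    finally show ?thesis .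
  qed
  have int: "integrable N (?t u)" and Et: "(\<integral>\<omega>. ?t u \<omega> \<partial>N) = a (fst u) * a (snd u) * (w u - 2 * \<alpha> + 1)"
    if "u \<in> I \<times> I" for u
  proof -
    have u: "fst u \<in> I" "snd u \<in> I" using that by auto
    note [simp] = q2[OF u] q1[OF u(1)] q1[OF u(2)]
    show "integrable N (?t u)" by simp
    show "(\<integral>\<omega>. ?t u \<omega> \<partial>N) = a (fst u) * a (snd u) * (w u - 2 * \<alpha> + 1)"
      using u by (simp add: Eq1 w_def prob_space)
  qed
  show "integrable N (\<lambda>\<omega>. (D \<omega>)\<^sup>2)"
    unfolding D2 by (intro Bochner_Integration.integrable_sum int)
  let ?P = "{u \<in> I \<times> I. fst u \<inter> snd u = {}}" and ?O = "{u \<in> I \<times> I. fst u \<inter> snd u \<noteq> {}}"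
  have split: "I \<times> I = ?P \<union> ?O" "?P \<inter> ?O = {}" by auto
  have fin: "finite ?P" "finite ?O" using I_fin by auto
  have sp: "(\<Sum>u\<in>I \<times> I. f u) = (\<Sum>u\<in>?P. f u) + (\<Sum>u\<in>?O. f u)" for f :: "nat set \<times> nat set \<Rightarrow> real"
    using sum.union_disjoint[OF fin split(2), of f] split(1) by simp
  have wP: "(\<Sum>u\<in>?P. w u) = Nd * \<beta>"
  proof -
    have "(\<Sum>u\<in>?P. w u) = (\<Sum>u\<in>?P. \<beta>)"
      unfolding w_def by (intro sum.cong refl) (auto intro: Eq2)
    then show ?thesis by (simp add: Nd_def)
  qed
  have cO: "real (card ?O) = p\<^sup>2 - Nd"
    using sp[of "\<lambda>_. 1"] by (simp add: Nd_def p_def card_cartesian_product power2_eq_square)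
  \<comment> \<open>The total is the mean of \<open>(\<Sum> x_i^2)^2\<close>, and
    \<open>elementary_symmetric_le\<close> bounds \<open>fact d\<close> times the inner sum by
    \<open>Sr ^ d\<close>.\<close>
  have wall: "(\<Sum>u\<in>I \<times> I. w u) \<le> M / (fact d)\<^sup>2"
  proof -
    let ?Q = "\<lambda>\<omega>. \<Sum>i\<in>I. ?q i \<omega>"
    have Q2: "(?Q \<omega>)\<^sup>2 = (\<Sum>u\<in>I \<times> I. ?q (fst u) \<omega> * ?q (snd u) \<omega>)" for \<omega>
      by (simp add: power2_eq_square[of "?Q \<omega>"] sum_product sum.cartesian_product split_beta')
    have iQ: "integrable N (\<lambda>\<omega>. (?Q \<omega>)\<^sup>2)"
      unfolding Q2 by (intro Bochner_Integration.integrable_sum q2) auto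
    have "(\<integral>\<omega>. (?Q \<omega>)\<^sup>2 \<partial>N) = (\<Sum>u\<in>I \<times> I. w u)"
      unfolding Q2 w_def by (intro Bochner_Integration.integral_sum q2) auto
    moreover have "(fact d)\<^sup>2 * (\<integral>\<omega>. (?Q \<omega>)\<^sup>2 \<partial>N) \<le> M"
    proof -
      have "(fact d * ?Q \<omega>)\<^sup>2 \<le> Sr \<omega> ^ (2 * d)" for \<omega>
      proof -
        have "fact d * ?Q \<omega> \<le> Sr \<omega> ^ d"
          using elementary_symmetric_le[of "{1..n}" "\<lambda>\<alpha>. (X \<alpha> \<omega>)\<^sup>2" d]
          by (simp add: Sr_def dsubsets_def tens_def prod_power_distrib)
        then have "(fact d * ?Q \<omega>)\<^sup>2 \<le> (Sr \<omega> ^ d)\<^sup>2"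
          by (intro power_mono) (auto intro!: mult_nonneg_nonneg sum_nonneg)
        then show ?thesis by (simp add: power_mult[symmetric] mult.commute)
      qed
      then have "(\<integral>\<omega>. (fact d)\<^sup>2 * (?Q \<omega>)\<^sup>2 \<partial>N) \<le> (\<integral>\<omega>. Sr \<omega> ^ (2 * d) \<partial>N)"
        using iQ integrable_Sr_power[OF M]
        by (intro integral_mono) (auto simp: power_mult_distrib)
      also have "\<dots> = M"
        using nn_integral_eq_integral[OF integrable_Sr_power[OF M]] M M_nonneg
        by (simp add: S_eq_Sr ennreal_power Sr_nonneg Bochner_Integration.integral_nonneg)
      finally show ?thesis by simp
    qed
    ultimately show ?thesis by (simp add: field_simps)
  qed
  have aa: "0 \<le> a (fst u) * a (snd u)" "a (fst u) * a (snd u) \<le> \<tau>\<^sup>2" if "u \<in> I \<times> I" for u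
  proof -
    have u: "fst u \<in> I" "snd u \<in> I" using that by auto
    show "0 \<le> a (fst u) * a (snd u)" using a(1)[OF u(1)] a(1)[OF u(2)] by simp
    show "a (fst u) * a (snd u) \<le> \<tau>\<^sup>2"
      using mult_mono'[OF a(2)[OF u(1)] a(2)[OF u(2)] a(1)[OF u(1)] a(1)[OF u(2)]]
      by (simp add: power2_eq_square)
  qed
  have "(\<integral>\<omega>. (D \<omega>)\<^sup>2 \<partial>N) = (\<Sum>u\<in>I \<times> I. a (fst u) * a (snd u) * (w u - 2 * \<alpha> + 1))"
  proof -
    have "(\<integral>\<omega>. (D \<omega>)\<^sup>2 \<partial>N) = (\<Sum>u\<in>I \<times> I. (\<integral>\<omega>. ?t u \<omega> \<partial>N))"
      unfolding D2 by (intro Bochner_Integration.integral_sum int)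
    also have "\<dots> = (\<Sum>u\<in>I \<times> I. a (fst u) * a (snd u) * (w u - 2 * \<alpha> + 1))"
      by (intro sum.cong refl Et)
    finally show ?thesis .
  qed
  also have "\<dots> \<le> (\<Sum>u\<in>?P. \<tau>\<^sup>2 * \<bar>\<beta> - 2 * \<alpha> + 1\<bar>) + (\<Sum>u\<in>?O. \<tau>\<^sup>2 * (w u + 1))"
    unfolding sp
  proof (intro add_mono sum_mono)
    fix u assume u: "u \<in> ?P"
    then have uI: "u \<in> I \<times> I" by auto
    have wb: "w u = \<beta>" unfolding w_def using u by (intro Eq2) auto
    have "a (fst u) * a (snd u) * (w u - 2 * \<alpha> + 1) \<le> a (fst u) * a (snd u) * \<bar>\<beta> - 2 * \<alpha> + 1\<bar>"
      unfolding wb using aa[OF uI] by (intro mult_left_mono) auto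
    also have "\<dots> \<le> \<tau>\<^sup>2 * \<bar>\<beta> - 2 * \<alpha> + 1\<bar>" using aa[OF uI] by (intro mult_right_mono) auto
    finally show "a (fst u) * a (snd u) * (w u - 2 * \<alpha> + 1) \<le> \<tau>\<^sup>2 * \<bar>\<beta> - 2 * \<alpha> + 1\<bar>" .
  next
    fix u assume u: "u \<in> ?O"
    then have uI: "u \<in> I \<times> I" by auto
    have "a (fst u) * a (snd u) * (w u - 2 * \<alpha> + 1) \<le> a (fst u) * a (snd u) * (w u + 1)"
      using aa[OF uI] \<alpha>(2) by (intro mult_left_mono) auto
    also have "\<dots> \<le> \<tau>\<^sup>2 * (w u + 1)" using aa[OF uI] w0[of u] by (intro mult_right_mono) auto
    finally show "a (fst u) * a (snd u) * (w u - 2 * \<alpha> + 1) \<le> \<tau>\<^sup>2 * (w u + 1)" .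
  qed
  also have "\<dots> = \<tau>\<^sup>2 * (Nd * \<bar>\<beta> - 2 * \<alpha> + 1\<bar> + ((\<Sum>u\<in>I \<times> I. w u) - Nd * \<beta> + (p\<^sup>2 - Nd)))"
  proof -
    have wO: "(\<Sum>u\<in>?O. w u) = (\<Sum>u\<in>I \<times> I. w u) - Nd * \<beta>" using sp[of w] wP by simp
    have "(\<Sum>u\<in>?O. \<tau>\<^sup>2 * (w u + 1)) = \<tau>\<^sup>2 * ((\<Sum>u\<in>?O. w u) + real (card ?O))"
      by (simp add: sum_distrib_left[symmetric] sum.distrib)
    then show ?thesis
      unfolding wO cO by (simp add: Nd_def[symmetric] algebra_simps)
  qed
  also have "\<dots> \<le> \<tau>\<^sup>2 * (p\<^sup>2 * \<bar>\<beta> - 2 * \<alpha> + 1\<bar> + (M / (fact d)\<^sup>2 - Nd * \<beta> + (p\<^sup>2 - Nd)))"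
  proof (rule mult_left_mono)
    have "0 \<le> real (card ?O)" by simp
    then have "Nd \<le> p\<^sup>2" unfolding cO by simp
    then have "Nd * \<bar>\<beta> - 2 * \<alpha> + 1\<bar> \<le> p\<^sup>2 * \<bar>\<beta> - 2 * \<alpha> + 1\<bar>" by (intro mult_right_mono) auto
    then show "Nd * \<bar>\<beta> - 2 * \<alpha> + 1\<bar> + ((\<Sum>u\<in>I \<times> I. w u) - Nd * \<beta> + (p\<^sup>2 - Nd))
        \<le> p\<^sup>2 * \<bar>\<beta> - 2 * \<alpha> + 1\<bar> + (M / (fact d)\<^sup>2 - Nd * \<beta> + (p\<^sup>2 - Nd))"
      using wall by linarith
  qed simp
  finally show "(\<integral>\<omega>. (D \<omega>)\<^sup>2 \<partial>N) \<le> \<tau>\<^sup>2 * (M / (fact d)\<^sup>2 - Nd * \<beta> + p\<^sup>2 * \<bar>\<beta> - 2 * \<alpha> + 1\<bar> + (p\<^sup>2 - Nd))"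
    by (simp add: algebra_simps)
qed

text \<open>Diagonal and off-diagonal parts are estimated apart; the factor 2 comes from
  \<open>(D + O)^2 <= 2 D^2 + 2 O^2\<close>.\<close>

lemma quad_form_variance:
  fixes A :: "nat set \<Rightarrow> nat set \<Rightarrow> real"
  assumes \<alpha>: "mom d = ennreal \<alpha>" "\<alpha> \<ge> 0" and \<beta>: "mom (2 * d) = ennreal \<beta>" "\<beta> \<ge> 0"
    and \<rho>: "\<And>s. s \<in> {1..d} \<Longrightarrow> 4 ^ s * M / (real (ff (d + s)) * fact (d - s)) \<le> \<rho>" and \<rho>0: "\<rho> \<ge> 0"
    and a: "\<And>i. i \<in> I \<Longrightarrow> 0 \<le> A i i" "\<And>i. i \<in> I \<Longrightarrow> A i i \<le> \<tau>"
    and A: "\<And>i. i \<in> I \<Longrightarrow> (\<Sum>j\<in>I. (A i j)\<^sup>2) \<le> \<tau>\<^sup>2"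
  defines "Nd \<equiv> real (card {u \<in> I \<times> I. fst u \<inter> snd u = {}})"
    and "p \<equiv> real (card I)"
  defines "Q \<equiv> \<lambda>\<omega>. quad I A (\<lambda>i. tens i \<omega>) - trace_on I A"
  shows "(\<integral>\<^sup>+\<omega>. ennreal ((Q \<omega>)\<^sup>2) \<partial>N) \<le> ennreal (2 * \<tau>\<^sup>2 *
    (M / (fact d)\<^sup>2 - Nd * \<beta> + p\<^sup>2 * \<bar>\<beta> - 2 * \<alpha> + 1\<bar> + (p\<^sup>2 - Nd) + p * \<rho>))"
proof -
  let ?P = "{u \<in> I \<times> I. fst u \<noteq> snd u}"
  define D where "D = (\<lambda>\<omega>. \<Sum>i\<in>I. A i i * ((tens i \<omega>)\<^sup>2 - 1))"
  define O' where "O' = (\<lambda>\<omega>. \<Sum>u\<in>?P. A (fst u) (snd u) * (tens (fst u) \<omega> * tens (snd u) \<omega>))"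
  have Q: "Q \<omega> = D \<omega> + O' \<omega>" for \<omega>
  proof -
    let ?f = "\<lambda>u. A (fst u) (snd u) * (tens (fst u) \<omega> * tens (snd u) \<omega>)"
    have "quad I A (\<lambda>i. tens i \<omega>) = (\<Sum>u\<in>I \<times> I. ?f u)"
      by (simp add: quad_def dot_def app_def sum_distrib_left sum.cartesian_product split_beta' mult_ac)
    also have "I \<times> I = ?P \<union> (\<lambda>i. (i, i)) ` I" by auto
    also have "(\<Sum>u\<in>?P \<union> (\<lambda>i. (i, i)) ` I. ?f u) = (\<Sum>u\<in>?P. ?f u) + (\<Sum>u\<in>(\<lambda>i. (i, i)) ` I. ?f u)"
      using I_fin by (intro sum.union_disjoint) auto
    also have "(\<Sum>u\<in>(\<lambda>i. (i, i)) ` I. ?f u) = (\<Sum>i\<in>I. A i i * (tens i \<omega>)\<^sup>2)"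
      by (subst sum.reindex) (auto simp: inj_on_def power2_eq_square)
    finally show ?thesis
      by (simp add: Q_def D_def O'_def trace_on_def sum_subtractf right_diff_distrib)
  qed
  have d2: "integrable N (\<lambda>\<omega>. (D \<omega>)\<^sup>2)" "(\<integral>\<omega>. (D \<omega>)\<^sup>2 \<partial>N) \<le> \<tau>\<^sup>2 *
      (M / (fact d)\<^sup>2 - Nd * \<beta> + p\<^sup>2 * \<bar>\<beta> - 2 * \<alpha> + 1\<bar> + (p\<^sup>2 - Nd))"
    unfolding D_def Nd_def p_def using a by (intro diag_second_moment[OF \<alpha> \<beta>]; blast)+
  have o2: "integrable N (\<lambda>\<omega>. (O' \<omega>)\<^sup>2)" "(\<integral>\<omega>. (O' \<omega>)\<^sup>2 \<partial>N) \<le> \<tau>\<^sup>2 * (p * \<rho>)"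
    unfolding O'_def p_def using A \<rho> \<rho>0 by (intro offdiag_second_moment; blast)+
  have "(\<integral>\<^sup>+\<omega>. ennreal ((Q \<omega>)\<^sup>2) \<partial>N) \<le> (\<integral>\<^sup>+\<omega>. ennreal (2 * (D \<omega>)\<^sup>2 + 2 * (O' \<omega>)\<^sup>2) \<partial>N)"
  proof (intro nn_integral_mono ennreal_leI)
    fix \<omega>
    have "0 \<le> (D \<omega> - O' \<omega>)\<^sup>2" by simp
    then show "(Q \<omega>)\<^sup>2 \<le> 2 * (D \<omega>)\<^sup>2 + 2 * (O' \<omega>)\<^sup>2"
      unfolding Q by (simp add: power2_eq_square algebra_simps)
  qed
  also have "\<dots> = ennreal (\<integral>\<omega>. 2 * (D \<omega>)\<^sup>2 + 2 * (O' \<omega>)\<^sup>2 \<partial>N)"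
    using d2(1) o2(1) by (intro nn_integral_eq_integral) auto
  also have "(\<integral>\<omega>. 2 * (D \<omega>)\<^sup>2 + 2 * (O' \<omega>)\<^sup>2 \<partial>N) = 2 * (\<integral>\<omega>. (D \<omega>)\<^sup>2 \<partial>N) + 2 * (\<integral>\<omega>. (O' \<omega>)\<^sup>2 \<partial>N)"
    using d2(1) o2(1) by simp
  also have "ennreal \<dots> \<le> ennreal (2 * \<tau>\<^sup>2 *
    (M / (fact d)\<^sup>2 - Nd * \<beta> + p\<^sup>2 * \<bar>\<beta> - 2 * \<alpha> + 1\<bar> + (p\<^sup>2 - Nd) + p * \<rho>))"
  proof (rule ennreal_leI)
    have "2 * x + 2 * y \<le> 2 * T * (W + R)" if "x \<le> T * W" "y \<le> T * R" for x y T W R :: real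
      using that by (simp add: algebra_simps)
    from this[OF d2(2) o2(2)]
    show "2 * (\<integral>\<omega>. (D \<omega>)\<^sup>2 \<partial>N) + 2 * (\<integral>\<omega>. (O' \<omega>)\<^sup>2 \<partial>N) \<le> 2 * \<tau>\<^sup>2 *
      (M / (fact d)\<^sup>2 - Nd * \<beta> + p\<^sup>2 * \<bar>\<beta> - 2 * \<alpha> + 1\<bar> + (p\<^sup>2 - Nd) + p * \<rho>)" .
  qed
  finally show ?thesis .
qed

end

section \<open>Concentration\<close>

text \<open>One coordinate is integrated out at a time. The partial mean \<open>g\<close> inherits
  the bounded differences, and with the other coordinates fixed \<open>f\<close> stays within
  \<delta> of a reference value, in an interval of length \<open>2 \<delta>\<close>; Hoeffding's
  lemma then gives \<open>exp (l^2 (2 \<delta>)^2 / 8)\<close>.\<close>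

lemma mcdiarmid_exp:
  fixes \<mu> :: "'c measure" and f :: "('i \<Rightarrow> 'c) \<Rightarrow> real"
  assumes \<mu>: "prob_space \<mu>" and J: "finite J" and l: "l > 0"
    and f: "f \<in> borel_measurable (Pi\<^sub>M J (\<lambda>_. \<mu>))"
    and B: "\<And>y. y \<in> space (Pi\<^sub>M J (\<lambda>_. \<mu>)) \<Longrightarrow> \<bar>f y\<bar> \<le> B"
    and \<delta>: "\<And>k y a b. k \<in> J \<Longrightarrow> y \<in> space (Pi\<^sub>M J (\<lambda>_. \<mu>)) \<Longrightarrow> a \<in> space \<mu> \<Longrightarrow> b \<in> space \<mu> \<Longrightarrow>
      \<bar>f (y(k := a)) - f (y(k := b))\<bar> \<le> \<delta>"
  shows "(\<integral>\<^sup>+y. ennreal (exp (l * (f y - (\<integral>y. f y \<partial>Pi\<^sub>M J (\<lambda>_. \<mu>))))) \<partial>Pi\<^sub>M J (\<lambda>_. \<mu>))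
    \<le> ennreal (exp (real (card J) * (l\<^sup>2 * \<delta>\<^sup>2 / 2)))"
  using J f B \<delta>
proof (induction J arbitrary: f rule: finite_induct)
  case empty
  show ?case
    by (simp add: PiM_empty nn_integral_count_space_finite lebesgue_integral_count_space_finite)
next
  case (insert k J)
  interpret mu: prob_space \<mu> by (rule \<mu>)
  interpret pp: product_prob_space "\<lambda>_::'i. \<mu>" J
    using \<mu> by (intro product_prob_spaceI)
  interpret pk: product_prob_space "\<lambda>_::'i. \<mu>" "insert k J"
    using \<mu> by (intro product_prob_spaceI)
  let ?P = "Pi\<^sub>M J (\<lambda>_. \<mu>)" and ?Pk = "Pi\<^sub>M (insert k J) (\<lambda>_. \<mu>)"
  note f [measurable] = insert.prems(1)
  have upd [measurable]: "(\<lambda>(y, z). y(k := z)) \<in> measurable (?P \<Otimes>\<^sub>M \<mu>) ?Pk"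
    by (rule measurable_add_dim)
  have fpair [measurable]: "(\<lambda>(y, z). f (y(k := z))) \<in> borel_measurable (?P \<Otimes>\<^sub>M \<mu>)"
    using measurable_compose[OF upd f] by (simp add: split_beta')
  have sp: "y(k := z) \<in> space ?Pk" if "y \<in> space ?P" "z \<in> space \<mu>" for y z
    using measurable_space[OF upd, of "(y, z)"] that by (simp add: space_pair_measure)
  have fz: "(\<lambda>z. f (y(k := z))) \<in> borel_measurable \<mu>" if "y \<in> space ?P" for y
    using measurable_compose[OF measurable_Pair1'[OF that] fpair] by simp
  have fB: "\<bar>f (y(k := z))\<bar> \<le> B" if "y \<in> space ?P" "z \<in> space \<mu>" for y z
    using insert.prems(2)[OF sp[OF that]] .
  have iz: "integrable \<mu> (\<lambda>z. f (y(k := z)))" if "y \<in> space ?P" for y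
    using fz[OF that] fB[OF that] by (intro mu.integrable_const_bound[of _ B]) auto
  define g where "g = (\<lambda>y. \<integral>z. f (y(k := z)) \<partial>\<mu>)"
  have g: "g \<in> borel_measurable ?P"
    unfolding g_def using mu.borel_measurable_lebesgue_integral[OF fpair] by simp
  have gB: "\<bar>g y\<bar> \<le> B" if "y \<in> space ?P" for y
  proof -
    have "\<bar>g y\<bar> \<le> (\<integral>z. \<bar>f (y(k := z))\<bar> \<partial>\<mu>)" unfolding g_def by (rule integral_abs_bound)
    also have "\<dots> \<le> (\<integral>z. B \<partial>\<mu>)" using iz[OF that] fB[OF that] by (intro integral_mono) auto
    finally show ?thesis by (simp add: mu.prob_space)
  qed
  have g\<delta>: "\<bar>g (y(j := a)) - g (y(j := b))\<bar> \<le> \<delta>"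
    if j: "j \<in> J" and y: "y \<in> space ?P" and ab: "a \<in> space \<mu>" "b \<in> space \<mu>" for j y a b
  proof -
    have ya: "y(j := a) \<in> space ?P" "y(j := b) \<in> space ?P"
      using y ab j by (auto simp: space_PiM PiE_iff extensional_def)
    have jk: "j \<noteq> k" using j insert.hyps(2) by auto
    have "\<bar>g (y(j := a)) - g (y(j := b))\<bar> = \<bar>\<integral>z. f ((y(j := a))(k := z)) - f ((y(j := b))(k := z)) \<partial>\<mu>\<bar>"
      unfolding g_def using iz ya by simp
    also have "\<dots> \<le> (\<integral>z. \<bar>f ((y(j := a))(k := z)) - f ((y(j := b))(k := z))\<bar> \<partial>\<mu>)"
      by (rule integral_abs_bound)
    also have "\<dots> \<le> (\<integral>z. \<delta> \<partial>\<mu>)"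
    proof (intro integral_mono)
      fix z assume z: "z \<in> space \<mu>"
      show "\<bar>f ((y(j := a))(k := z)) - f ((y(j := b))(k := z))\<bar> \<le> \<delta>"
        unfolding fun_upd_twist[OF jk] using j by (intro insert.prems(3) sp[OF y z] ab) simp
    qed (use iz ya in auto)
    finally show ?thesis by (simp add: mu.prob_space)
  qed
  have int_f: "integrable ?Pk f"
    using insert.prems(2) by (intro pk.P.integrable_const_bound[of _ B]) auto
  have Ef: "(\<integral>y. f y \<partial>?Pk) = (\<integral>y. g y \<partial>?P)"
    unfolding g_def by (rule pp.product_integral_insert[OF insert.hyps int_f])
  define e where "e = (\<integral>y. g y \<partial>?P)"
  have "(\<integral>\<^sup>+y. ennreal (exp (l * (f y - e))) \<partial>?Pk)
      = (\<integral>\<^sup>+y. (\<integral>\<^sup>+z. ennreal (exp (l * (f (y(k := z)) - e))) \<partial>\<mu>) \<partial>?P)"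
    by (rule pp.product_nn_integral_insert[OF insert.hyps]) measurable
  also have "\<dots> \<le> (\<integral>\<^sup>+y. ennreal (exp (l * (g y - e))) * ennreal (exp (l\<^sup>2 * \<delta>\<^sup>2 / 2)) \<partial>?P)"
  proof (intro nn_integral_mono)
    fix y assume y: "y \<in> space ?P"
    obtain z0 where z0: "z0 \<in> space \<mu>" using mu.not_empty by blast
    interpret h: interval_bounded_random_variable \<mu> "\<lambda>z. f (y(k := z))" "f (y(k := z0)) - \<delta>" "f (y(k := z0)) + \<delta>"
    proof unfold_locales
      show "AE z in \<mu>. f (y(k := z)) \<in> {f (y(k := z0)) - \<delta>..f (y(k := z0)) + \<delta>}"
      proof (rule AE_I2)
        fix z assume z: "z \<in> space \<mu>"
        have "\<bar>f ((y(k := z0))(k := z)) - f ((y(k := z0))(k := z0))\<bar> \<le> \<delta>"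
          by (rule insert.prems(3)[OF insertI1 sp[OF y z0] z z0])
        then show "f (y(k := z)) \<in> {f (y(k := z0)) - \<delta>..f (y(k := z0)) + \<delta>}"
          by (simp add: abs_le_iff)
      qed
    qed (rule fz[OF y])
    have "(\<integral>\<^sup>+z. ennreal (exp (l * (f (y(k := z)) - e))) \<partial>\<mu>)
        = (\<integral>\<^sup>+z. ennreal (exp (l * (g y - e))) * ennreal (exp (l * (f (y(k := z)) - g y))) \<partial>\<mu>)"
      by (simp add: ennreal_mult'[symmetric] exp_add[symmetric] algebra_simps)
    also have "\<dots> = ennreal (exp (l * (g y - e))) * (\<integral>\<^sup>+z. ennreal (exp (l * (f (y(k := z)) - g y))) \<partial>\<mu>)"
      using fz[OF y] by (intro nn_integral_cmult) measurable
    also have "(\<integral>\<^sup>+z. ennreal (exp (l * (f (y(k := z)) - g y))) \<partial>\<mu>) \<le> ennreal (exp (l\<^sup>2 * \<delta>\<^sup>2 / 2))"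
      using h.Hoeffdings_lemma_nn_integral[OF l] by (simp add: g_def power_mult_distrib mult.commute)
    finally show "(\<integral>\<^sup>+z. ennreal (exp (l * (f (y(k := z)) - e))) \<partial>\<mu>)
        \<le> ennreal (exp (l * (g y - e))) * ennreal (exp (l\<^sup>2 * \<delta>\<^sup>2 / 2))"
      by (simp add: mult_left_mono)
  qed
  also have "\<dots> = (\<integral>\<^sup>+y. ennreal (exp (l * (g y - e))) \<partial>?P) * ennreal (exp (l\<^sup>2 * \<delta>\<^sup>2 / 2))"
    by (rule nn_integral_multc) (use g in simp)
  also have "\<dots> \<le> ennreal (exp (real (card J) * (l\<^sup>2 * \<delta>\<^sup>2 / 2))) * ennreal (exp (l\<^sup>2 * \<delta>\<^sup>2 / 2))"
    unfolding e_def using insert.IH[OF g gB g\<delta>] by (intro mult_right_mono) auto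
  also have "\<dots> = ennreal (exp (real (card (insert k J)) * (l\<^sup>2 * \<delta>\<^sup>2 / 2)))"
    using insert.hyps by (simp add: ennreal_mult'[symmetric] exp_add[symmetric] algebra_simps add_divide_distrib)
  finally show ?case unfolding Ef e_def .
qed

lemma mcdiarmid_upper:
  fixes \<mu> :: "'c measure" and f :: "('i \<Rightarrow> 'c) \<Rightarrow> real"
  assumes \<mu>: "prob_space \<mu>" and J: "finite J" "J \<noteq> {}" and \<delta>0: "\<delta> > 0" and \<epsilon>: "\<epsilon> > 0"
    and f: "f \<in> borel_measurable (Pi\<^sub>M J (\<lambda>_. \<mu>))"
    and B: "\<And>y. y \<in> space (Pi\<^sub>M J (\<lambda>_. \<mu>)) \<Longrightarrow> \<bar>f y\<bar> \<le> B"
    and \<delta>: "\<And>k y a b. k \<in> J \<Longrightarrow> y \<in> space (Pi\<^sub>M J (\<lambda>_. \<mu>)) \<Longrightarrow> a \<in> space \<mu> \<Longrightarrow> b \<in> space \<mu> \<Longrightarrow>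
      \<bar>f (y(k := a)) - f (y(k := b))\<bar> \<le> \<delta>"
  defines "P \<equiv> Pi\<^sub>M J (\<lambda>_. \<mu>)"
  shows "measure P {y \<in> space P. f y - (\<integral>y. f y \<partial>P) \<ge> \<epsilon>}
    \<le> exp (- (\<epsilon>\<^sup>2 / (2 * real (card J) * \<delta>\<^sup>2)))"
proof -
  interpret pp: product_prob_space "\<lambda>_::'i. \<mu>" J
    using \<mu> by (intro product_prob_spaceI)
  interpret prob_space P unfolding P_def by (rule pp.P.prob_space_axioms)
  have cJ: "real (card J) > 0" using J by (simp add: card_gt_0_iff)
  \<comment> \<open>Minimises the exponent \<open>- l \<epsilon> + |J| l^2 \<delta>^2 / 2\<close> of
    the Chernoff bound.\<close>
  define l where "l = \<epsilon> / (real (card J) * \<delta>\<^sup>2)"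
  have l: "l > 0" using cJ \<delta>0 \<epsilon> by (simp add: l_def)
  let ?u = "\<lambda>y. ennreal (exp (l * (f y - (\<integral>y. f y \<partial>P))))"
  have fP [measurable]: "f \<in> borel_measurable P" using f by (simp add: P_def)
  have um: "?u \<in> borel_measurable P" by measurable
  have sub: "{y \<in> space P. f y - (\<integral>y. f y \<partial>P) \<ge> \<epsilon>} = {y \<in> space P. 1 \<le> ennreal (exp (- l * \<epsilon>)) * ?u y}"
  proof -
    have "1 \<le> ennreal (exp (- l * \<epsilon>)) * ?u y \<longleftrightarrow> f y - (\<integral>y. f y \<partial>P) \<ge> \<epsilon>" for y
    proof -
      have "ennreal (exp (- l * \<epsilon>)) * ?u y = ennreal (exp (l * ((f y - (\<integral>y. f y \<partial>P)) - \<epsilon>)))"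
        by (simp add: ennreal_mult'[symmetric] exp_add[symmetric] algebra_simps)
      also have "1 \<le> \<dots> \<longleftrightarrow> 0 \<le> l * ((f y - (\<integral>y. f y \<partial>P)) - \<epsilon>)"
        by (simp add: one_ennreal_def[symmetric] ennreal_le_iff flip: ennreal_1)
      also have "\<dots> \<longleftrightarrow> f y - (\<integral>y. f y \<partial>P) \<ge> \<epsilon>"
        using l by (simp add: zero_le_mult_iff)
      finally show ?thesis .
    qed
    then show ?thesis by simp
  qed
  have "emeasure P {y \<in> space P. f y - (\<integral>y. f y \<partial>P) \<ge> \<epsilon>} \<le> ennreal (exp (- l * \<epsilon>)) * (\<integral>\<^sup>+y. ?u y \<partial>P)"
  proof -
    have "(\<lambda>y. ?u y * indicator (space P) y) \<in> borel_measurable P" by measurable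
    from nn_integral_Markov_inequality[OF this sets.top, of "ennreal (exp (- l * \<epsilon>))"]
    have "emeasure P {y \<in> space P. 1 \<le> ennreal (exp (- l * \<epsilon>)) * ?u y}
        \<le> ennreal (exp (- l * \<epsilon>)) * (\<integral>\<^sup>+y. ?u y * indicator (space P) y \<partial>P)" .
    also have "(\<integral>\<^sup>+y. ?u y * indicator (space P) y \<partial>P) = (\<integral>\<^sup>+y. ?u y \<partial>P)"
      by (intro nn_integral_cong) simp
    finally show ?thesis unfolding sub .
  qed
  also have "\<dots> \<le> ennreal (exp (- l * \<epsilon>)) * ennreal (exp (real (card J) * (l\<^sup>2 * \<delta>\<^sup>2 / 2)))"
    unfolding P_def by (intro mult_left_mono mcdiarmid_exp[OF \<mu> J(1) l f B \<delta>]) auto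
  also have "\<dots> = ennreal (exp (- (\<epsilon>\<^sup>2 / (2 * real (card J) * \<delta>\<^sup>2))))"
  proof -
    have "- l * \<epsilon> + real (card J) * (l\<^sup>2 * \<delta>\<^sup>2 / 2) = - (\<epsilon>\<^sup>2 / (2 * real (card J) * \<delta>\<^sup>2))"
      unfolding l_def using cJ \<delta>0 by (simp add: field_simps power2_eq_square)
    then show ?thesis by (simp add: ennreal_mult'[symmetric] exp_add[symmetric])
  qed
  finally show ?thesis by (simp add: emeasure_eq_measure)
qed

lemma mcdiarmid:
  fixes \<mu> :: "'c measure" and f :: "('i \<Rightarrow> 'c) \<Rightarrow> real"
  assumes \<mu>: "prob_space \<mu>" and J: "finite J" "J \<noteq> {}" and \<delta>0: "\<delta> > 0" and \<epsilon>: "\<epsilon> > 0"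
    and f: "f \<in> borel_measurable (Pi\<^sub>M J (\<lambda>_. \<mu>))"
    and B: "\<And>y. y \<in> space (Pi\<^sub>M J (\<lambda>_. \<mu>)) \<Longrightarrow> \<bar>f y\<bar> \<le> B"
    and \<delta>: "\<And>k y a b. k \<in> J \<Longrightarrow> y \<in> space (Pi\<^sub>M J (\<lambda>_. \<mu>)) \<Longrightarrow> a \<in> space \<mu> \<Longrightarrow> b \<in> space \<mu> \<Longrightarrow>
      \<bar>f (y(k := a)) - f (y(k := b))\<bar> \<le> \<delta>"
  defines "P \<equiv> Pi\<^sub>M J (\<lambda>_. \<mu>)"
  shows "measure P {y \<in> space P. \<bar>f y - (\<integral>y. f y \<partial>P)\<bar> \<ge> \<epsilon>}
    \<le> 2 * exp (- (\<epsilon>\<^sup>2 / (2 * real (card J) * \<delta>\<^sup>2)))"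
proof -
  interpret pp: product_prob_space "\<lambda>_::'i. \<mu>" J
    using \<mu> by (intro product_prob_spaceI)
  interpret prob_space P unfolding P_def by (rule pp.P.prob_space_axioms)
  let ?b = "exp (- (\<epsilon>\<^sup>2 / (2 * real (card J) * \<delta>\<^sup>2)))"
  have fP [measurable]: "f \<in> borel_measurable P" using f by (simp add: P_def)
  have 1: "measure P {y \<in> space P. f y - (\<integral>y. f y \<partial>P) \<ge> \<epsilon>} \<le> ?b"
    unfolding P_def by (rule mcdiarmid_upper[OF \<mu> J \<delta>0 \<epsilon> f B \<delta>])
  have mf: "(\<lambda>y. - f y) \<in> borel_measurable (Pi\<^sub>M J (\<lambda>_. \<mu>))" using f by simp
  have 2: "measure P {y \<in> space P. - f y - (\<integral>y. - f y \<partial>P) \<ge> \<epsilon>} \<le> ?b"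
    unfolding P_def
    by (rule mcdiarmid_upper[OF \<mu> J \<delta>0 \<epsilon> mf]) (use B \<delta> in \<open>auto simp: abs_minus_commute\<close>)
  have "{y \<in> space P. \<bar>f y - (\<integral>y. f y \<partial>P)\<bar> \<ge> \<epsilon>}
      = {y \<in> space P. f y - (\<integral>y. f y \<partial>P) \<ge> \<epsilon>} \<union> {y \<in> space P. - f y - (\<integral>y. - f y \<partial>P) \<ge> \<epsilon>}"
    by auto
  then have "measure P {y \<in> space P. \<bar>f y - (\<integral>y. f y \<partial>P)\<bar> \<ge> \<epsilon>}
      \<le> measure P {y \<in> space P. f y - (\<integral>y. f y \<partial>P) \<ge> \<epsilon>} + measure P {y \<in> space P. - f y - (\<integral>y. - f y \<partial>P) \<ge> \<epsilon>}"
    by (simp only:) (intro measure_Un_le; measurable)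
  then show ?thesis using 1 2 by linarith
qed

text \<open>The first Borel--Cantelli lemma at the thresholds \<open>1 / Suc j\<close>. It asks
  nothing of the joint law of the \<open>F n\<close>, so samples for different \<open>n\<close> may
  be dependent in any way.\<close>

lemma (in prob_space) AE_tendsto_of_summable_tails:
  fixes F :: "nat \<Rightarrow> 'a \<Rightarrow> real"
  assumes F [measurable]: "\<And>n. F n \<in> borel_measurable M"
    and e: "e \<longlonglongrightarrow> L"
    and tails: "\<And>\<epsilon>. \<epsilon> > 0 \<Longrightarrow> summable (\<lambda>n. prob {\<omega> \<in> space M. \<bar>F n \<omega> - e n\<bar> \<ge> \<epsilon>})"
  shows "AE \<omega> in M. (\<lambda>n. F n \<omega>) \<longlonglongrightarrow> L"
proof -
  have "AE \<omega> in M. \<forall>j. \<forall>\<^sub>F n in sequentially. \<bar>F n \<omega> - e n\<bar> < 1 / real (Suc j)"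
    unfolding AE_all_countable
  proof
    fix j
    let ?A = "\<lambda>n. {\<omega> \<in> space M. \<bar>F n \<omega> - e n\<bar> \<ge> 1 / real (Suc j)}"
    have "AE \<omega> in M. \<forall>\<^sub>F n in sequentially. \<omega> \<in> space M - ?A n"
      by (rule borel_cantelli_AE1) (auto intro!: tails simp: less_top[symmetric])
    then show "AE \<omega> in M. \<forall>\<^sub>F n in sequentially. \<bar>F n \<omega> - e n\<bar> < 1 / real (Suc j)"
      by eventually_elim (auto elim!: eventually_mono)
  qed
  then show ?thesis
  proof eventually_elim
    case (elim \<omega>)
    have "(\<lambda>n. F n \<omega> - e n) \<longlonglongrightarrow> 0"
    proof (rule LIMSEQ_I)
      fix r :: real assume "r > 0"
      then obtain j where j: "1 / real (Suc j) < r" using nat_approx_posE by blast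
      have "\<forall>\<^sub>F n in sequentially. \<bar>F n \<omega> - e n\<bar> < r"
        using elim[rule_format, of j] by eventually_elim (use j in linarith)
      then show "\<exists>N. \<forall>n\<ge>N. norm (F n \<omega> - e n - 0) < r"
        by (simp add: eventually_sequentially)
    qed
    from tendsto_add[OF this e] show ?case by simp
  qed
qed

section \<open>The self-consistent equation for i.i.d. samples\<close>

text \<open>A canonical model: \<open>m\<close> independent copies of \<mu> on a product space.
  \<open>st_sample\<close> transfers the results to given samples.\<close>

locale iid_vectors = prob_space \<mu> for \<mu> :: "('i \<Rightarrow> real) measure" +
  fixes I :: "'i set" and m :: nat and t :: real
  assumes sets_\<mu>: "sets \<mu> = sets (Pi\<^sub>M I (\<lambda>_. borel))"
    and I_fin: "finite I" and I_ne: "I \<noteq> {}" and m_pos: "m > 0" and t_pos: "t > 0"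
begin

definition "w = 1 / real m"
definition "p = real (card I)"
definition "J = {1..m}"
definition "idx = [1..<Suc m]"

lemma J_card [simp]: "card J = m" and J_fin [simp]: "finite J" and J_ne: "J \<noteq> {}"
  using m_pos by (auto simp: J_def)

lemma set_idx [simp]: "set idx = J" and distinct_idx [simp]: "distinct idx"
  by (auto simp: idx_def J_def)

sublocale resolvent_setting I w t
  using I_fin t_pos by unfold_locales (auto simp: w_def)

abbreviation "\<Omega> \<equiv> Pi\<^sub>M J (\<lambda>_. \<mu>)"

sublocale P: product_prob_space "\<lambda>_. \<mu>" "J"
  by (intro product_prob_spaceI prob_space_axioms)

definition st :: "(nat \<Rightarrow> 'i \<Rightarrow> real) \<Rightarrow> real" where
  "st y = trace_on I (G (map y idx)) / p"

lemma p_pos: "p > 0" using I_fin I_ne by (simp add: p_def card_gt_0_iff)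

lemma coord_meas:
  assumes "k \<in> J" "j \<in> I"
  shows "(\<lambda>y. y k j) \<in> borel_measurable \<Omega>"
proof -
  have "(\<lambda>x. x j) \<in> borel_measurable \<mu>"
    using measurable_component_singleton[OF assms(2), of "\<lambda>_. borel"]
    by (simp cong: measurable_cong_sets add: sets_\<mu>)
  from measurable_compose[OF measurable_component_singleton[OF assms(1)] this] show ?thesis .
qed

lemma app_meas:
  assumes "\<And>i j. (\<lambda>y. A y i j) \<in> borel_measurable \<Omega>" "k \<in> J"
  shows "(\<lambda>y. app I (A y) (y k) i) \<in> borel_measurable \<Omega>"
  unfolding app_def by (intro borel_measurable_sum borel_measurable_times assms coord_meas)

lemma quad_meas:
  assumes "\<And>i j. (\<lambda>y. A y i j) \<in> borel_measurable \<Omega>" "k \<in> J"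
  shows "(\<lambda>y. quad I (A y) (y k)) \<in> borel_measurable \<Omega>"
  unfolding quad_def dot_def
  by (intro borel_measurable_sum borel_measurable_times app_meas assms coord_meas)

lemma resolvent_meas:
  assumes "set l \<subseteq> J"
  shows "(\<lambda>y. G (map y l) i j) \<in> borel_measurable \<Omega>"
  using assms
proof (induction l arbitrary: i j)
  case (Cons k l)
  then have IH: "\<And>i j. (\<lambda>y. G (map y l) i j) \<in> borel_measurable \<Omega>" and k: "k \<in> J" by auto
  show ?case
    unfolding list.map resolvent.simps
    by (intro borel_measurable_diff borel_measurable_times borel_measurable_divide borel_measurable_add
        borel_measurable_const IH app_meas[OF IH k] quad_meas[OF IH k])
qed simp

lemma trace_meas:
  assumes "set l \<subseteq> J"
  shows "(\<lambda>y. trace_on I (G (map y l))) \<in> borel_measurable \<Omega>"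
  unfolding trace_on_def by (intro borel_measurable_sum resolvent_meas assms)

lemma st_meas: "st \<in> borel_measurable \<Omega>"
  unfolding st_def[abs_def] by (intro borel_measurable_divide trace_meas borel_measurable_const) auto

lemma st_nonneg: "st y \<ge> 0"
  using trace_nonneg p_pos by (simp add: st_def)

lemma st_le: "st y \<le> 1 / t"
proof -
  have "st y \<le> (real (card I) / t) / p"
    unfolding st_def using p_pos by (intro divide_right_mono trace_le) auto
  then show ?thesis using p_pos by (simp add: p_def)
qed

text \<open>Whatever sample \<open>k\<close> is, the trace lies in the interval of length
  \<open>1 / t\<close> below the trace of the resolvent without it.\<close>

lemma st_bounded_difference:
  assumes "k \<in> J"
  shows "\<bar>st (y(k := a)) - st (y(k := b))\<bar> \<le> 1 / (t * p)"
proof -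
  let ?l = "remove1 k idx"
  have dist: "k \<notin> set ?l" by (simp)
  have "mset idx = mset (k # ?l)" using assms by (simp flip: set_idx)
  then have "mset (map (y(k := z)) idx) = mset (map (y(k := z)) (k # ?l))" for z
    by (metis mset_map)
  then have tr: "trace_on I (G (map (y(k := z)) idx)) = trace_on I (G (map (y(k := z)) (k # ?l)))" for z
    by (rule trace_mset_cong)
  have m: "map (y(k := z)) (k # ?l) = z # map y ?l" for z
    using dist by (simp add: map_fun_upd)
  have *: "trace_on I (G (map y ?l)) - 1 / t \<le> trace_on I (G (map (y(k := z)) idx))"
    "trace_on I (G (map (y(k := z)) idx)) \<le> trace_on I (G (map y ?l))" for z
    using trace_Cons[where x = z and xs = "map y ?l"] unfolding tr m by linarith+
  have "\<bar>st (y(k := a)) - st (y(k := b))\<bar>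
      = \<bar>trace_on I (G (map (y(k := a)) idx)) - trace_on I (G (map (y(k := b)) idx))\<bar> / p"
    using p_pos by (simp add: st_def diff_divide_distrib[symmetric])
  also have "\<dots> \<le> (1 / t) / p"
    using *[of a] *[of b] p_pos by (intro divide_right_mono) linarith+
  finally show ?thesis by simp
qed

text \<open>McDiarmid's inequality with \<open>m\<close> coordinates and differences
  \<open>1 / (t p)\<close>. Writing the exponent with \<open>p (p / m)\<close> shows it to be of the
  order of \<open>p\<close> when \<open>p / m\<close> has a positive limit.\<close>

lemma st_concentration:
  assumes "\<epsilon> > 0"
  shows "measure \<Omega> {y \<in> space \<Omega>. \<bar>st y - (\<integral>y. st y \<partial>\<Omega>)\<bar> \<ge> \<epsilon>} \<le> 2 * exp (- (\<epsilon>\<^sup>2 * t\<^sup>2 * p * (p / m) / 2))"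
proof -
  have "measure \<Omega> {y \<in> space \<Omega>. \<bar>st y - (\<integral>y. st y \<partial>\<Omega>)\<bar> \<ge> \<epsilon>}
      \<le> 2 * exp (- (\<epsilon>\<^sup>2 / (2 * real (card J) * (1 / (t * p))\<^sup>2)))"
  proof (rule mcdiarmid[OF prob_space_axioms _ _ _ assms st_meas, where B = "1 / t"])
    show "\<bar>st y\<bar> \<le> 1 / t" for y using st_nonneg[of y] st_le[of y] by simp
  qed (use m_pos t_pos p_pos st_bounded_difference J_ne in auto)
  also have "\<epsilon>\<^sup>2 / (2 * real (card J) * (1 / (t * p))\<^sup>2) = \<epsilon>\<^sup>2 * t\<^sup>2 * p * (p / m) / 2"
    using t_pos p_pos m_pos by (simp add: power2_eq_square mult_ac)
  finally show ?thesis .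
qed

text \<open>Since \<open>y k\<close> is independent of the resolvent that omits it, the quadratic form
  may be estimated for a fixed matrix.\<close>

lemma leave_one_out:
  assumes v: "v > 0" and k: "k \<in> J"
    and var: "\<And>A. (\<And>i. i \<in> I \<Longrightarrow> 0 \<le> A i i) \<Longrightarrow> (\<And>i. i \<in> I \<Longrightarrow> A i i \<le> 1 / t) \<Longrightarrow>
      (\<And>i. i \<in> I \<Longrightarrow> (\<Sum>j\<in>I. (A i j)\<^sup>2) \<le> (1 / t)\<^sup>2) \<Longrightarrow>
      (\<integral>\<^sup>+x. ennreal ((quad I A x - trace_on I A)\<^sup>2) \<partial>\<mu>) \<le> ennreal (v\<^sup>2)"
  defines "H \<equiv> \<lambda>y. G (map y (remove1 k idx))"
  shows "(\<integral>\<^sup>+y. ennreal \<bar>quad I (H y) (y k) - trace_on I (H y)\<bar> \<partial>\<Omega>) \<le> ennreal v"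
proof -
  let ?l = "remove1 k idx"
  let ?J = "J - {k}"
  let ?D = "\<lambda>A x. quad I A x - trace_on I A"
  have dist: "k \<notin> set ?l" by (simp)
  have setl: "set ?l \<subseteq> J" using set_remove1_subset[of k idx] by simp
  have ins: "insert k ?J = J" using k by auto
  have Hk: "H (y(k := z)) = H y" for y z
    using dist by (simp add: H_def map_fun_upd)
  have Dm: "(\<lambda>y. ?D (H y) (y k)) \<in> borel_measurable \<Omega>"
    unfolding H_def by (intro borel_measurable_diff quad_meas resolvent_meas trace_meas setl k)
  \<comment> \<open>A linearised Cauchy--Schwarz inequality: the right-hand side has mean at most
    \<open>v\<close> if \<open>x^2\<close> has mean at most \<open>v^2\<close>.\<close>
  have amgm: "ennreal \<bar>x\<bar> \<le> ennreal (1 / (2 * v)) * ennreal (x\<^sup>2) + ennreal (v / 2)" for x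
  proof -
    have "0 \<le> (\<bar>x\<bar> - v)\<^sup>2" by simp
    then have "\<bar>x\<bar> * v \<le> (x\<^sup>2 + v * v) / 2" by (simp add: power2_eq_square algebra_simps)
    then have "\<bar>x\<bar> \<le> 1 / (2 * v) * x\<^sup>2 + v / 2" using v by (simp add: field_simps)
    then have "ennreal \<bar>x\<bar> \<le> ennreal (1 / (2 * v) * x\<^sup>2 + v / 2)" by (rule ennreal_leI)
    also have "\<dots> = ennreal (1 / (2 * v) * x\<^sup>2) + ennreal (v / 2)"
      using v by (intro ennreal_plus) auto
    also have "ennreal (1 / (2 * v) * x\<^sup>2) = ennreal (1 / (2 * v)) * ennreal (x\<^sup>2)"
      using v by (intro ennreal_mult) auto
    finally show ?thesis .
  qed
  have xm: "(\<lambda>x. ?D A x) \<in> borel_measurable \<mu>" for A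
  proof -
    have "(\<lambda>x. x j) \<in> borel_measurable \<mu>" if "j \<in> I" for j
      using measurable_component_singleton[OF that, of "\<lambda>_. borel"]
      by (simp cong: measurable_cong_sets add: sets_\<mu>)
    then show ?thesis unfolding quad_def dot_def app_def
      by (intro borel_measurable_diff borel_measurable_sum borel_measurable_times borel_measurable_const) auto
  qed
  have inner: "(\<integral>\<^sup>+x. ennreal \<bar>?D (H y) x\<bar> \<partial>\<mu>) \<le> ennreal v" for y
  proof -
    have xm2: "(\<lambda>x. ennreal ((?D (H y) x)\<^sup>2)) \<in> borel_measurable \<mu>" using xm[of "H y"] by measurable
    have "(\<integral>\<^sup>+x. ennreal \<bar>?D (H y) x\<bar> \<partial>\<mu>)
        \<le> (\<integral>\<^sup>+x. ennreal (1 / (2 * v)) * ennreal ((?D (H y) x)\<^sup>2) + ennreal (v / 2) \<partial>\<mu>)"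
      by (intro nn_integral_mono amgm)
    also have "\<dots> = ennreal (1 / (2 * v)) * (\<integral>\<^sup>+x. ennreal ((?D (H y) x)\<^sup>2) \<partial>\<mu>) + ennreal (v / 2)"
      using xm2 by (simp add: nn_integral_add nn_integral_cmult emeasure_space_1)
    also have "\<dots> \<le> ennreal (1 / (2 * v)) * ennreal (v\<^sup>2) + ennreal (v / 2)"
      unfolding H_def by (intro add_right_mono mult_left_mono var diag_nonneg diag_le row_norm_le') auto
    also have "\<dots> = ennreal v"
      using v by (simp add: ennreal_mult'[symmetric] ennreal_plus[symmetric] power2_eq_square del: ennreal_plus)
    finally show ?thesis .
  qed
  have "(\<integral>\<^sup>+y. ennreal \<bar>?D (H y) (y k)\<bar> \<partial>\<Omega>)
      = (\<integral>\<^sup>+y. (\<integral>\<^sup>+z. ennreal \<bar>?D (H (y(k := z))) ((y(k := z)) k)\<bar> \<partial>\<mu>) \<partial>Pi\<^sub>M ?J (\<lambda>_. \<mu>))"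
    using P.product_nn_integral_insert[of ?J k "\<lambda>y. ennreal \<bar>?D (H y) (y k)\<bar>"] Dm unfolding ins by simp
  also have "\<dots> = (\<integral>\<^sup>+y. (\<integral>\<^sup>+z. ennreal \<bar>?D (H y) z\<bar> \<partial>\<mu>) \<partial>Pi\<^sub>M ?J (\<lambda>_. \<mu>))"
    unfolding Hk by simp
  also have "\<dots> \<le> (\<integral>\<^sup>+y. ennreal v \<partial>Pi\<^sub>M ?J (\<lambda>_. \<mu>))"
    by (intro nn_integral_mono inner)
  also have "\<dots> = ennreal v"
  proof -
    interpret Q: product_prob_space "\<lambda>_. \<mu>" ?J by (intro product_prob_spaceI prob_space_axioms)
    show ?thesis by (simp add: Q.P.emeasure_space_1)
  qed
  finally show ?thesis .
qed

text \<open>The mean of \<open>self_consistent_error\<close>; the \<open>m\<close> leave-one-out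
  terms have weight \<open>w / p\<close> each, together \<open>1 / p\<close>.\<close>

lemma self_consistent_mean:
  assumes v: "v > 0"
    and var: "\<And>A. (\<And>i. i \<in> I \<Longrightarrow> 0 \<le> A i i) \<Longrightarrow> (\<And>i. i \<in> I \<Longrightarrow> A i i \<le> 1 / t) \<Longrightarrow>
      (\<And>i. i \<in> I \<Longrightarrow> (\<Sum>j\<in>I. (A i j)\<^sup>2) \<le> (1 / t)\<^sup>2) \<Longrightarrow>
      (\<integral>\<^sup>+x. ennreal ((quad I A x - trace_on I A)\<^sup>2) \<partial>\<mu>) \<le> ennreal (v\<^sup>2)"
  shows "(\<integral>y. \<bar>t * st y + st y / (1 + p / m * st y) - 1\<bar> \<partial>\<Omega>) \<le> v / p + 1 / (t * p)"
proof -
  let ?H = "\<lambda>k y. G (map y (remove1 k idx))"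
  let ?D = "\<lambda>k y. \<bar>quad I (?H k y) (y k) - trace_on I (?H k y)\<bar>"
  let ?F = "\<lambda>y. \<bar>t * st y + st y / (1 + p / m * st y) - 1\<bar>"
  have setl: "set (remove1 k idx) \<subseteq> J" for k
    using set_remove1_subset[of k idx] by simp
  have Dm: "(\<lambda>y. ennreal (?D k y)) \<in> borel_measurable \<Omega>" if "k \<in> J" for k
    by (intro measurable_compose[OF _ measurable_ennreal] borel_measurable_abs borel_measurable_diff
        quad_meas resolvent_meas trace_meas setl that)
  have Fm: "?F \<in> borel_measurable \<Omega>" using st_meas by measurable
  have "(\<integral>\<^sup>+y. ennreal (?F y) \<partial>\<Omega>)
      \<le> (\<integral>\<^sup>+y. (\<Sum>k\<in>J. ennreal (w / p) * ennreal (?D k y)) + ennreal (1 / (t * p)) \<partial>\<Omega>)"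
  proof (intro nn_integral_mono)
    fix y
    have "?F y \<le> (\<Sum>k\<in>J. w * ?D k y) / p + 1 / (t * p)"
      using self_consistent_error[OF I_fin I_ne m_pos t_pos, of y]
      unfolding st_def p_def w_def idx_def J_def .
    also have "(\<Sum>k\<in>J. w * ?D k y) / p = (\<Sum>k\<in>J. w / p * ?D k y)"
      by (simp add: sum_divide_distrib)
    finally have "ennreal (?F y) \<le> ennreal ((\<Sum>k\<in>J. w / p * ?D k y) + 1 / (t * p))"
      by (rule ennreal_leI)
    also have "\<dots> = (\<Sum>k\<in>J. ennreal (w / p) * ennreal (?D k y)) + ennreal (1 / (t * p))"
    proof -
      have wp: "w / p \<ge> 0" using w_nonneg p_pos by simp
      have "ennreal (\<Sum>k\<in>J. w / p * ?D k y) = (\<Sum>k\<in>J. ennreal (w / p * ?D k y))"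
        using wp by (intro sum_ennreal[symmetric] mult_nonneg_nonneg) auto
      also have "\<dots> = (\<Sum>k\<in>J. ennreal (w / p) * ennreal (?D k y))"
        using wp by (intro sum.cong refl ennreal_mult) auto
      finally show ?thesis
        using wp t_pos p_pos by (subst ennreal_plus) (auto intro!: sum_nonneg mult_nonneg_nonneg simp del: times_divide_eq_left)
    qed
    finally show "ennreal (?F y) \<le> (\<Sum>k\<in>J. ennreal (w / p) * ennreal (?D k y)) + ennreal (1 / (t * p))" .
  qed
  also have "\<dots> = (\<Sum>k\<in>J. ennreal (w / p) * (\<integral>\<^sup>+y. ennreal (?D k y) \<partial>\<Omega>)) + ennreal (1 / (t * p))"
    using Dm by (subst nn_integral_add) (auto simp: nn_integral_sum nn_integral_cmult P.P.emeasure_space_1)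
  also have "\<dots> \<le> (\<Sum>k\<in>J. ennreal (w / p) * ennreal v) + ennreal (1 / (t * p))"
    by (intro add_right_mono sum_mono mult_left_mono leave_one_out[OF v _ var]) auto
  also have "\<dots> = ennreal (v / p + 1 / (t * p))"
  proof -
    have "(\<Sum>k\<in>J. ennreal (w / p) * ennreal v) = ennreal (\<Sum>k\<in>J. w / p * v)"
    proof -
      have "ennreal (w / p) * ennreal v = ennreal (w / p * v)"
        using w_nonneg p_pos v by (intro ennreal_mult[symmetric]) auto
      then show ?thesis using w_nonneg p_pos v by (simp only:) (intro sum_ennreal, auto)
    qed
    also have "(\<Sum>k\<in>J. w / p * v) = v / p" using m_pos by (simp add: w_def)
    finally show ?thesis using v p_pos t_pos by (simp add: ennreal_plus)
  qed
  finally have "(\<integral>\<^sup>+y. ennreal (?F y) \<partial>\<Omega>) \<le> ennreal (v / p + 1 / (t * p))" .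
  then show ?thesis
    using Fm v p_pos t_pos by (subst integral_eq_nn_integral) (auto intro!: enn2real_leI)
qed

text \<open>Both sides of the limit equation increase in \<open>s\<close> with slope at least \<open>t\<close>, so an approximate
  solution is close to the exact one.\<close>

lemma mean_distance_to_root:
  assumes v: "v > 0" and c: "c > 0" and s0: "s0 \<ge> 0" "t * s0 + s0 / (1 + c * s0) = 1"
    and var: "\<And>A. (\<And>i. i \<in> I \<Longrightarrow> 0 \<le> A i i) \<Longrightarrow> (\<And>i. i \<in> I \<Longrightarrow> A i i \<le> 1 / t) \<Longrightarrow>
      (\<And>i. i \<in> I \<Longrightarrow> (\<Sum>j\<in>I. (A i j)\<^sup>2) \<le> (1 / t)\<^sup>2) \<Longrightarrow>
      (\<integral>\<^sup>+x. ennreal ((quad I A x - trace_on I A)\<^sup>2) \<partial>\<mu>) \<le> ennreal (v\<^sup>2)"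
  shows "\<bar>(\<integral>y. st y \<partial>\<Omega>) - s0\<bar> \<le> (v / p + 1 / (t * p) + \<bar>p / m - c\<bar> / t\<^sup>2) / t"
proof -
  let ?F = "\<lambda>y. \<bar>t * st y + st y / (1 + p / m * st y) - 1\<bar>"
  have pm: "p / m > 0" using p_pos m_pos by simp
  have int_st: "integrable \<Omega> st"
    using st_meas st_nonneg st_le by (intro P.P.integrable_const_bound[of _ "1 / t"]) auto
  have Fb: "?F y \<le> 2 + 1 / t" for y
  proof -
    have "0 \<le> st y / (1 + p / m * st y)" "st y / (1 + p / m * st y) \<le> st y"
    proof -
      have "x / (1 + q * x) \<ge> 0 \<and> x / (1 + q * x) \<le> x" if "x \<ge> 0" "q > 0" for x q :: real
      proof -
        have q: "0 \<le> q * x" using that by simp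
        then have d: "0 < 1 + q * x" by linarith
        have "x * 1 \<le> x * (1 + q * x)" using that q by (intro mult_left_mono) auto
        then show ?thesis using d that by (simp add: pos_divide_le_eq)
      qed
      from this[OF st_nonneg[of y] pm]
      show "0 \<le> st y / (1 + p / m * st y)" "st y / (1 + p / m * st y) \<le> st y" by auto
    qed
    moreover have "0 \<le> t * st y" "t * st y \<le> 1"
      using st_nonneg[of y] st_le[of y] t_pos by (auto simp: field_simps)
    ultimately show ?thesis using st_le[of y] by linarith
  qed
  have int_F: "integrable \<Omega> ?F"
    using st_meas Fb by (intro P.P.integrable_const_bound[of _ "2 + 1 / t"]) auto
  have pt: "\<bar>st y - s0\<bar> \<le> (?F y + \<bar>p / m - c\<bar> / t\<^sup>2) / t" for y
  proof -
    define s where "s = st y"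
    define c' where "c' = p / m"
    have s: "s \<ge> 0" "s \<le> 1 / t" and c': "c' > 0" using st_nonneg st_le pm by (auto simp: s_def c'_def)
    have d: "1 + c * s > 0" "1 + c' * s > 0" "1 + c * s0 > 0"
      using s s0 c c' by (auto intro!: add_pos_nonneg)
    \<comment> \<open>The difference factors as
      \<open>(s - s0) (t + 1 / ((1 + c s) (1 + c s0)))\<close>, and the second factor is at least
      \<open>t\<close>.\<close>
    have mono: "t * \<bar>s - s0\<bar> \<le> \<bar>(t * s + s / (1 + c * s)) - (t * s0 + s0 / (1 + c * s0))\<bar>"
    proof -
      have e: "s / (1 + c * s) - s0 / (1 + c * s0) = (s - s0) / ((1 + c * s) * (1 + c * s0))"
        using d by (simp add: field_simps)
      have "(t * s + s / (1 + c * s)) - (t * s0 + s0 / (1 + c * s0))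
          = (s - s0) * (t + 1 / ((1 + c * s) * (1 + c * s0)))"
        using e by (simp add: algebra_simps)
      then have "\<bar>(t * s + s / (1 + c * s)) - (t * s0 + s0 / (1 + c * s0))\<bar>
          = \<bar>s - s0\<bar> * \<bar>t + 1 / ((1 + c * s) * (1 + c * s0))\<bar>"
        by (simp add: abs_mult)
      moreover have "t \<le> \<bar>t + 1 / ((1 + c * s) * (1 + c * s0))\<bar>"
      proof -
        have "0 \<le> 1 / ((1 + c * s) * (1 + c * s0))" using d by simp
        then show ?thesis using t_pos by linarith
      qed
      then have "\<bar>s - s0\<bar> * t \<le> \<bar>s - s0\<bar> * \<bar>t + 1 / ((1 + c * s) * (1 + c * s0))\<bar>"
        by (intro mult_left_mono) auto
      ultimately show ?thesis by (simp only: mult.commute[of t])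
    qed
    \<comment> \<open>Replacing the ratio \<open>p / m\<close> by its limit costs at most
      \<open>s^2 |p / m - c|\<close>, and \<open>s <= 1 / t\<close>.\<close>
    have "\<bar>s / (1 + c * s) - s / (1 + c' * s)\<bar> \<le> \<bar>c' - c\<bar> / t\<^sup>2"
    proof -
      have "s / (1 + c * s) - s / (1 + c' * s) = (c' - c) * (s * s) / ((1 + c * s) * (1 + c' * s))"
        using d by (simp add: field_simps)
      then have "\<bar>s / (1 + c * s) - s / (1 + c' * s)\<bar> = \<bar>c' - c\<bar> * (s * s) / ((1 + c * s) * (1 + c' * s))"
        using d s by (simp add: abs_mult)
      also have "\<dots> \<le> \<bar>c' - c\<bar> * (s * s) / 1"
      proof (intro divide_left_mono)
        have "1 * 1 \<le> (1 + c * s) * (1 + c' * s)" using s c c' by (intro mult_mono) auto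
        then show "1 \<le> (1 + c * s) * (1 + c' * s)" by simp
      qed (use d s in auto)
      also have "\<dots> \<le> \<bar>c' - c\<bar> * ((1 / t) * (1 / t))"
        using s t_pos by (simp only: div_by_1) (intro mult_left_mono mult_mono, auto)
      finally show ?thesis by (simp add: power2_eq_square)
    qed
    with mono s0(2) have "t * \<bar>s - s0\<bar> \<le> \<bar>t * s + s / (1 + c' * s) - 1\<bar> + \<bar>c' - c\<bar> / t\<^sup>2" by linarith
    then show ?thesis using t_pos by (simp add: s_def c'_def le_divide_eq mult.commute)
  qed
  have "\<bar>(\<integral>y. st y \<partial>\<Omega>) - s0\<bar> = \<bar>\<integral>y. st y - s0 \<partial>\<Omega>\<bar>"
    using int_st by (simp add: P.P.prob_space)
  also have "\<dots> \<le> (\<integral>y. \<bar>st y - s0\<bar> \<partial>\<Omega>)" by (rule integral_abs_bound)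
  also have "\<dots> \<le> (\<integral>y. (?F y + \<bar>p / m - c\<bar> / t\<^sup>2) / t \<partial>\<Omega>)"
    using int_st int_F pt by (intro integral_mono) auto
  also have "\<dots> = ((\<integral>y. ?F y \<partial>\<Omega>) + \<bar>p / m - c\<bar> / t\<^sup>2) / t"
    using int_F by (simp add: P.P.prob_space)
  also have "\<dots> \<le> (v / p + 1 / (t * p) + \<bar>p / m - c\<bar> / t\<^sup>2) / t"
  proof (intro divide_right_mono add_right_mono)
    show "(\<integral>y. ?F y \<partial>\<Omega>) \<le> v / p + 1 / (t * p)"
      by (rule self_consistent_mean[OF v var])
  qed (use t_pos in simp)
  finally show ?thesis .
qed

end

section \<open>Moments under the hypotheses on the norms\<close>

lemma Cauchy_Schwarz_ennreal_bound:
  assumes [measurable]: "f \<in> borel_measurable M" "g \<in> borel_measurable M"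
    and f: "(\<integral>\<^sup>+x. f x ^ 2 \<partial>M) \<le> ennreal a" and g: "(\<integral>\<^sup>+x. g x ^ 2 \<partial>M) \<le> ennreal b"
    and ab: "a \<ge> 0" "b \<ge> 0"
  shows "(\<integral>\<^sup>+x. f x * g x \<partial>M) \<le> ennreal (sqrt (a * b))"
proof -
  have "(\<integral>\<^sup>+x. f x * g x \<partial>M)\<^sup>2 \<le> (\<integral>\<^sup>+x. f x ^ 2 \<partial>M) * (\<integral>\<^sup>+x. g x ^ 2 \<partial>M)"
    by (rule Cauchy_Schwarz_nn_integral) auto
  also have "\<dots> \<le> ennreal a * ennreal b" by (intro mult_mono f g) auto
  also have "\<dots> = ennreal (a * b)" using ab by (simp add: ennreal_mult)
  finally have sq: "(\<integral>\<^sup>+x. f x * g x \<partial>M)\<^sup>2 \<le> ennreal (a * b)" .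
  show ?thesis
  proof (cases "\<integral>\<^sup>+x. f x * g x \<partial>M")
    case (real r)
    then have "r\<^sup>2 \<le> a * b" using sq ab by (simp add: ennreal_power ennreal_le_iff)
    then have "r \<le> sqrt (a * b)" by (rule real_le_rsqrt)
    then show ?thesis using real by (simp add: ennreal_leI)
  next
    case top
    then show ?thesis using sq by (simp add: power2_eq_square ennreal_mult_top top_unique)
  qed
qed

lemma ennreal_affine:
  "p \<ge> 0 \<Longrightarrow> q \<ge> 0 \<Longrightarrow> x \<ge> 0 \<Longrightarrow> ennreal (p + q * x) = ennreal p + ennreal q * ennreal x"
  by (simp add: ennreal_plus ennreal_mult)

text \<open>Each factor is at least \<open>n - 2 d\<close> and there are at most \<open>2 d\<close>
  of them, so Bernoulli's inequality makes the relative loss at most \<open>4 d^2 / n\<close>. This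
  is where \<open>d = o(sqrt n)\<close> will enter.\<close>

lemma falling_product_bounds:
  fixes n d j k :: nat
  assumes d: "2 * d \<le> n" "n > 0" and jk: "j + k \<le> 2 * d"
  shows "(1 - 4 * real d ^ 2 / n) * real n ^ k \<le> (\<Prod>i<k. real (n - j - i))"
    and "(\<Prod>i<k. real (n - j - i)) \<le> real n ^ k"
proof -
  have n: "real n > 0" using d by simp
  have "1 - 4 * real d ^ 2 / n \<le> 1 + real k * (- (2 * real d / n))"
  proof -
    have "real k * (2 * real d) \<le> (2 * real d) * (2 * real d)"
      using jk by (intro mult_right_mono) auto
    then have "real k * (2 * real d) / n \<le> (2 * real d) * (2 * real d) / n"
      using n by (intro divide_right_mono) auto
    then show ?thesis by (simp add: power2_eq_square)
  qed
  also have "\<dots> \<le> (1 + - (2 * real d / n)) ^ k"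
    using d n by (intro Bernoulli_inequality) (simp add: field_simps)
  finally have "(1 - 4 * real d ^ 2 / n) * real n ^ k \<le> (1 + - (2 * real d / n)) ^ k * real n ^ k"
    using n by (intro mult_right_mono) auto
  also have "\<dots> = (real n - 2 * real d) ^ k"
    using n by (simp add: power_mult_distrib[symmetric] field_simps)
  also have "\<dots> = (\<Prod>i<k. real n - 2 * real d)" by simp
  also have "\<dots> \<le> (\<Prod>i<k. real (n - j - i))"
    using d jk by (intro prod_mono) (auto simp: of_nat_diff)
  finally show "(1 - 4 * real d ^ 2 / n) * real n ^ k \<le> (\<Prod>i<k. real (n - j - i))" .
  have "(\<Prod>i<k. real (n - j - i)) \<le> (\<Prod>i<k. real n)" by (intro prod_mono) auto
  then show "(\<Prod>i<k. real (n - j - i)) \<le> real n ^ k" by simp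
qed

text \<open>\<open>a\<close> is the normalised \<open>8 d\<close>-th moment of
  \<open>||X||_2\<close>. \<open>T2\<close> is what (iii) and (iii') both yield at
  \<open>r = 1\<close>, and all that (A) and (B) use of them. \<open>8 d^2 <= n\<close> keeps
  falling factorials above half the powers of \<open>n\<close>.\<close>

locale tensor_moments = sym_vector +
  fixes d :: nat and a L :: real
  assumes d_pos: "d \<ge> 1" and n_large: "8 * d ^ 2 \<le> n"
    and var1: "E (\<lambda>\<omega>. sq (X 1 \<omega>)) = 1"
    and S4: "E (\<lambda>\<omega>. S \<omega> ^ (4 * d)) = ennreal (a * real n ^ (4 * d))" and a_nonneg: "a \<ge> 0"
    and T2: "E (\<lambda>\<omega>. T \<omega> ^ 2) \<le> ennreal (real n ^ 2 * L ^ 2)" and L_nonneg: "L \<ge> 0"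
begin

lemma n_pos: "n > 0" and d2_le_n: "2 * d \<le> n"
proof -
  have "d \<le> d * d" using d_pos by simp
  then have "8 * d \<le> n" using n_large unfolding power2_eq_square by linarith
  then show "n > 0" "2 * d \<le> n" using d_pos by auto
qed

lemma nr_pos: "real n > 0" using n_pos by simp

text \<open>\<open>s ^ k <= 1 + s ^ (4 * d)\<close> for \<open>s = ||X||_2^2 / n\<close>.\<close>

lemma S_power_le: assumes k: "k \<le> 4 * d" shows "E (\<lambda>\<omega>. S \<omega> ^ k) \<le> ennreal ((1 + a) * real n ^ k)"
proof -
  have pt: "S \<omega> ^ k \<le> ennreal (real n ^ k) + ennreal (real n ^ k / real n ^ (4 * d)) * S \<omega> ^ (4 * d)" for \<omega>
  proof -
    define s where "s = Sr \<omega> / real n"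
    have s: "s \<ge> 0" "Sr \<omega> = s * real n" using Sr_nonneg nr_pos by (auto simp: s_def)
    have "s ^ k \<le> 1 + s ^ (4 * d)"
    proof (cases "s \<le> 1")
      case True
      then have "s ^ k \<le> 1" using s by (intro power_le_one) auto
      moreover have "0 \<le> s ^ (4 * d)" using s by simp
      ultimately show ?thesis by linarith
    next
      case False
      then have "s ^ k \<le> s ^ (4 * d)" using k by (intro power_increasing) auto
      then show ?thesis by simp
    qed
    then have "s ^ k * real n ^ k \<le> (1 + s ^ (4 * d)) * real n ^ k"
      by (intro mult_right_mono) auto
    also have "\<dots> = real n ^ k + real n ^ k / real n ^ (4 * d) * (s * real n) ^ (4 * d)"
      using nr_pos by (simp add: power_mult_distrib field_simps)
    finally have "Sr \<omega> ^ k \<le> real n ^ k + real n ^ k / real n ^ (4 * d) * Sr \<omega> ^ (4 * d)"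
      unfolding s(2) by (simp add: power_mult_distrib)
    then have "ennreal (Sr \<omega> ^ k) \<le> ennreal (real n ^ k + real n ^ k / real n ^ (4 * d) * Sr \<omega> ^ (4 * d))"
      by (rule ennreal_leI)
    also have "\<dots> = ennreal (real n ^ k) + ennreal (real n ^ k / real n ^ (4 * d)) * ennreal (Sr \<omega> ^ (4 * d))"
      by (rule ennreal_affine) (auto simp: Sr_nonneg)
    finally show ?thesis by (simp add: S_eq_Sr ennreal_power Sr_nonneg)
  qed
  have "E (\<lambda>\<omega>. S \<omega> ^ k) \<le> E (\<lambda>\<omega>. ennreal (real n ^ k) + ennreal (real n ^ k / real n ^ (4 * d)) * S \<omega> ^ (4 * d))"
    by (intro nn_integral_mono pt)
  also have "\<dots> = ennreal (real n ^ k) + ennreal (real n ^ k / real n ^ (4 * d)) * ennreal (a * real n ^ (4 * d))"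
    by (simp add: nn_integral_add nn_integral_cmult emeasure_space_1 S4)
  also have "\<dots> = ennreal (real n ^ k + real n ^ k / real n ^ (4 * d) * (a * real n ^ (4 * d)))"
    using a_nonneg by (intro ennreal_affine[symmetric]) auto
  also have "real n ^ k + real n ^ k / real n ^ (4 * d) * (a * real n ^ (4 * d)) = (1 + a) * real n ^ k"
    using nr_pos by (simp add: field_simps)
  finally show ?thesis .
qed

definition u :: "nat \<Rightarrow> real" where "u k = enn2real (E (\<lambda>\<omega>. S \<omega> ^ k)) / real n ^ k"

lemma u_nonneg: "u k \<ge> 0" by (simp add: u_def)

lemma S_power_eq: assumes "k \<le> 4 * d" shows "E (\<lambda>\<omega>. S \<omega> ^ k) = ennreal (u k * real n ^ k)"
proof -
  have "E (\<lambda>\<omega>. S \<omega> ^ k) < \<top>"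
    using S_power_le[OF assms] by (meson ennreal_less_top le_less_trans)
  then show ?thesis using nr_pos by (simp add: u_def)
qed

text \<open>Cauchy--Schwarz against 1. Applied at \<open>2 d\<close> and then at \<open>d\<close>,
  it descends from \<open>u (4 * d) = a\<close> to the two moments needed.\<close>

lemma u_square_le: assumes "2 * k \<le> 4 * d" shows "u k ^ 2 \<le> u (2 * k)"
proof -
  have "E (\<lambda>\<omega>. S \<omega> ^ k * 1) \<le> ennreal (sqrt (u (2 * k) * real n ^ (2 * k) * 1))"
  proof (rule Cauchy_Schwarz_ennreal_bound)
    show "E (\<lambda>\<omega>. (S \<omega> ^ k)\<^sup>2) \<le> ennreal (u (2 * k) * real n ^ (2 * k))"
      using S_power_eq[OF assms] by (simp add: power_mult[symmetric] mult.commute)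
  qed (use u_nonneg in \<open>auto simp: emeasure_space_1\<close>)
  then have "u k * real n ^ k \<le> sqrt (u (2 * k) * real n ^ (2 * k))"
    using S_power_eq[of k] assms u_nonneg by (simp add: ennreal_le_iff)
  also have "\<dots> = sqrt (u (2 * k)) * real n ^ k"
  proof -
    have "real n ^ (2 * k) = (real n ^ k)\<^sup>2" by (simp add: power_mult[symmetric] mult.commute)
    then show ?thesis by (simp add: real_sqrt_mult)
  qed
  finally have "u k \<le> sqrt (u (2 * k))" using nr_pos by simp
  then show ?thesis using u_nonneg by (metis power_mono real_sqrt_pow2)
qed

lemma u_4d: "u (4 * d) = a"
  using a_nonneg nr_pos by (simp add: u_def S4)

lemma E_S: "E S = of_nat n"
proof -
  have "E (\<lambda>\<omega>. sq (X i \<omega>)) = 1" if "i \<in> {1..n}" for i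
    using nn_integral_prod_set[OF symf_const[of 1] sq_meas, of "{i}" 1] that var1 by simp
  then have "E (\<lambda>\<omega>. \<Sum>i=1..n. sq (X i \<omega>)) = (\<Sum>i=1..n. 1)"
    using prod_X_meas[of "{_}" "\<lambda>_. sq"] by (subst nn_integral_sum) auto
  then show ?thesis by (simp add: S_def[abs_def])
qed

text \<open>\<open>s ^ k\<close> lies above its tangent at 1, and \<open>S / n\<close> has mean
  1.\<close>

lemma u_ge_1: assumes k: "k \<le> 4 * d" shows "u k \<ge> 1"
proof -
  have iS: "integrable N Sr" and eS: "(\<integral>\<omega>. Sr \<omega> \<partial>N) = real n"
  proof -
    have e: "E (\<lambda>\<omega>. ennreal (Sr \<omega>)) = ennreal (real n)"
      using E_S by (simp add: S_eq_Sr[symmetric] ennreal_of_nat_eq_real_of_nat)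
    show i: "integrable N Sr" using e by (intro integrableI_nonneg) (auto simp: Sr_nonneg)
    show "(\<integral>\<omega>. Sr \<omega> \<partial>N) = real n"
      using nn_integral_eq_integral[OF i] e Sr_nonneg
      by (simp add: Bochner_Integration.integral_nonneg)
  qed
  have iSk: "integrable N (\<lambda>\<omega>. Sr \<omega> ^ k)"
    by (rule integrable_Sr_power[OF S_power_eq[OF k]])
  have eSk: "(\<integral>\<omega>. Sr \<omega> ^ k \<partial>N) = u k * real n ^ k"
    using nn_integral_eq_integral[OF iSk] S_power_eq[OF k] u_nonneg
    by (simp add: S_eq_Sr ennreal_power Sr_nonneg Bochner_Integration.integral_nonneg)
  have "real n ^ k = (\<integral>\<omega>. real n ^ k * (1 + real k * (Sr \<omega> / real n - 1)) \<partial>N)"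
    using iS eS nr_pos by (simp add: prob_space)
  also have "\<dots> \<le> (\<integral>\<omega>. Sr \<omega> ^ k \<partial>N)"
  proof (rule integral_mono)
    fix \<omega>
    have "1 + real k * (Sr \<omega> / real n - 1) \<le> (1 + (Sr \<omega> / real n - 1)) ^ k"
      using Sr_nonneg[of \<omega>] by (intro Bernoulli_inequality) simp
    then have "real n ^ k * (1 + real k * (Sr \<omega> / real n - 1)) \<le> real n ^ k * (Sr \<omega> / real n) ^ k"
      by (intro mult_left_mono) auto
    also have "\<dots> = Sr \<omega> ^ k" using nr_pos by (simp add: power_divide)
    finally show "real n ^ k * (1 + real k * (Sr \<omega> / real n - 1)) \<le> Sr \<omega> ^ k" .
  qed (use iS iSk in auto)
  finally show ?thesis using nr_pos by (simp add: eSk)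
qed

lemma ff_real: "real (ff k) = (\<Prod>i<k. real (n - 0 - i))" by (simp add: ff_def)

lemma ff_bounds:
  assumes "k \<le> 2 * d"
  shows "(1 - 4 * real d ^ 2 / n) * real n ^ k \<le> real (ff k)" "real (ff k) \<le> real n ^ k"
  unfolding ff_real using assms falling_product_bounds[OF d2_le_n n_pos, of 0 k] by auto

lemma half_le: "1 / 2 \<le> 1 - 4 * real d ^ 2 / n"
proof -
  have "real (8 * d ^ 2) \<le> real n" using n_large by (simp only: of_nat_le_iff)
  then show ?thesis using nr_pos by (simp add: field_simps)
qed

lemma falling_half:
  assumes "j + k \<le> 2 * d"
  shows "real n ^ k \<le> 2 * (\<Prod>i<k. real (n - j - i))"
proof -
  have "(1 / 2) * real n ^ k \<le> (1 - 4 * real d ^ 2 / n) * real n ^ k"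
    using half_le by (intro mult_right_mono) auto
  then show ?thesis using falling_product_bounds(1)[OF d2_le_n n_pos assms] by linarith
qed

definition b :: "nat \<Rightarrow> real" where "b k = enn2real (mom k)"

lemma b_nonneg: "b k \<ge> 0" by (simp add: b_def)

lemma mom_ff_le: assumes "k \<le> 2 * d" shows "of_nat (ff k) * mom k \<le> ennreal (u k * real n ^ k)"
proof -
  have "of_nat (ff k) * E (\<lambda>\<omega>. (\<Prod>i\<in>{1..k}. sq (X i \<omega>)) * S \<omega> ^ 0) \<le> E (\<lambda>\<omega>. S \<omega> ^ (k + 0))"
    using assms d2_le_n by (intro moment_set_le) auto
  then show ?thesis using S_power_eq[of k] assms by (simp add: mom_def)
qed

lemma ff_pos: assumes "k \<le> 2 * d" shows "real (ff k) > 0"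
proof -
  have "0 + k \<le> 2 * d" using assms by simp
  from falling_half[OF this] zero_less_power[OF nr_pos, of k] show ?thesis
    unfolding ff_real by linarith
qed

lemma mom_eq: assumes "k \<le> 2 * d" shows "mom k = ennreal (b k)"
proof -
  have "mom k \<noteq> \<top>"
  proof
    assume "mom k = \<top>"
    then have "of_nat (ff k) * mom k = \<top>"
      using ff_pos[OF assms] by (simp add: ennreal_mult_top)
    then show False using mom_ff_le[OF assms] by (simp add: top_unique)
  qed
  then show ?thesis by (simp add: b_def less_top)
qed

lemma b_upper: assumes "k \<le> 2 * d" shows "real (ff k) / real n ^ k * b k \<le> u k"
proof -
  have "ennreal (real (ff k) * b k) \<le> ennreal (u k * real n ^ k)"
    using mom_ff_le[OF assms] mom_eq[OF assms] b_nonneg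
    by (simp add: ennreal_mult ennreal_of_nat_eq_real_of_nat)
  then have "real (ff k) * b k \<le> u k * real n ^ k" using u_nonneg by (simp add: ennreal_le_iff)
  then show ?thesis using nr_pos by (simp add: field_simps)
qed

text \<open>Cauchy--Schwarz bounds the repeated-index term \<open>k (k - 1) E (T S^{k-2})\<close>
  through \<open>E T^2\<close> and \<open>E S^{2(k-2)}\<close>; as \<open>k <= 2 d\<close>, the
  latter stays within the \<open>8 d\<close>-th moment of the norm. Relative to \<open>n ^ k\<close>
  the term is of order \<open>d^2 L / n\<close>.\<close>

lemma b_lower:
  assumes k: "k \<le> 2 * d"
  shows "u k \<le> real (ff k) / real n ^ k * b k + 4 * real d ^ 2 * L / n * sqrt (1 + a)"
proof (cases "k \<le> 1")
  \<comment> \<open>Here \<open>k - 2\<close> truncates to 0, but the coefficient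
    \<open>k * (k - 1)\<close> vanishes.\<close>
  case True
  have "E (\<lambda>\<omega>. S \<omega> ^ k) \<le> of_nat (ff k) * mom k + of_nat (k * (k - 1)) * E (\<lambda>\<omega>. T \<omega> * S \<omega> ^ (k - 2))"
    using k d2_le_n by (intro power_sum_le) auto
  also have "k * (k - 1) = 0" using True by (cases k) auto
  finally have "ennreal (u k * real n ^ k) \<le> ennreal (real (ff k) * b k)"
    using S_power_eq[of k] k mom_eq[OF k] b_nonneg
    by (simp add: ennreal_mult ennreal_of_nat_eq_real_of_nat)
  then have "u k * real n ^ k \<le> real (ff k) * b k" using b_nonneg by (simp add: ennreal_le_iff)
  then have "u k \<le> real (ff k) / real n ^ k * b k" using nr_pos by (simp add: field_simps)
  moreover have "0 \<le> 4 * real d ^ 2 * L / n * sqrt (1 + a)" using L_nonneg a_nonneg by auto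
  ultimately show ?thesis by linarith
next
  case False
  then obtain k'' where kk: "k = Suc (Suc k'')"
    by (cases k; cases "k - 1") auto
  define c where "c = real n ^ (k - 1) * L * sqrt (1 + a)"
  have c0: "c \<ge> 0" using L_nonneg a_nonneg by (simp add: c_def)
  have D: "E (\<lambda>\<omega>. T \<omega> * S \<omega> ^ (k - 2)) \<le> ennreal c"
  proof -
    have "E (\<lambda>\<omega>. T \<omega> * S \<omega> ^ (k - 2))
        \<le> ennreal (sqrt (real n ^ 2 * L ^ 2 * ((1 + a) * real n ^ (2 * (k - 2)))))"
    proof (rule Cauchy_Schwarz_ennreal_bound[OF _ _ T2])
      show "E (\<lambda>\<omega>. (S \<omega> ^ (k - 2))\<^sup>2) \<le> ennreal ((1 + a) * real n ^ (2 * (k - 2)))"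
        using S_power_le[of "2 * (k - 2)"] k by (simp add: power_mult[symmetric] mult.commute)
    qed (use a_nonneg in auto)
    also have "sqrt (real n ^ 2 * L ^ 2 * ((1 + a) * real n ^ (2 * (k - 2)))) = c"
    proof (rule real_sqrt_unique)
      have e: "real n ^ (k - 1) = real n * real n ^ (k - 2)"
        unfolding kk by simp
      show "c\<^sup>2 = real n ^ 2 * L ^ 2 * ((1 + a) * real n ^ (2 * (k - 2)))"
        using a_nonneg unfolding c_def e by (simp add: power_mult_distrib power_mult[symmetric] mult_ac)
    qed (rule c0)
    finally show ?thesis .
  qed
  have "E (\<lambda>\<omega>. S \<omega> ^ k) \<le> of_nat (ff k) * mom k + of_nat (k * (k - 1)) * E (\<lambda>\<omega>. T \<omega> * S \<omega> ^ (k - 2))"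
    using k d2_le_n by (intro power_sum_le) auto
  also have "\<dots> \<le> of_nat (ff k) * mom k + of_nat (k * (k - 1)) * ennreal c"
    by (intro add_left_mono mult_left_mono D) auto
  also have "\<dots> = ennreal (real (ff k) * b k + real (k * (k - 1)) * c)"
    using mom_eq[OF k] b_nonneg c0
    by (simp add: ennreal_mult ennreal_of_nat_eq_real_of_nat ennreal_plus del: of_nat_mult)
  finally have F: "E (\<lambda>\<omega>. S \<omega> ^ k) \<le> ennreal (real (ff k) * b k + real (k * (k - 1)) * c)" .
  have nn: "0 \<le> real (ff k) * b k + real (k * (k - 1)) * c" using b_nonneg c0 by simp
  have k4: "k \<le> 4 * d" using k by simp
  have "u k * real n ^ k \<le> real (ff k) * b k + real (k * (k - 1)) * c"
    using F unfolding S_power_eq[OF k4] ennreal_le_iff[OF nn] .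
  then have "u k \<le> (real (ff k) * b k + real (k * (k - 1)) * c) / real n ^ k"
    using nr_pos by (simp add: field_simps del: of_nat_mult)
  also have "\<dots> = real (ff k) / real n ^ k * b k + real (k * (k - 1)) * (c / real n ^ k)"
    by (simp add: add_divide_distrib)
  also have "c / real n ^ k = L * sqrt (1 + a) / n"
  proof -
    have "real n ^ k = real n * real n ^ (k - 1)" unfolding kk by simp
    then show ?thesis using nr_pos by (simp add: c_def)
  qed
  also have "real (k * (k - 1)) * (L * sqrt (1 + a) / n) \<le> 4 * real d ^ 2 * (L * sqrt (1 + a) / n)"
  proof (rule mult_right_mono)
    have "k * (k - 1) \<le> (2 * d) * (2 * d)" using k by (intro mult_mono) auto
    then have "real (k * (k - 1)) \<le> real ((2 * d) * (2 * d))" by (simp only: of_nat_le_iff)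
    then show "real (k * (k - 1)) \<le> 4 * real d ^ 2" by (simp add: power2_eq_square)
    show "0 \<le> L * sqrt (1 + a) / n" using L_nonneg a_nonneg by simp
  qed
  finally show ?thesis by simp
qed

section \<open>Mixed fourth and second moments, for (C)\<close>

definition mixed :: "nat \<Rightarrow> ennreal" where
  "mixed r = E (\<lambda>\<omega>. (\<Prod>j=1..r. sq (X j \<omega>) ^ 2) * (\<Prod>j=Suc r..2 * d - r. sq (X j \<omega>)))"

text \<open>The \<open>2 d - 2 r\<close> squared coordinates are collected into a power of
  \<open>S\<close>.\<close>

lemma mixed_falling:
  assumes r: "r \<le> d"
  shows "(\<Prod>i<2 * d - 2 * r. of_nat (n - r - i)) * mixed r
    \<le> E (\<lambda>\<omega>. (\<Prod>j=1..r. sq (X j \<omega>) ^ 2) * S \<omega> ^ (2 * d - 2 * r))"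
proof -
  have "r + (2 * d - 2 * r) = 2 * d - r" using r by simp
  then show ?thesis
    using nn_integral_falling_le[of "\<lambda>_ x. sq x ^ 2" sq "\<lambda>_. 1" r "2 * d - 2 * r", OF sq2_meas sq_meas symf_const] d2_le_n
    by (simp add: mixed_def S_def)
qed

text \<open>The falling product is at least half of \<open>n ^ (2 * d - 2 * r)\<close>, whence the
  factor 2.\<close>

lemma mixed_le_of_bound:
  assumes r: "r \<le> d" and c: "c \<ge> 0"
    and bnd: "E (\<lambda>\<omega>. (\<Prod>j=1..r. sq (X j \<omega>) ^ 2) * S \<omega> ^ (2 * d - 2 * r)) \<le> ennreal (c * real n ^ (2 * d - 2 * r))"
  shows "mixed r \<le> ennreal (2 * c)"
proof -
  let ?k = "2 * d - 2 * r"
  define P where "P = (\<Prod>i<?k. real (n - r - i))"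
  have P: "real n ^ ?k \<le> 2 * P" using falling_half[of r ?k] r by (simp add: P_def)
  then have P0: "P > 0" using zero_less_power[OF nr_pos, of ?k] by linarith
  have e: "(\<Prod>i<?k. of_nat (n - r - i)) = ennreal P"
    unfolding P_def by (simp add: prod_ennreal[symmetric] ennreal_of_nat_eq_real_of_nat)
  have "ennreal P * mixed r \<le> ennreal (c * real n ^ ?k)"
    using order_trans[OF mixed_falling[OF r] bnd] unfolding e .
  also have "\<dots> \<le> ennreal (P * (2 * c))"
    using mult_left_mono[OF P c] by (intro ennreal_leI) (simp add: mult_ac)
  also have "\<dots> = ennreal P * ennreal (2 * c)" using P0 c by (simp add: ennreal_mult)
  finally show ?thesis
    using P0 ennreal_mult_le_mult_iff[of "ennreal P"] by simp
qed

text \<open>Cauchy--Schwarz: squaring the product of fourth powers gives the eighth moments of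
  (iii), and the exponent of \<open>S\<close> becomes \<open>2 (2 d - 2 r)\<close>, still at most
  \<open>4 d\<close>.\<close>

lemma mixed_le_of_eighth_moments:
  assumes r: "1 \<le> r" "r \<le> d"
    and iii: "E (\<lambda>\<omega>. \<Prod>j=1..r. sq (X j \<omega>) ^ 4) \<le> ennreal (L ^ (2 * r))"
  shows "mixed r \<le> ennreal (4 * sqrt (1 + a) * L ^ r)"
proof -
  let ?k = "2 * d - 2 * r"
  have "E (\<lambda>\<omega>. (\<Prod>j=1..r. sq (X j \<omega>) ^ 2) * S \<omega> ^ ?k)
      \<le> ennreal (sqrt (L ^ (2 * r) * ((1 + a) * real n ^ (2 * ?k))))"
  proof (rule Cauchy_Schwarz_ennreal_bound)
    show "(\<lambda>\<omega>. \<Prod>j=1..r. sq (X j \<omega>) ^ 2) \<in> borel_measurable N"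
      using r d2_le_n by (intro prod_X_meas) auto
    show "E (\<lambda>\<omega>. (\<Prod>j=1..r. sq (X j \<omega>) ^ 2)\<^sup>2) \<le> ennreal (L ^ (2 * r))"
      using iii by (simp add: prod_power_distrib[symmetric] power_mult[symmetric])
    show "E (\<lambda>\<omega>. (S \<omega> ^ ?k)\<^sup>2) \<le> ennreal ((1 + a) * real n ^ (2 * ?k))"
      using S_power_le[of "2 * ?k"] by (simp add: power_mult[symmetric] mult.commute)
  qed (use a_nonneg in auto)
  also have "sqrt (L ^ (2 * r) * ((1 + a) * real n ^ (2 * ?k))) = (sqrt (1 + a) * L ^ r) * real n ^ ?k"
    using L_nonneg a_nonneg by (intro real_sqrt_unique)
      (auto simp: power_mult_distrib power_mult[symmetric] mult_ac)
  finally have "mixed r \<le> ennreal (2 * (sqrt (1 + a) * L ^ r))"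
    using r L_nonneg a_nonneg by (intro mixed_le_of_bound) auto
  \<comment> \<open>Weakened by a factor 2 to agree with the bound under (iii').\<close>
  also have "\<dots> \<le> ennreal (4 * sqrt (1 + a) * L ^ r)"
    using L_nonneg a_nonneg by (intro ennreal_leI) (simp add: mult_right_mono)
  finally show ?thesis .
qed

text \<open>Before Cauchy--Schwarz, exchangeability replaces the product of \<open>r\<close> fourth
  powers by \<open>T ^ r\<close> over \<open>ff r\<close>. Comparing \<open>ff r\<close> with
  \<open>n ^ r\<close> costs a second factor 2.\<close>

lemma mixed_le_of_norm_moments:
  assumes r: "1 \<le> r" "r \<le> d"
    and iii': "E (\<lambda>\<omega>. T \<omega> ^ (2 * r)) \<le> ennreal (real n ^ (2 * r) * L ^ (2 * r))"
  shows "mixed r \<le> ennreal (4 * sqrt (1 + a) * L ^ r)"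
proof -
  let ?k = "2 * d - 2 * r"
  let ?Y = "E (\<lambda>\<omega>. (\<Prod>j=1..r. sq (X j \<omega>) ^ 2) * S \<omega> ^ ?k)"
  have "of_nat (ff r) * ?Y \<le> E (\<lambda>\<omega>. T \<omega> ^ r * S \<omega> ^ ?k)"
    using nn_integral_falling_le[of "\<lambda>_. sq" "\<lambda>x. sq x ^ 2" "\<lambda>z. (\<Sum>i=1..n. sq (z i)) ^ ?k" 0 r, OF sq_meas sq2_meas symf_S]
      r d2_le_n by (simp add: ff_def S_def T_def)
  also have "\<dots> \<le> ennreal (sqrt (real n ^ (2 * r) * L ^ (2 * r) * ((1 + a) * real n ^ (2 * ?k))))"
  proof (rule Cauchy_Schwarz_ennreal_bound)
    show "E (\<lambda>\<omega>. (T \<omega> ^ r)\<^sup>2) \<le> ennreal (real n ^ (2 * r) * L ^ (2 * r))"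
      using iii' by (simp add: power_mult[symmetric] mult.commute)
    show "E (\<lambda>\<omega>. (S \<omega> ^ ?k)\<^sup>2) \<le> ennreal ((1 + a) * real n ^ (2 * ?k))"
      using S_power_le[of "2 * ?k"] by (simp add: power_mult[symmetric] mult.commute)
  qed (use a_nonneg in auto)
  also have "sqrt (real n ^ (2 * r) * L ^ (2 * r) * ((1 + a) * real n ^ (2 * ?k)))
      = real n ^ r * (sqrt (1 + a) * L ^ r * real n ^ ?k)"
    using L_nonneg a_nonneg by (intro real_sqrt_unique)
      (auto simp: power_mult_distrib power_mult[symmetric] mult_ac)
  also have "ennreal \<dots> \<le> ennreal (real (ff r) * (2 * sqrt (1 + a) * L ^ r * real n ^ ?k))"
  proof (rule ennreal_leI)
    have "real n ^ r \<le> 2 * real (ff r)" using falling_half[of 0 r] r ff_real by simp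
    then have "real n ^ r * (sqrt (1 + a) * L ^ r * real n ^ ?k)
        \<le> 2 * real (ff r) * (sqrt (1 + a) * L ^ r * real n ^ ?k)"
      using L_nonneg a_nonneg by (intro mult_right_mono) auto
    then show "real n ^ r * (sqrt (1 + a) * L ^ r * real n ^ ?k)
        \<le> real (ff r) * (2 * sqrt (1 + a) * L ^ r * real n ^ ?k)" by (simp add: mult_ac)
  qed
  also have "\<dots> = of_nat (ff r) * ennreal (2 * sqrt (1 + a) * L ^ r * real n ^ ?k)"
    using L_nonneg a_nonneg by (simp add: ennreal_mult ennreal_of_nat_eq_real_of_nat)
  finally have "?Y \<le> ennreal ((2 * sqrt (1 + a) * L ^ r) * real n ^ ?k)"
    using ennreal_mult_le_mult_iff[of "of_nat (ff r)"] ff_pos[of r] r by simp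
  then have "mixed r \<le> ennreal (2 * (2 * sqrt (1 + a) * L ^ r))"
    using r L_nonneg a_nonneg by (intro mixed_le_of_bound) auto
  then show ?thesis by (simp add: mult.assoc)
qed

end

section \<open>Binomial counts and the relative variance\<close>

lemma fact_times_binomial: "k \<le> n \<Longrightarrow> fact k * real (n choose k) = (\<Prod>i<k. real (n - i))"
proof -
  assume k: "k \<le> n"
  have "fact k * real (n choose k) = (\<Prod>i = 0..<k. real n - real i)"
    unfolding binomial_gbinomial gbinomial_prod_rev by simp
  also have "\<dots> = (\<Prod>i<k. real (n - i))"
    using k by (intro prod.cong) (auto simp: of_nat_diff)
  finally show ?thesis .
qed

lemma card_dsubsets: "card (dsubsets n d) = n choose d"
  using n_subsets[of "{1..n}" d] by (simp add: dsubsets_def)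

lemma card_disjoint_pairs:
  "card {u \<in> dsubsets n d \<times> dsubsets n d. fst u \<inter> snd u = {}} = (n choose d) * ((n - d) choose d)"
proof -
  have fin: "finite (dsubsets n d)" by (simp add: dsubsets_def)
  have "{u \<in> dsubsets n d \<times> dsubsets n d. fst u \<inter> snd u = {}}
      = (SIGMA i:dsubsets n d. {k \<in> dsubsets n d. i \<inter> k = {}})" by auto
  then have "card {u \<in> dsubsets n d \<times> dsubsets n d. fst u \<inter> snd u = {}}
      = (\<Sum>i\<in>dsubsets n d. card {k \<in> dsubsets n d. i \<inter> k = {}})"
    using fin by (simp add: card_SigmaI)
  also have "\<dots> = (\<Sum>i\<in>dsubsets n d. (n - d) choose d)"
  proof (rule sum.cong)
    fix i assume i: "i \<in> dsubsets n d"
    then have "finite i" "card i = d" "i \<subseteq> {1..n}" by (auto simp: dsubsets_def intro: finite_subset)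
    then have "card ({1..n} - i) = n - d" by (simp add: card_Diff_subset)
    moreover have "{k \<in> dsubsets n d. i \<inter> k = {}} = {k. k \<subseteq> {1..n} - i \<and> card k = d}"
      by (auto simp: dsubsets_def)
    ultimately show "card {k \<in> dsubsets n d. i \<inter> k = {}} = (n - d) choose d"
      using n_subsets[of "{1..n} - i" d] by simp
  qed simp
  finally show ?thesis by (simp add: card_dsubsets)
qed

text \<open>Makes tails exponential in the dimension summable in \<open>n\<close>.\<close>

lemma binomial_ge_self: "1 \<le> d \<Longrightarrow> d < n \<Longrightarrow> n \<le> n choose d"
proof (induction n arbitrary: d)
  case (Suc n)
  show ?case
  proof (cases "d = n")
    case False
    then have "n \<le> n choose d" using Suc by simp
    moreover have "1 \<le> n choose (d - 1)" using Suc.prems by (simp add: Suc_le_eq zero_less_binomial_iff)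
    moreover have "Suc n choose d = (n choose (d - 1)) + (n choose d)"
      using Suc.prems by (cases d) auto
    ultimately show ?thesis by simp
  qed simp
qed simp

context tensor_moments
begin

definition err :: real where "err = 4 * real d ^ 2 / n"

text \<open>The variance bound divided by \<open>2 \<tau>^2 p^2\<close>. In order: the total over
  all diagonal pairs, minus its disjoint share; the centred mean over disjoint pairs; the proportion
  of overlapping pairs; the off-diagonal part.\<close>

definition \<kappa> :: real where
  "\<kappa> = u (2 * d) / (1 - err)\<^sup>2 - (1 - err) * b (2 * d) + \<bar>b (2 * d) - 2 * b d + 1\<bar> + err + 16 * u (2 * d) * (d / n)"

lemma quad_form_relative_variance:
  fixes A :: "nat set \<Rightarrow> nat set \<Rightarrow> real"
  assumes a: "\<And>i. i \<in> dsubsets n d \<Longrightarrow> 0 \<le> A i i" "\<And>i. i \<in> dsubsets n d \<Longrightarrow> A i i \<le> \<tau>"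
    and A: "\<And>i. i \<in> dsubsets n d \<Longrightarrow> (\<Sum>j\<in>dsubsets n d. (A i j)\<^sup>2) \<le> \<tau>\<^sup>2"
  shows "(\<integral>\<^sup>+\<omega>. ennreal ((quad (dsubsets n d) A (\<lambda>i. tens i \<omega>) - trace_on (dsubsets n d) A)\<^sup>2) \<partial>N)
    \<le> ennreal (2 * \<tau>\<^sup>2 * (real (n choose d))\<^sup>2 * \<kappa>)"
proof -
  define M where "M = u (2 * d) * real n ^ (2 * d)"
  interpret sm: sym_vector_moments N n X d M
    using d2_le_n S_power_eq[of "2 * d"] u_nonneg by unfold_locales (auto simp: M_def)
  let ?I = "dsubsets n d"
  define p where "p = real (n choose d)"
  define Nd where "Nd = real (card {u \<in> ?I \<times> ?I. fst u \<inter> snd u = {}})"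
  \<comment> \<open>The row-sum bound at \<open>s = 1\<close>, which dominates because
    \<open>4 d / n <= 1\<close>. The constant 16 is a factor 2 from each of two comparisons of
    falling factorials with powers, times the 4 of \<open>4 ^ s\<close>.\<close>
  define \<rho> where "\<rho> = p * (16 * u (2 * d) * (d / n))"
  have e: "0 \<le> err" "err \<le> 1 / 2" using half_le by (auto simp: err_def)
  have dn: "d \<le> n" "d \<le> n - d" using d2_le_n by auto
  have p: "p > 0" using dn by (simp add: p_def zero_less_binomial_iff)
  have pf: "fact d * p = real (ff d)"
    using fact_times_binomial[OF dn(1)] by (simp add: p_def ff_def)
  have fl: "(1 - err) * real n ^ d \<le> fact d * p" "fact d * p \<le> real n ^ d"
    unfolding pf using ff_bounds[of d] by (auto simp: err_def)
  \<comment> \<open>Fixing the first set leaves \<open>(n - d) choose d\<close> sets disjoint from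
    it, compared with \<open>n choose d\<close> through \<open>n ^ d\<close>.\<close>
  have Nd: "(1 - err) * p\<^sup>2 \<le> Nd"
  proof -
    have "(1 - err) * (fact d * p) \<le> (1 - err) * real n ^ d"
      using fl e by (intro mult_left_mono) auto
    also have "\<dots> \<le> (\<Prod>i<d. real (n - d - i))"
      using falling_product_bounds(1)[OF d2_le_n n_pos, of d d] by (simp add: err_def)
    also have "\<dots> = fact d * real ((n - d) choose d)"
      using fact_times_binomial[OF dn(2)] by simp
    finally have "fact d * ((1 - err) * p) \<le> fact d * real ((n - d) choose d)" by (simp add: mult_ac)
    then have "(1 - err) * p \<le> real ((n - d) choose d)" by simp
    then have "p * ((1 - err) * p) \<le> p * real ((n - d) choose d)"
      using p by (intro mult_left_mono) auto
    also have "\<dots> = Nd" by (simp add: Nd_def card_disjoint_pairs p_def)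
    finally show ?thesis by (simp add: power2_eq_square mult_ac)
  qed
  have \<rho>0: "\<rho> \<ge> 0" using p u_nonneg by (simp add: \<rho>_def)
  have \<rho>: "4 ^ s * M / (real (ff (d + s)) * fact (d - s)) \<le> \<rho>" if s: "s \<in> {1..d}" for s
  proof -
    have f1: "real n ^ (d + s) \<le> 2 * real (ff (d + s))"
      using falling_half[of 0 "d + s"] s by (simp add: ff_real)
    have f2: "real n ^ d \<le> 2 * (fact d * p)"
      using falling_half[of 0 d] pf by (simp add: ff_real)
    have fd: "fact d \<le> real d ^ s * fact (d - s)"
    proof -
      have "(fact d :: nat) = (fact d div fact (d - s)) * fact (d - s)"
        by (simp add: fact_dvd)
      also have "\<dots> \<le> d ^ s * fact (d - s)"
        using s by (intro mult_right_mono fact_div_fact_le_pow) auto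
      finally have "real (fact d) \<le> real (d ^ s * fact (d - s))" by (simp only: of_nat_le_iff)
      then show ?thesis by simp
    qed
    have dn4: "4 * real d / n \<le> 1" "0 \<le> 4 * real d / n"
    proof -
      have "real d * 1 \<le> real d * real d" using d_pos by (intro mult_left_mono) auto
      then have "4 * real d \<le> 4 * real d ^ 2" by (simp add: power2_eq_square)
      also have "\<dots> \<le> real n" using e nr_pos by (simp add: err_def field_simps)
      finally show "4 * real d / n \<le> 1" using nr_pos by simp
    qed simp
    have "4 ^ s * M * real n ^ (d + s) * real n ^ d \<le> 4 ^ s * M * (2 * real (ff (d + s))) * (2 * (fact d * p))"
      using f1 f2 u_nonneg by (intro mult_mono) (auto simp: M_def)
    also have "\<dots> \<le> 4 ^ s * M * (2 * real (ff (d + s))) * (2 * ((real d ^ s * fact (d - s)) * p))"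
      using fd p u_nonneg by (intro mult_left_mono mult_right_mono) (auto simp: M_def)
    finally have "4 ^ s * M * real n ^ (d + s) * real n ^ d
        \<le> 4 * p * u (2 * d) * (real (ff (d + s)) * fact (d - s)) * (4 ^ s * real d ^ s) * real n ^ (2 * d)"
      by (simp add: M_def mult_ac)
    moreover have "real n ^ (d + s) * real n ^ d = real n ^ s * real n ^ (2 * d)"
      by (simp only: power_add[symmetric]) (rule arg_cong[of _ _ "\<lambda>k. real n ^ k"], simp)
    ultimately have "(4 ^ s * M * real n ^ s) * real n ^ (2 * d)
        \<le> (4 * p * u (2 * d) * (real (ff (d + s)) * fact (d - s)) * (4 * real d) ^ s) * real n ^ (2 * d)"
      by (simp add: power_mult_distrib mult_ac)
    then have "4 ^ s * M * real n ^ s \<le> 4 * p * u (2 * d) * (real (ff (d + s)) * fact (d - s)) * (4 * real d) ^ s"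
      using nr_pos by simp
    then have "4 ^ s * M \<le> 4 * p * u (2 * d) * (real (ff (d + s)) * fact (d - s)) * (4 * real d) ^ s / real n ^ s"
      using nr_pos by (simp add: pos_le_divide_eq)
    also have "\<dots> = 4 * p * u (2 * d) * (4 * real d / n) ^ s * (real (ff (d + s)) * fact (d - s))"
      by (simp add: power_divide)
    also have "\<dots> \<le> 4 * p * u (2 * d) * (4 * real d / n) ^ 1 * (real (ff (d + s)) * fact (d - s))"
      using s dn4 p u_nonneg by (intro mult_right_mono mult_left_mono power_decreasing) auto
    finally have "4 ^ s * M \<le> \<rho> * (real (ff (d + s)) * fact (d - s))"
      by (simp add: \<rho>_def mult_ac)
    then show ?thesis using ff_pos[of "d + s"] s by (simp add: pos_divide_le_eq)
  qed
  have Mp: "M / (fact d)\<^sup>2 \<le> p\<^sup>2 * (u (2 * d) / (1 - err)\<^sup>2)"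
  proof -
    have "((1 - err) * real n ^ d)\<^sup>2 \<le> (fact d * p)\<^sup>2"
      using fl e by (intro power_mono) auto
    then have "u (2 * d) * ((1 - err)\<^sup>2 * real n ^ (2 * d)) \<le> u (2 * d) * ((fact d)\<^sup>2 * p\<^sup>2)"
      using u_nonneg by (intro mult_left_mono) (auto simp: power_mult_distrib power_mult[symmetric] mult.commute)
    then have "M * (1 - err)\<^sup>2 \<le> p\<^sup>2 * u (2 * d) * (fact d)\<^sup>2" by (simp add: M_def mult_ac)
    moreover have "(1 - err)\<^sup>2 > 0" using e by simp
    ultimately show ?thesis by (simp add: field_simps)
  qed
  have "(\<integral>\<^sup>+\<omega>. ennreal ((quad ?I A (\<lambda>i. tens i \<omega>) - trace_on ?I A)\<^sup>2) \<partial>N) \<le> ennreal (2 * \<tau>\<^sup>2 *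
      (M / (fact d)\<^sup>2 - Nd * b (2 * d) + p\<^sup>2 * \<bar>b (2 * d) - 2 * b d + 1\<bar> + (p\<^sup>2 - Nd) + p * \<rho>))"
  proof -
    have c: "p = real (card ?I)" by (simp add: p_def card_dsubsets)
    show ?thesis unfolding Nd_def c
      by (rule sm.quad_form_variance[OF mom_eq b_nonneg mom_eq b_nonneg \<rho> \<rho>0 a A]) auto
  qed
  also have "\<dots> \<le> ennreal (2 * \<tau>\<^sup>2 * p\<^sup>2 * \<kappa>)"
  proof (rule ennreal_leI)
    have "M / (fact d)\<^sup>2 - Nd * b (2 * d) + p\<^sup>2 * \<bar>b (2 * d) - 2 * b d + 1\<bar> + (p\<^sup>2 - Nd) + p * \<rho>
        \<le> p\<^sup>2 * (u (2 * d) / (1 - err)\<^sup>2) - (1 - err) * p\<^sup>2 * b (2 * d)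
          + p\<^sup>2 * \<bar>b (2 * d) - 2 * b d + 1\<bar> + (p\<^sup>2 - (1 - err) * p\<^sup>2) + p * \<rho>"
      using Mp Nd mult_right_mono[OF Nd b_nonneg[of "2 * d"]] by linarith
    also have "\<dots> = p\<^sup>2 * \<kappa>"
      by (simp add: \<kappa>_def \<rho>_def power2_eq_square algebra_simps)
    finally show "2 * \<tau>\<^sup>2 * (M / (fact d)\<^sup>2 - Nd * b (2 * d) + p\<^sup>2 * \<bar>b (2 * d) - 2 * b d + 1\<bar> + (p\<^sup>2 - Nd) + p * \<rho>)
        \<le> 2 * \<tau>\<^sup>2 * p\<^sup>2 * \<kappa>"
      using mult_left_mono[of _ _ "2 * \<tau>\<^sup>2"] by (simp add: mult.assoc)
  qed
  finally show ?thesis by (simp add: p_def)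
qed

end

section \<open>Hypotheses in terms of norms, and the law of the tensor\<close>

context sym_vector
begin

lemma lnorm2_power: "lnorm 2 n (\<lambda>i. X i \<omega>) ^ (8 * k) = Sr \<omega> ^ (4 * k)"
proof -
  have "lnorm 2 n (\<lambda>i. X i \<omega>) ^ (8 * k) = (root 2 (Sr \<omega>) ^ 2) ^ (4 * k)"
    by (simp add: lnorm_def Sr_def power_mult[symmetric])
  then show ?thesis using Sr_nonneg by simp
qed

definition Tr :: "'b \<Rightarrow> real" where "Tr \<omega> = (\<Sum>i=1..n. X i \<omega> ^ 4)"

lemma Tr_nonneg: "Tr \<omega> \<ge> 0" by (auto simp: Tr_def intro!: sum_nonneg)

lemma T_eq_Tr: "T \<omega> = ennreal (Tr \<omega>)"
  by (simp add: T_def Tr_def sq_def ennreal_power power_mult[symmetric] sum_ennreal)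

lemma lnorm4_power: "lnorm 4 n (\<lambda>i. X i \<omega>) ^ (8 * k) = Tr \<omega> ^ (2 * k)"
proof -
  have "lnorm 4 n (\<lambda>i. X i \<omega>) ^ (8 * k) = (root 4 (Tr \<omega>) ^ 4) ^ (2 * k)"
    by (simp add: lnorm_def Tr_def power_mult[symmetric])
  then show ?thesis using Tr_nonneg by simp
qed

lemma nn_eq_lebesgue:
  assumes "integrable N f" "\<And>\<omega>. f \<omega> \<ge> 0"
  shows "E (\<lambda>\<omega>. ennreal (f \<omega>)) = ennreal (\<integral>\<omega>. f \<omega> \<partial>N)"
  using assms by (intro nn_integral_eq_integral) auto

lemma E_T_power:
  assumes "integrable N (\<lambda>\<omega>. lnorm 4 n (\<lambda>i. X i \<omega>) ^ (8 * r))"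
    and "1 / real n ^ (2 * r) * (\<integral>\<omega>. lnorm 4 n (\<lambda>i. X i \<omega>) ^ (8 * r) \<partial>N) \<le> l" and n: "n > 0"
  shows "E (\<lambda>\<omega>. T \<omega> ^ (2 * r)) \<le> ennreal (real n ^ (2 * r) * l)"
proof -
  have "E (\<lambda>\<omega>. T \<omega> ^ (2 * r)) = ennreal (\<integral>\<omega>. Tr \<omega> ^ (2 * r) \<partial>N)"
    using nn_eq_lebesgue[of "\<lambda>\<omega>. Tr \<omega> ^ (2 * r)"] assms(1)
    by (simp add: lnorm4_power T_eq_Tr ennreal_power Tr_nonneg)
  also have "\<dots> \<le> ennreal (real n ^ (2 * r) * l)"
    using assms(2) n unfolding lnorm4_power by (intro ennreal_leI) (simp add: field_simps)
  finally show ?thesis .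
qed

lemma E_prod_eighth:
  assumes int: "integrable N (\<lambda>\<omega>. \<Prod>j=1..r. X j \<omega> ^ 8)" and le: "(\<integral>\<omega>. (\<Prod>j=1..r. X j \<omega> ^ 8) \<partial>N) \<le> l"
  shows "E (\<lambda>\<omega>. \<Prod>j=1..r. sq (X j \<omega>) ^ 4) \<le> ennreal l"
proof -
  have "(\<Prod>j=1..r. sq (X j \<omega>) ^ 4) = ennreal (\<Prod>j=1..r. X j \<omega> ^ 8)" for \<omega>
    by (simp add: sq_def ennreal_power power_mult[symmetric] prod_ennreal)
  then have "E (\<lambda>\<omega>. \<Prod>j=1..r. sq (X j \<omega>) ^ 4) = ennreal (\<integral>\<omega>. (\<Prod>j=1..r. X j \<omega> ^ 8) \<partial>N)"
    using nn_eq_lebesgue[OF int] by (simp add: prod_nonneg)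
  then show ?thesis using le by (simp add: ennreal_leI)
qed

text \<open>\<open>T^2 <= n \<Sum> X_i^8\<close>, so (iii) at \<open>r = 1\<close> bounds
  \<open>E T^2\<close> just as (iii') does.\<close>

lemma E_T_square:
  assumes E8: "E (\<lambda>\<omega>. \<Prod>j=1..1. sq (X j \<omega>) ^ 4) \<le> ennreal l" and l: "l \<ge> 0"
  shows "E (\<lambda>\<omega>. T \<omega> ^ 2) \<le> ennreal (real n ^ 2 * l)"
proof -
  have m4: "(\<lambda>x. sq x ^ 4) \<in> borel_measurable borel" by measurable
  have e: "E (\<lambda>\<omega>. sq (X i \<omega>) ^ 4) \<le> ennreal l" if "i \<in> {1..n}" for i
    using nn_integral_prod_set[OF symf_const[of 1] m4, of "{i}" 1] that E8 by simp
  have mX: "(\<lambda>\<omega>. sq (X i \<omega>) ^ 4) \<in> borel_measurable N" if "i \<in> {1..n}" for i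
    by (rule measurable_compose[OF X_meas[OF that] m4])
  have "T \<omega> ^ 2 \<le> of_nat n * (\<Sum>i=1..n. sq (X i \<omega>) ^ 4)" for \<omega>
  proof -
    have "(\<Sum>i=1..n. X i \<omega> ^ 4)\<^sup>2 \<le> (\<Sum>i=1..n. (X i \<omega> ^ 4)\<^sup>2) * card {1..n}"
      by (rule sum_squared_le_sum_of_squares)
    then have "ennreal ((\<Sum>i=1..n. X i \<omega> ^ 4)\<^sup>2) \<le> ennreal (real n * (\<Sum>i=1..n. (X i \<omega>)\<^sup>2 ^ 4))"
      by (intro ennreal_leI) (simp add: power_mult[symmetric] mult.commute)
    then show ?thesis
      by (simp add: T_eq_Tr Tr_def ennreal_power sum_nonneg sq_def sum_ennreal ennreal_mult
          ennreal_of_nat_eq_real_of_nat)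
  qed
  then have "E (\<lambda>\<omega>. T \<omega> ^ 2) \<le> E (\<lambda>\<omega>. of_nat n * (\<Sum>i=1..n. sq (X i \<omega>) ^ 4))"
    by (intro nn_integral_mono)
  also have "\<dots> = of_nat n * (\<Sum>i=1..n. E (\<lambda>\<omega>. sq (X i \<omega>) ^ 4))"
    using mX by (subst nn_integral_cmult, intro borel_measurable_sum, simp) (subst nn_integral_sum, auto)
  also have "\<dots> \<le> of_nat n * (\<Sum>i=1..n. ennreal l)"
    by (intro mult_left_mono sum_mono e) auto
  also have "\<dots> = ennreal (real n ^ 2 * l)"
    using l by (simp add: ennreal_of_nat_eq_real_of_nat ennreal_mult power2_eq_square mult.assoc)
  finally show ?thesis .
qed

lemma tensor_law_prob: "prob_space (PrincipalT N n d X)"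
  and tensor_law_sets: "sets (PrincipalT N n d X) = sets (tensor_space n d)"
  and tensor_law_nn_integral: "f \<in> borel_measurable (tensor_space n d) \<Longrightarrow>
    (\<integral>\<^sup>+x. f x \<partial>PrincipalT N n d X) = E (\<lambda>\<omega>. f (\<lambda>i\<in>dsubsets n d. tens i \<omega>))"
proof -
  have m: "(\<lambda>\<omega>. \<lambda>i\<in>dsubsets n d. \<Prod>\<alpha>\<in>i. X \<alpha> \<omega>) \<in> measurable N (tensor_space n d)"
    by (intro measurable_restrict borel_measurable_prod X_meas) (auto simp: dsubsets_def)
  show "prob_space (PrincipalT N n d X)" unfolding PrincipalT_def by (rule prob_space_distr[OF m])
  show "sets (PrincipalT N n d X) = sets (tensor_space n d)" by (simp add: PrincipalT_def)
  show "f \<in> borel_measurable (tensor_space n d) \<Longrightarrow>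
    (\<integral>\<^sup>+x. f x \<partial>PrincipalT N n d X) = E (\<lambda>\<omega>. f (\<lambda>i\<in>dsubsets n d. tens i \<omega>))"
    unfolding PrincipalT_def tens_def by (intro nn_integral_distr[OF m]) simp
qed

end

context iid_vectors
begin

lemma st_restrict: "st (\<lambda>k\<in>J. y k) = st y"
proof -
  have e: "map (\<lambda>k\<in>J. y k) idx = map y idx" by (intro map_cong) auto
  show ?thesis unfolding st_def e ..
qed

text \<open>Independent samples with common law \<mu> have the product law jointly, and
  \<open>st\<close> reads no samples other than \<open>1..m\<close>.\<close>

lemma st_sample:
  assumes M: "prob_space M"
    and indep: "prob_space.indep_vars M (\<lambda>_. Pi\<^sub>M I (\<lambda>_. borel)) x {1..m}"
    and law: "\<And>k. k \<in> {1..m} \<Longrightarrow> distr M (Pi\<^sub>M I (\<lambda>_. borel)) (x k) = \<mu>"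
  shows "(\<lambda>\<omega>. st (\<lambda>k. x k \<omega>)) \<in> borel_measurable M"
    and "measure M {\<omega> \<in> space M. \<bar>st (\<lambda>k. x k \<omega>) - e\<bar> \<ge> \<epsilon>} = measure \<Omega> {y \<in> space \<Omega>. \<bar>st y - e\<bar> \<ge> \<epsilon>}"
proof -
  interpret M: prob_space M by (rule M)
  let ?B = "Pi\<^sub>M I (\<lambda>_. borel) :: ('i \<Rightarrow> real) measure"
  let ?x = "\<lambda>\<omega>. \<lambda>k\<in>J. x k \<omega>"
  have xm: "x k \<in> measurable M ?B" if "k \<in> J" for k
    using indep that unfolding M.indep_vars_def J_def by auto
  have sm: "?x \<in> measurable M \<Omega>"
    by (intro measurable_restrict) (use xm sets_\<mu> in \<open>simp cong: measurable_cong_sets\<close>)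
  have sets\<Omega>: "sets \<Omega> = sets (Pi\<^sub>M J (\<lambda>_. ?B))"
    by (intro sets_PiM_cong refl sets_\<mu>)
  have "distr M \<Omega> ?x = distr M (Pi\<^sub>M J (\<lambda>_. ?B)) ?x"
    by (intro distr_cong refl sets\<Omega>)
  also have "\<dots> = Pi\<^sub>M J (\<lambda>k. distr M ?B (x k))"
    using indep M.indep_vars_iff_distr_eq_PiM'[OF J_ne, of x "\<lambda>_. ?B"] xm by (simp add: J_def)
  also have "\<dots> = \<Omega>"
    using law by (intro PiM_cong) (auto simp: J_def)
  finally have D: "distr M \<Omega> ?x = \<Omega>" .
  show st: "(\<lambda>\<omega>. st (\<lambda>k. x k \<omega>)) \<in> borel_measurable M"
    using measurable_compose[OF sm st_meas] by (simp add: st_restrict)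
  have ms: "{y \<in> space \<Omega>. \<bar>st y - e\<bar> \<ge> \<epsilon>} \<in> sets \<Omega>" using st_meas by measurable
  have "measure \<Omega> {y \<in> space \<Omega>. \<bar>st y - e\<bar> \<ge> \<epsilon>} = measure (distr M \<Omega> ?x) {y \<in> space \<Omega>. \<bar>st y - e\<bar> \<ge> \<epsilon>}"
    by (simp add: D)
  also have "\<dots> = measure M (?x -` {y \<in> space \<Omega>. \<bar>st y - e\<bar> \<ge> \<epsilon>} \<inter> space M)"
    by (rule measure_distr[OF sm ms])
  also have "?x -` {y \<in> space \<Omega>. \<bar>st y - e\<bar> \<ge> \<epsilon>} \<inter> space M = {\<omega> \<in> space M. \<bar>st (\<lambda>k. x k \<omega>) - e\<bar> \<ge> \<epsilon>}"
    using measurable_space[OF sm] by (auto simp: st_restrict)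
  finally show "measure M {\<omega> \<in> space M. \<bar>st (\<lambda>k. x k \<omega>) - e\<bar> \<ge> \<epsilon>} = measure \<Omega> {y \<in> space \<Omega>. \<bar>st y - e\<bar> \<ge> \<epsilon>}"
    by simp
qed

end

section \<open>Limits\<close>

locale mp_setting =
  fixes d m :: "nat \<Rightarrow> nat"
    and N :: "nat \<Rightarrow> 'b measure"
    and X :: "nat \<Rightarrow> nat \<Rightarrow> 'b \<Rightarrow> real"
    and c :: real
    and M :: "'a measure"
    and x :: "nat \<Rightarrow> nat \<Rightarrow> 'a \<Rightarrow> nat set \<Rightarrow> real"
    and L :: "nat \<Rightarrow> real"
  assumes d_pos: "\<And>n. n \<ge> 1 \<Longrightarrow> d n \<ge> 1"
    and d_small: "(\<lambda>n. real (d n)) \<in> o(\<lambda>n. sqrt (real n))"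
    and X_rv: "\<And>n. n \<ge> 1 \<Longrightarrow> random_vector (N n) n (X n)"
    and X_exch: "\<And>n. n \<ge> 1 \<Longrightarrow> exchangeable (N n) n (X n)"
    and X_uncond: "\<And>n. n \<ge> 1 \<Longrightarrow> unconditional (N n) n (X n)"
    and c_pos: "c > 0"
    and aspect: "(\<lambda>n. real (n choose d n) / real (m (n choose d n))) \<longlonglongrightarrow> c"
    and M_prob: "prob_space M"
    and x_indep: "\<And>n. n \<ge> 1 \<Longrightarrow>
      prob_space.indep_vars M (\<lambda>_. tensor_space n (d n)) (x n) {1..m (n choose d n)}"
    and x_law: "\<And>n k. n \<ge> 1 \<Longrightarrow> k \<in> {1..m (n choose d n)} \<Longrightarrow>
      distr M (tensor_space n (d n)) (x n k) = PrincipalT (N n) n (d n) (X n)"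
    and i: "\<And>n. n \<ge> 1 \<Longrightarrow> (\<integral>\<omega>. (X n 1 \<omega>)\<^sup>2 \<partial>N n) = 1"
    and ii: "(\<lambda>n. 1 / real n ^ (4 * d n) *
      (\<integral>\<omega>. lnorm 2 n (\<lambda>i. X n i \<omega>) ^ (8 * d n) \<partial>N n)) \<longlonglongrightarrow> 1"
    and L_nonneg: "\<And>n. L n \<ge> 0"
    and L_lim: "(\<lambda>n. L n * real (d n) ^ 2 / real n) \<longlonglongrightarrow> 0"
    and L_bound: "(\<forall>n\<ge>1. \<forall>r. 1 \<le> r \<and> r \<le> d n \<and> r \<le> n \<longrightarrow>
             integrable (N n) (\<lambda>\<omega>. \<Prod>j=1..r. X n j \<omega> ^ 8) \<and>
             (\<integral>\<omega>. (\<Prod>j=1..r. X n j \<omega> ^ 8) \<partial>N n) \<le> L n ^ (2 * r))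
       \<or> (\<forall>n\<ge>1. \<forall>r. 1 \<le> r \<and> r \<le> d n \<longrightarrow>
             integrable (N n) (\<lambda>\<omega>. lnorm 4 n (\<lambda>i. X n i \<omega>) ^ (8 * r)) \<and>
             1 / real n ^ (2 * r) * (\<integral>\<omega>. lnorm 4 n (\<lambda>i. X n i \<omega>) ^ (8 * r) \<partial>N n)
               \<le> L n ^ (2 * r))"
begin

definition a :: "nat \<Rightarrow> real" where
  "a n = 1 / real n ^ (4 * d n) * (\<integral>\<omega>. lnorm 2 n (\<lambda>i. X n i \<omega>) ^ (8 * d n) \<partial>N n)"

definition dimn :: "nat \<Rightarrow> nat" where "dimn n = n choose d n"

text \<open>The finitely many \<open>n\<close> at which some estimate may fail are excluded by \<open>good\<close>.\<close>

definition good :: "nat \<Rightarrow> bool" where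
  "good n \<longleftrightarrow> n \<ge> 1 \<and> 8 * d n ^ 2 \<le> n \<and> 0 < a n \<and> a n \<le> 3 \<and> 0 < m (dimn n) \<and> c / 2 \<le> real (dimn n) / real (m (dimn n))"

lemma sym_vector_X: "n \<ge> 1 \<Longrightarrow> sym_vector (N n) n (X n)"
  using X_rv[of n] X_exch[of n] X_uncond[of n]
  by (intro sym_vector.intro sym_vector_axioms.intro) (auto simp: random_vector_def)

lemma a_lim: "a \<longlonglongrightarrow> 1"
  unfolding a_def using ii by simp

lemma d2_lim: "(\<lambda>n. real (d n) ^ 2 / real n) \<longlonglongrightarrow> 0"
proof -
  have "((\<lambda>n. real (d n) / sqrt (real n)) \<longlongrightarrow> 0) sequentially"
    by (rule smalloD_tendsto[OF d_small])
  from tendsto_power[OF this, of 2] show ?thesis by (simp add: power_divide)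
qed

lemma eventually_good: "\<forall>\<^sub>F n in sequentially. good n"
proof -
  have 1: "\<forall>\<^sub>F n in sequentially. n \<ge> 1" by (rule eventually_ge_at_top)
  have 2: "\<forall>\<^sub>F n in sequentially. real (d n) ^ 2 / real n < 1 / 8"
    by (rule order_tendstoD(2)[OF d2_lim]) simp
  have 3: "\<forall>\<^sub>F n in sequentially. 0 < a n" by (rule order_tendstoD(1)[OF a_lim]) simp
  have 4: "\<forall>\<^sub>F n in sequentially. a n < 3" by (rule order_tendstoD(2)[OF a_lim]) simp
  have 5: "\<forall>\<^sub>F n in sequentially. c / 2 < real (dimn n) / real (m (dimn n))"
    unfolding dimn_def by (rule order_tendstoD(1)[OF aspect]) (use c_pos in simp)
  show ?thesis using 1 2 3 4 5
  proof eventually_elim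
    case (elim n)
    have "real (8 * d n ^ 2) \<le> real n" using elim(1,2) by (simp add: field_simps)
    then have "8 * d n ^ 2 \<le> n" by (simp only: of_nat_le_iff)
    moreover have "m (dimn n) > 0" using elim(5) c_pos by (cases "m (dimn n) = 0") auto
    ultimately show ?case using elim by (simp add: good_def)
  qed
qed

lemma tensor_moments_of_good: assumes g: "good n" shows "tensor_moments (N n) n (X n) (d n) (a n) (L n)"
proof -
  have n: "n \<ge> 1" using g by (simp add: good_def)
  interpret sym_vector "N n" n "X n" by (rule sym_vector_X[OF n])
  have d1: "1 \<le> d n" by (rule d_pos[OF n])
  show ?thesis
  proof unfold_locales
    show "1 \<le> d n" "8 * (d n)\<^sup>2 \<le> n" "0 \<le> a n" "0 \<le> L n"
      using g d1 L_nonneg by (auto simp: good_def)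
    \<comment> \<open>A Bochner integral different from 0 forces integrability, as the default value
      is 0.\<close>
    have int1: "integrable (N n) (\<lambda>\<omega>. (X n 1 \<omega>)\<^sup>2)"
      using i[OF n] by (metis not_integrable_integral_eq zero_neq_one)
    show "E (\<lambda>\<omega>. sq (X n 1 \<omega>)) = 1"
      unfolding sq_def using nn_eq_lebesgue[OF int1] i[OF n] by simp
    have nn: "0 < real n ^ (4 * d n)" using n by simp
    \<comment> \<open>The same argument for the norm; \<open>good\<close> contains
      \<open>0 < a n\<close> for its sake.\<close>
    have ne: "(\<integral>\<omega>. lnorm 2 n (\<lambda>i. X n i \<omega>) ^ (8 * d n) \<partial>N n) \<noteq> 0"
      using g by (auto simp: good_def a_def)
    have eq: "(\<integral>\<omega>. Sr \<omega> ^ (4 * d n) \<partial>N n) = a n * real n ^ (4 * d n)"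
      using nn by (simp add: a_def lnorm2_power)
    have "integrable (N n) (\<lambda>\<omega>. Sr \<omega> ^ (4 * d n))"
      using ne unfolding lnorm2_power by (metis not_integrable_integral_eq)
    from nn_eq_lebesgue[OF this]
    show "E (\<lambda>\<omega>. S \<omega> ^ (4 * d n)) = ennreal (a n * real n ^ (4 * d n))"
      by (simp add: eq S_eq_Sr ennreal_power Sr_nonneg)
    show "E (\<lambda>\<omega>. (T \<omega>)\<^sup>2) \<le> ennreal ((real n)\<^sup>2 * (L n)\<^sup>2)"
      using L_bound
    proof
      assume A: "\<forall>n\<ge>1. \<forall>r. 1 \<le> r \<and> r \<le> d n \<and> r \<le> n \<longrightarrow>
             integrable (N n) (\<lambda>\<omega>. \<Prod>j=1..r. X n j \<omega> ^ 8) \<and>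
             (\<integral>\<omega>. (\<Prod>j=1..r. X n j \<omega> ^ 8) \<partial>N n) \<le> L n ^ (2 * r)"
      have "integrable (N n) (\<lambda>\<omega>. \<Prod>j=1..1. X n j \<omega> ^ 8)"
        "(\<integral>\<omega>. (\<Prod>j=1..1. X n j \<omega> ^ 8) \<partial>N n) \<le> L n ^ (2 * 1)"
        using A[rule_format, of n 1] n d1 by blast+
      from E_prod_eighth[OF this] show ?thesis by (intro E_T_square) auto
    next
      assume B: "\<forall>n\<ge>1. \<forall>r. 1 \<le> r \<and> r \<le> d n \<longrightarrow>
             integrable (N n) (\<lambda>\<omega>. lnorm 4 n (\<lambda>i. X n i \<omega>) ^ (8 * r)) \<and>
             1 / real n ^ (2 * r) * (\<integral>\<omega>. lnorm 4 n (\<lambda>i. X n i \<omega>) ^ (8 * r) \<partial>N n)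
               \<le> L n ^ (2 * r)"
      have "integrable (N n) (\<lambda>\<omega>. lnorm 4 n (\<lambda>i. X n i \<omega>) ^ (8 * 1))"
        "1 / real n ^ (2 * 1) * (\<integral>\<omega>. lnorm 4 n (\<lambda>i. X n i \<omega>) ^ (8 * 1) \<partial>N n) \<le> L n ^ (2 * 1)"
        using B[rule_format, of n 1] n d1 by blast+
      from E_T_power[OF this] show ?thesis using n by simp
    qed
  qed
qed

abbreviation "U n k \<equiv> tensor_moments.u (N n) n (X n) k"
abbreviation "B n k \<equiv> tensor_moments.b (N n) (X n) k"
abbreviation "K n \<equiv> tensor_moments.\<kappa> (N n) n (X n) (d n)"

definition err_seq :: "nat \<Rightarrow> real" where "err_seq n = 4 * real (d n) ^ 2 / real n"

lemma err_seq_lim: "err_seq \<longlonglongrightarrow> 0"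
  using tendsto_mult_right_zero[OF d2_lim, of 4] by (simp add: err_seq_def[abs_def])

definition \<delta> :: "nat \<Rightarrow> real" where "\<delta> n = 4 * real (d n) ^ 2 * L n / real n * sqrt (1 + a n)"

lemma \<delta>_lim: "\<delta> \<longlonglongrightarrow> 0"
proof -
  have "(\<lambda>n. 4 * (L n * real (d n) ^ 2 / real n) * sqrt (1 + a n)) \<longlonglongrightarrow> 4 * 0 * sqrt (1 + 1)"
    by (intro tendsto_intros L_lim a_lim)
  then show ?thesis by (simp add: \<delta>_def[abs_def] mult_ac)
qed

text \<open>Squeezed between 1, from the tangent at 1, and \<open>sqrt (a n)\<close>, from
  Cauchy--Schwarz.\<close>

lemma U2_lim: "(\<lambda>n. U n (2 * d n)) \<longlonglongrightarrow> 1"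
proof (rule tendsto_sandwich)
  show "\<forall>\<^sub>F n in sequentially. 1 \<le> U n (2 * d n)"
    using eventually_good by eventually_elim (rule tensor_moments.u_ge_1[OF tensor_moments_of_good], auto)
  show "\<forall>\<^sub>F n in sequentially. U n (2 * d n) \<le> sqrt (a n)"
    using eventually_good
  proof eventually_elim
    case (elim n)
    interpret tensor_moments "N n" n "X n" "d n" "a n" "L n" by (rule tensor_moments_of_good[OF elim])
    have "(u (2 * d n))\<^sup>2 \<le> a n" using u_square_le[of "2 * d n"] u_4d by simp
    then show ?case by (rule real_le_rsqrt)
  qed
  show "(\<lambda>n. sqrt (a n)) \<longlonglongrightarrow> 1" using tendsto_real_sqrt[OF a_lim] by simp
qed simp

lemma U1_lim: "(\<lambda>n. U n (d n)) \<longlonglongrightarrow> 1"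
proof (rule tendsto_sandwich)
  show "\<forall>\<^sub>F n in sequentially. 1 \<le> U n (d n)"
    using eventually_good by eventually_elim (rule tensor_moments.u_ge_1[OF tensor_moments_of_good], auto)
  show "\<forall>\<^sub>F n in sequentially. U n (d n) \<le> sqrt (U n (2 * d n))"
    using eventually_good
  proof eventually_elim
    case (elim n)
    interpret tensor_moments "N n" n "X n" "d n" "a n" "L n" by (rule tensor_moments_of_good[OF elim])
    show ?case using u_square_le[of "d n"] by (intro real_le_rsqrt) simp
  qed
  show "(\<lambda>n. sqrt (U n (2 * d n))) \<longlonglongrightarrow> 1" using tendsto_real_sqrt[OF U2_lim] by simp
qed simp

text \<open>The upper bound drops the repeated indices, the lower bound estimates them.\<close>

lemma B_lim:
  assumes U: "(\<lambda>n. U n (k n)) \<longlonglongrightarrow> 1" and k: "\<And>n. k n \<le> 2 * d n"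
  shows "(\<lambda>n. B n (k n)) \<longlonglongrightarrow> 1"
proof (rule tendsto_sandwich)
  have bounds: "U n (k n) - \<delta> n \<le> B n (k n)" "B n (k n) \<le> U n (k n) / (1 - err_seq n)" if g: "good n" for n
  proof -
    interpret tensor_moments "N n" n "X n" "d n" "a n" "L n" by (rule tensor_moments_of_good[OF g])
    let ?f = "real (ff (k n)) / real n ^ k n"
    have f: "1 - err_seq n \<le> ?f" "?f \<le> 1"
      using ff_bounds[OF k] nr_pos by (auto simp: err_seq_def field_simps)
    have e: "1 - err_seq n > 0" using half_le by (simp add: err_seq_def)
    have "?f * b (k n) \<le> 1 * b (k n)" using f b_nonneg by (intro mult_right_mono) auto
    then show "U n (k n) - \<delta> n \<le> B n (k n)"
      using b_lower[OF k] by (simp add: \<delta>_def)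
    have "(1 - err_seq n) * b (k n) \<le> ?f * b (k n)" using f b_nonneg by (intro mult_right_mono) auto
    also have "\<dots> \<le> u (k n)" by (rule b_upper[OF k])
    finally show "B n (k n) \<le> U n (k n) / (1 - err_seq n)" using e by (simp add: field_simps)
  qed
  show "\<forall>\<^sub>F n in sequentially. U n (k n) - \<delta> n \<le> B n (k n)"
    using eventually_good by eventually_elim (rule bounds)
  show "\<forall>\<^sub>F n in sequentially. B n (k n) \<le> U n (k n) / (1 - err_seq n)"
    using eventually_good by eventually_elim (rule bounds)
  show "(\<lambda>n. U n (k n) - \<delta> n) \<longlonglongrightarrow> 1" using tendsto_diff[OF U \<delta>_lim] by simp
  have "(\<lambda>n. U n (k n) / (1 - err_seq n)) \<longlonglongrightarrow> 1 / (1 - 0)"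
    by (intro tendsto_intros U err_seq_lim) simp
  then show "(\<lambda>n. U n (k n) / (1 - err_seq n)) \<longlonglongrightarrow> 1" by simp
qed

lemma B1_lim: "(\<lambda>n. B n (d n)) \<longlonglongrightarrow> 1"
  by (rule B_lim[OF U1_lim]) simp

lemma B2_lim: "(\<lambda>n. B n (2 * d n)) \<longlonglongrightarrow> 1"
  by (rule B_lim[OF U2_lim]) simp

lemma dn_lim: "(\<lambda>n. real (d n) / real n) \<longlonglongrightarrow> 0"
proof (rule tendsto_sandwich[OF _ _ tendsto_const d2_lim])
  show "\<forall>\<^sub>F n in sequentially. real (d n) / real n \<le> real (d n) ^ 2 / real n"
    using eventually_good
  proof eventually_elim
    case (elim n)
    then have "real (d n) \<ge> 1" using d_pos by (simp add: good_def)
    then show ?case by (intro divide_right_mono) (auto simp: power2_eq_square)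
  qed
qed simp

text \<open>The leading terms cancel, as \<open>1 - 1\<close> and as
  \<open>1 - 2 + 1\<close>.\<close>

lemma K_lim: "K \<longlonglongrightarrow> 0"
proof (rule Lim_transform_eventually)
  show "\<forall>\<^sub>F n in sequentially. U n (2 * d n) / (1 - err_seq n)\<^sup>2 - (1 - err_seq n) * B n (2 * d n)
      + \<bar>B n (2 * d n) - 2 * B n (d n) + 1\<bar> + err_seq n + 16 * U n (2 * d n) * (real (d n) / real n) = K n"
    using eventually_good
  proof eventually_elim
    case (elim n)
    interpret tensor_moments "N n" n "X n" "d n" "a n" "L n" by (rule tensor_moments_of_good[OF elim])
    show ?case by (simp add: \<kappa>_def err_def err_seq_def)
  qed
  have "(\<lambda>n. U n (2 * d n) / (1 - err_seq n)\<^sup>2 - (1 - err_seq n) * B n (2 * d n)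
      + \<bar>B n (2 * d n) - 2 * B n (d n) + 1\<bar> + err_seq n + 16 * U n (2 * d n) * (real (d n) / real n))
    \<longlonglongrightarrow> 1 / (1 - 0)\<^sup>2 - (1 - 0) * 1 + \<bar>1 - 2 * 1 + 1\<bar> + 0 + 16 * 1 * 0"
    by (intro tendsto_intros U2_lim B1_lim B2_lim err_seq_lim dn_lim) simp
  then show "(\<lambda>n. U n (2 * d n) / (1 - err_seq n)\<^sup>2 - (1 - err_seq n) * B n (2 * d n)
      + \<bar>B n (2 * d n) - 2 * B n (d n) + 1\<bar> + err_seq n + 16 * U n (2 * d n) * (real (d n) / real n)) \<longlonglongrightarrow> 0"
    by simp
qed

lemma integral_prod_eq_B:
  assumes g: "good n" and k: "k \<le> 2 * d n"
  shows "(\<integral>\<omega>. (\<Prod>j=1..k. (X n j \<omega>)\<^sup>2) \<partial>N n) = B n k"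
proof -
  interpret tensor_moments "N n" n "X n" "d n" "a n" "L n" by (rule tensor_moments_of_good[OF g])
  have "(\<lambda>\<omega>. \<Prod>j=1..k. (X n j \<omega>)\<^sup>2) \<in> borel_measurable (N n)"
    using k d2_le_n by (intro borel_measurable_prod borel_measurable_power X_meas) auto
  then have "(\<integral>\<omega>. (\<Prod>j=1..k. (X n j \<omega>)\<^sup>2) \<partial>N n) = enn2real (E (\<lambda>\<omega>. ennreal (\<Prod>j=1..k. (X n j \<omega>)\<^sup>2)))"
    by (intro integral_eq_nn_integral) (auto intro!: prod_nonneg)
  then show ?thesis by (simp add: b_def mom_def sq_def prod_ennreal)
qed

lemma moment_conclusions:
  "(\<lambda>n. \<integral>\<omega>. (\<Prod>j=1..d n. (X n j \<omega>)\<^sup>2) \<partial>N n) \<longlonglongrightarrow> 1"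
  "(\<lambda>n. (\<integral>\<omega>. (\<Prod>j=1..2 * d n. (X n j \<omega>)\<^sup>2) \<partial>N n)
      - (\<integral>\<omega>. (\<Prod>j=1..d n. (X n j \<omega>)\<^sup>2) \<partial>N n)\<^sup>2) \<longlonglongrightarrow> 0"
proof -
  have e1: "\<forall>\<^sub>F n in sequentially. B n (d n) = (\<integral>\<omega>. (\<Prod>j=1..d n. (X n j \<omega>)\<^sup>2) \<partial>N n)"
    using eventually_good by eventually_elim (rule integral_prod_eq_B[symmetric], auto)
  have e2: "\<forall>\<^sub>F n in sequentially. B n (2 * d n) = (\<integral>\<omega>. (\<Prod>j=1..2 * d n. (X n j \<omega>)\<^sup>2) \<partial>N n)"
    using eventually_good by eventually_elim (rule integral_prod_eq_B[symmetric], auto)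
  show 1: "(\<lambda>n. \<integral>\<omega>. (\<Prod>j=1..d n. (X n j \<omega>)\<^sup>2) \<partial>N n) \<longlonglongrightarrow> 1"
    by (rule Lim_transform_eventually[OF B1_lim e1])
  have 2: "(\<lambda>n. \<integral>\<omega>. (\<Prod>j=1..2 * d n. (X n j \<omega>)\<^sup>2) \<partial>N n) \<longlonglongrightarrow> 1"
    by (rule Lim_transform_eventually[OF B2_lim e2])
  from tendsto_diff[OF 2 tendsto_power[OF 1, of 2]]
  show "(\<lambda>n. (\<integral>\<omega>. (\<Prod>j=1..2 * d n. (X n j \<omega>)\<^sup>2) \<partial>N n)
      - (\<integral>\<omega>. (\<Prod>j=1..d n. (X n j \<omega>)\<^sup>2) \<partial>N n)\<^sup>2) \<longlonglongrightarrow> 0" by simp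
qed

lemma mixed_conclusion:
  "\<forall>\<^sub>F n in sequentially. \<forall>r. 1 \<le> r \<and> r \<le> d n \<longrightarrow>
    integrable (N n) (\<lambda>\<omega>. (\<Prod>j=1..r. X n j \<omega> ^ 4) * (\<Prod>j=r+1..2 * d n - r. (X n j \<omega>)\<^sup>2)) \<and>
    (\<integral>\<omega>. (\<Prod>j=1..r. X n j \<omega> ^ 4) * (\<Prod>j=r+1..2 * d n - r. (X n j \<omega>)\<^sup>2) \<partial>N n) \<le> (8 * L n) ^ r"
  using eventually_good
proof eventually_elim
  case (elim n)
  interpret tensor_moments "N n" n "X n" "d n" "a n" "L n" by (rule tensor_moments_of_good[OF elim])
  show ?case
  proof (intro allI impI)
    fix r assume r: "1 \<le> r \<and> r \<le> d n"
    let ?f = "\<lambda>\<omega>. (\<Prod>j=1..r. X n j \<omega> ^ 4) * (\<Prod>j=r+1..2 * d n - r. (X n j \<omega>)\<^sup>2)"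
    have f0: "?f \<omega> \<ge> 0" for \<omega> by (intro mult_nonneg_nonneg prod_nonneg) auto
    have fm: "?f \<in> borel_measurable (N n)"
      using r d2_le_n
      by (intro borel_measurable_times borel_measurable_prod borel_measurable_power X_meas) auto
    have e: "ennreal (?f \<omega>) = (\<Prod>j=1..r. sq (X n j \<omega>) ^ 2) * (\<Prod>j=Suc r..2 * d n - r. sq (X n j \<omega>))" for \<omega>
    proof -
      have "ennreal (?f \<omega>) = ennreal (\<Prod>j=1..r. X n j \<omega> ^ 4) * ennreal (\<Prod>j=r+1..2 * d n - r. (X n j \<omega>)\<^sup>2)"
        by (intro ennreal_mult prod_nonneg) auto
      also have "ennreal (\<Prod>j=1..r. X n j \<omega> ^ 4) = (\<Prod>j=1..r. sq (X n j \<omega>) ^ 2)"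
        by (simp add: sq_def ennreal_power power_mult[symmetric] prod_ennreal)
      also have "ennreal (\<Prod>j=r+1..2 * d n - r. (X n j \<omega>)\<^sup>2) = (\<Prod>j=Suc r..2 * d n - r. sq (X n j \<omega>))"
        by (simp add: sq_def prod_ennreal)
      finally show ?thesis .
    qed
    have n1: "n \<ge> 1" and rn: "r \<le> n" using r d2_le_n elim by (auto simp: good_def)
    have "mixed r \<le> ennreal (4 * sqrt (1 + a n) * L n ^ r)"
      using L_bound
    proof
      assume A: "\<forall>n\<ge>1. \<forall>r. 1 \<le> r \<and> r \<le> d n \<and> r \<le> n \<longrightarrow>
             integrable (N n) (\<lambda>\<omega>. \<Prod>j=1..r. X n j \<omega> ^ 8) \<and>
             (\<integral>\<omega>. (\<Prod>j=1..r. X n j \<omega> ^ 8) \<partial>N n) \<le> L n ^ (2 * r)"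
      have "integrable (N n) (\<lambda>\<omega>. \<Prod>j=1..r. X n j \<omega> ^ 8)"
        "(\<integral>\<omega>. (\<Prod>j=1..r. X n j \<omega> ^ 8) \<partial>N n) \<le> L n ^ (2 * r)"
        using A[rule_format, of n r] r n1 rn by blast+
      then show ?thesis using r by (intro mixed_le_of_eighth_moments E_prod_eighth) auto
    next
      assume A: "\<forall>n\<ge>1. \<forall>r. 1 \<le> r \<and> r \<le> d n \<longrightarrow>
             integrable (N n) (\<lambda>\<omega>. lnorm 4 n (\<lambda>i. X n i \<omega>) ^ (8 * r)) \<and>
             1 / real n ^ (2 * r) * (\<integral>\<omega>. lnorm 4 n (\<lambda>i. X n i \<omega>) ^ (8 * r) \<partial>N n)
               \<le> L n ^ (2 * r)"
      have "integrable (N n) (\<lambda>\<omega>. lnorm 4 n (\<lambda>i. X n i \<omega>) ^ (8 * r))"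
        "1 / real n ^ (2 * r) * (\<integral>\<omega>. lnorm 4 n (\<lambda>i. X n i \<omega>) ^ (8 * r) \<partial>N n) \<le> L n ^ (2 * r)"
        using A[rule_format, of n r] r n1 by blast+
      then show ?thesis using r n1 by (intro mixed_le_of_norm_moments E_T_power) auto
    qed
    also have "\<dots> \<le> ennreal ((8 * L n) ^ r)"
    proof (rule ennreal_leI)
      \<comment> \<open>\<open>a n <= 3\<close> gives
        \<open>4 * sqrt (1 + a n) <= 8 <= 8 ^ r\<close> as \<open>r >= 1\<close>; this is the origin
        of the sequence \<open>8 * L n\<close>.\<close>
      have "sqrt (1 + a n) \<le> 2" using elim by (intro real_le_lsqrt) (auto simp: good_def)
      then have "4 * sqrt (1 + a n) * L n ^ r \<le> 8 * L n ^ r"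
        using L_nonneg by (intro mult_right_mono) auto
      also have "\<dots> \<le> 8 ^ r * L n ^ r"
        using r L_nonneg power_increasing[of 1 r "8::real"] by (intro mult_right_mono) auto
      finally show "4 * sqrt (1 + a n) * L n ^ r \<le> (8 * L n) ^ r" by (simp add: power_mult_distrib)
    qed
    finally have le: "E (\<lambda>\<omega>. ennreal (?f \<omega>)) \<le> ennreal ((8 * L n) ^ r)"
      unfolding mixed_def e .
    have int: "integrable (N n) ?f"
      using le f0 by (intro integrableI_nonneg[OF fm]) (auto intro: le_less_trans)
    have "ennreal (\<integral>\<omega>. ?f \<omega> \<partial>N n) \<le> ennreal ((8 * L n) ^ r)"
      using le nn_eq_lebesgue[OF int f0] by simp
    then have "(\<integral>\<omega>. ?f \<omega> \<partial>N n) \<le> (8 * L n) ^ r"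
      using L_nonneg by (simp add: ennreal_le_iff)
    with int show "integrable (N n) ?f \<and> (\<integral>\<omega>. ?f \<omega> \<partial>N n) \<le> (8 * L n) ^ r" by simp
  qed
qed

section \<open>Almost sure convergence of the Stieltjes transforms\<close>

definition stieltjes :: "real \<Rightarrow> nat \<Rightarrow> 'a \<Rightarrow> real" where
  "stieltjes t n \<omega> = trace_on (dsubsets n (d n))
     (resolvent (dsubsets n (d n)) (1 / real (m (dimn n))) t (map (\<lambda>k. x n k \<omega>) [1..<Suc (m (dimn n))])) / real (dimn n)"

lemma dimn_ge: "good n \<Longrightarrow> dimn n \<ge> n"
proof -
  assume g: "good n"
  then have n: "n \<ge> 1" by (simp add: good_def)
  interpret tensor_moments "N n" n "X n" "d n" "a n" "L n" by (rule tensor_moments_of_good[OF g])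
  show "dimn n \<ge> n" unfolding dimn_def using d_pos d2_le_n n by (intro binomial_ge_self) auto
qed

lemma iid_vectors_of_good: assumes g: "good n" and t: "t > 0"
  shows "iid_vectors (PrincipalT (N n) n (d n) (X n)) (dsubsets n (d n)) (m (dimn n)) t"
proof -
  have n: "n \<ge> 1" using g by (simp add: good_def)
  interpret sym_vector "N n" n "X n" by (rule sym_vector_X[OF n])
  have "card (dsubsets n (d n)) > 0"
    using dimn_ge[OF g] n by (simp add: card_dsubsets dimn_def[symmetric])
  then have "finite (dsubsets n (d n))" "dsubsets n (d n) \<noteq> {}" by (auto simp: card_gt_0_iff)
  then show ?thesis
    using g t by (intro iid_vectors.intro iid_vectors_axioms.intro tensor_law_prob tensor_law_sets)
      (auto simp: good_def)
qed

abbreviation "law n \<equiv> Pi\<^sub>M (iid_vectors.J (m (dimn n))) (\<lambda>_. PrincipalT (N n) n (d n) (X n))"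

definition mean :: "real \<Rightarrow> nat \<Rightarrow> real" where
  "mean t n = (\<integral>y. iid_vectors.st (dsubsets n (d n)) (m (dimn n)) t y \<partial>law n)"

lemma stieltjes_eq_st:
  assumes g: "good n" and t: "t > 0"
  shows "stieltjes t n \<omega> = iid_vectors.st (dsubsets n (d n)) (m (dimn n)) t (\<lambda>k. x n k \<omega>)"
proof -
  interpret iid_vectors "PrincipalT (N n) n (d n) (X n)" "dsubsets n (d n)" "m (dimn n)" t
    by (rule iid_vectors_of_good[OF g t])
  show ?thesis
    unfolding stieltjes_def st_def idx_def w_def p_def
    by (simp add: card_dsubsets dimn_def)
qed

lemma stieltjes_meas:
  assumes g: "good n" and t: "t > 0"
  shows "stieltjes t n \<in> borel_measurable M"
proof -
  have n: "n \<ge> 1" using g by (simp add: good_def)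
  interpret iid_vectors "PrincipalT (N n) n (d n) (X n)" "dsubsets n (d n)" "m (dimn n)" t
    by (rule iid_vectors_of_good[OF g t])
  show ?thesis
    unfolding stieltjes_eq_st[OF g t, abs_def]
    using st_sample(1)[OF M_prob, of "x n"] x_indep[OF n] x_law[OF n]
    by (simp add: dimn_def)
qed

text \<open>\<open>p (p / m) >= n c / 2\<close> by \<open>dimn_ge\<close> and \<open>good\<close>,
  so the tail is geometric in \<open>n\<close>.\<close>

lemma stieltjes_tail:
  assumes g: "good n" and t: "t > 0" and \<epsilon>: "\<epsilon> > 0"
  shows "measure M {\<omega> \<in> space M. \<bar>stieltjes t n \<omega> - mean t n\<bar> \<ge> \<epsilon>} \<le> 2 * exp (- (\<epsilon>\<^sup>2 * t\<^sup>2 * c / 4)) ^ n"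
proof -
  have n: "n \<ge> 1" using g by (simp add: good_def)
  interpret iid_vectors "PrincipalT (N n) n (d n) (X n)" "dsubsets n (d n)" "m (dimn n)" t
    by (rule iid_vectors_of_good[OF g t])
  let ?p = "real (dimn n)"
  let ?m = "real (m (dimn n))"
  have pe: "iid_vectors.p (dsubsets n (d n)) = ?p"
    by (simp add: p_def card_dsubsets dimn_def)
  have "measure M {\<omega> \<in> space M. \<bar>stieltjes t n \<omega> - mean t n\<bar> \<ge> \<epsilon>}
      = measure \<Omega> {y \<in> space \<Omega>. \<bar>st y - mean t n\<bar> \<ge> \<epsilon>}"
    unfolding stieltjes_eq_st[OF g t]
    using x_indep[OF n] x_law[OF n]
    by (intro st_sample(2)[OF M_prob]) (simp_all add: dimn_def)
  also have "\<dots> \<le> 2 * exp (- (\<epsilon>\<^sup>2 * t\<^sup>2 * ?p * (?p / ?m) / 2))"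
    using st_concentration[OF \<epsilon>] unfolding pe mean_def .
  also have "\<dots> \<le> 2 * exp (- (\<epsilon>\<^sup>2 * t\<^sup>2 * c / 4) * real n)"
  proof -
    have "real n * (c / 2) \<le> ?p * (?p / ?m)"
      using dimn_ge[OF g] g c_pos by (intro mult_mono) (auto simp: good_def)
    then have "\<epsilon>\<^sup>2 * t\<^sup>2 * (real n * (c / 2)) \<le> \<epsilon>\<^sup>2 * t\<^sup>2 * (?p * (?p / ?m))"
      by (intro mult_left_mono) auto
    then show ?thesis by (simp add: mult_ac)
  qed
  also have "\<dots> = 2 * exp (- (\<epsilon>\<^sup>2 * t\<^sup>2 * c / 4)) ^ n"
    by (simp add: exp_of_nat_mult[symmetric] mult_ac)
  finally show ?thesis .
qed

lemma mean_lim: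
  assumes t: "t > 0" and s0: "s0 \<ge> 0" "t * s0 + s0 / (1 + c * s0) = 1"
  shows "mean t \<longlonglongrightarrow> s0"
proof -
  \<comment> \<open>\<open>v n\<close> is the standard deviation bound relative to the dimension.
    The absolute value and the summand \<open>1 / n\<close> make it positive, as
    \<open>mean_distance_to_root\<close> requires.\<close>
  define v where "v = (\<lambda>n. sqrt (2 * (1 / t)\<^sup>2 * (\<bar>K n\<bar> + 1 / real n)))"
  define bd where "bd = (\<lambda>n. (v n + 1 / (t * real n) + \<bar>real (dimn n) / real (m (dimn n)) - c\<bar> / t\<^sup>2) / t)"
  have bound: "\<bar>mean t n - s0\<bar> \<le> bd n" if g: "good n" for n
  proof -
    have n: "n \<ge> 1" using g by (simp add: good_def)
    interpret tm: tensor_moments "N n" n "X n" "d n" "a n" "L n" by (rule tensor_moments_of_good[OF g])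
    interpret iid_vectors "PrincipalT (N n) n (d n) (X n)" "dsubsets n (d n)" "m (dimn n)" t
      by (rule iid_vectors_of_good[OF g t])
    let ?p = "real (dimn n)"
    have pe: "iid_vectors.p (dsubsets n (d n)) = ?p"
      by (simp add: p_def card_dsubsets dimn_def)
    have p0: "?p > 0" using dimn_ge[OF g] n by simp
    have q0: "2 * (1 / t)\<^sup>2 * (\<bar>K n\<bar> + 1 / real n) > 0" using t n by (auto intro!: mult_pos_pos add_nonneg_pos)
    have v0: "v n > 0" unfolding v_def using q0 by simp
    have "\<bar>(\<integral>y. st y \<partial>\<Omega>) - s0\<bar> \<le> (?p * v n / iid_vectors.p (dsubsets n (d n))
        + 1 / (t * iid_vectors.p (dsubsets n (d n)))
        + \<bar>iid_vectors.p (dsubsets n (d n)) / real (m (dimn n)) - c\<bar> / t\<^sup>2) / t"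
    proof (rule mean_distance_to_root[OF _ c_pos s0])
      show "?p * v n > 0" using p0 v0 by simp
      fix A :: "nat set \<Rightarrow> nat set \<Rightarrow> real"
      assume A: "\<And>i. i \<in> dsubsets n (d n) \<Longrightarrow> 0 \<le> A i i" "\<And>i. i \<in> dsubsets n (d n) \<Longrightarrow> A i i \<le> 1 / t"
        "\<And>i. i \<in> dsubsets n (d n) \<Longrightarrow> (\<Sum>j\<in>dsubsets n (d n). (A i j)\<^sup>2) \<le> (1 / t)\<^sup>2"
      let ?I = "dsubsets n (d n)"
      let ?D = "\<lambda>x. ennreal ((quad ?I A x - trace_on ?I A)\<^sup>2)"
      have Dm: "?D \<in> borel_measurable (tensor_space n (d n))"
        unfolding quad_def dot_def app_def
        by (intro measurable_compose[OF _ measurable_ennreal] borel_measurable_power borel_measurable_diff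
          borel_measurable_sum borel_measurable_times borel_measurable_const measurable_component_singleton)
      have r: "quad ?I A (\<lambda>i\<in>?I. z i) = quad ?I A z" for z
        by (simp add: quad_def dot_def app_def)
      have "(\<integral>\<^sup>+x. ?D x \<partial>PrincipalT (N n) n (d n) (X n)) = (\<integral>\<^sup>+\<omega>. ?D (\<lambda>i. tm.tens i \<omega>) \<partial>N n)"
        unfolding tm.tensor_law_nn_integral[OF Dm] r ..
      also have "\<dots> \<le> ennreal (2 * (1 / t)\<^sup>2 * (real (n choose d n))\<^sup>2 * K n)"
        by (rule tm.quad_form_relative_variance[OF A])
      also have "\<dots> \<le> ennreal ((?p * v n)\<^sup>2)"
      proof (rule ennreal_leI)
        have "2 * (1 / t)\<^sup>2 * (real (n choose d n))\<^sup>2 * K n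
            \<le> 2 * (1 / t)\<^sup>2 * (real (n choose d n))\<^sup>2 * (\<bar>K n\<bar> + 1 / real n)"
          by (intro mult_left_mono) (auto simp: add_increasing2)
        also have "\<dots> = (?p * v n)\<^sup>2"
          using q0 by (simp add: v_def power_mult_distrib dimn_def del: power_divide)
        finally show "2 * (1 / t)\<^sup>2 * (real (n choose d n))\<^sup>2 * K n \<le> (?p * v n)\<^sup>2" .
      qed
      finally show "(\<integral>\<^sup>+x. ?D x \<partial>PrincipalT (N n) n (d n) (X n)) \<le> ennreal ((?p * v n)\<^sup>2)" .
    qed
    also have "\<dots> \<le> bd n"
      unfolding bd_def pe
    proof (intro divide_right_mono add_mono)
      show "?p * v n / ?p \<le> v n" using p0 by simp
      show "1 / (t * ?p) \<le> 1 / (t * real n)"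
        using dimn_ge[OF g] n t by (intro divide_left_mono mult_left_mono) auto
    qed (use t in auto)
    finally show ?thesis by (simp add: mean_def)
  qed
  have "(\<lambda>n. 1 / real n) \<longlonglongrightarrow> 0" by (rule lim_1_over_n)
  then have "v \<longlonglongrightarrow> sqrt (2 * (1 / t)\<^sup>2 * (\<bar>0\<bar> + 0))"
    unfolding v_def by (intro tendsto_intros K_lim)
  then have vl: "v \<longlonglongrightarrow> 0" by simp
  have "(\<lambda>n. 1 / t * (1 / real n)) \<longlonglongrightarrow> 1 / t * 0"
    by (intro tendsto_intros lim_1_over_n)
  then have tl: "(\<lambda>n. 1 / (t * real n)) \<longlonglongrightarrow> 0" by simp
  have "(\<lambda>n. \<bar>real (dimn n) / real (m (dimn n)) - c\<bar> / t\<^sup>2) \<longlonglongrightarrow> \<bar>c - c\<bar> / t\<^sup>2"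
    unfolding dimn_def using t by (intro tendsto_intros aspect) auto
  then have al: "(\<lambda>n. \<bar>real (dimn n) / real (m (dimn n)) - c\<bar> / t\<^sup>2) \<longlonglongrightarrow> 0" by simp
  have "bd \<longlonglongrightarrow> (0 + 0 + 0) / t"
    unfolding bd_def using t by (intro tendsto_intros vl tl al) auto
  then have bl: "bd \<longlonglongrightarrow> 0" by simp
  have "\<forall>\<^sub>F n in sequentially. norm (mean t n - s0) \<le> bd n"
    using eventually_good by eventually_elim (use bound in simp)
  then have "(\<lambda>n. mean t n - s0) \<longlonglongrightarrow> 0"
    by (rule Lim_null_comparison[OF _ bl])
  then show ?thesis by (simp add: LIM_zero_iff)
qed

lemma stieltjes_AE_lim:
  assumes t: "t > 0" and s0: "s0 \<ge> 0" "t * s0 + s0 / (1 + c * s0) = 1"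
  shows "AE \<omega> in M. (\<lambda>n. stieltjes t n \<omega>) \<longlonglongrightarrow> s0"
proof -
  interpret M: prob_space M by (rule M_prob)
  \<comment> \<open>At the \<open>n\<close> that are not good, \<open>F\<close> and \<open>e\<close>
    take the limit itself, so that \<open>F n\<close> is measurable for every
    \<open>n\<close>.\<close>
  define F where "F = (\<lambda>n \<omega>. if good n then stieltjes t n \<omega> else s0)"
  define e where "e = (\<lambda>n. if good n then mean t n else s0)"
  have "AE \<omega> in M. (\<lambda>n. F n \<omega>) \<longlonglongrightarrow> s0"
  proof (rule M.AE_tendsto_of_summable_tails)
    show "F n \<in> borel_measurable M" for n
      using stieltjes_meas[OF _ t, of n] by (cases "good n") (simp_all add: F_def[abs_def])
    show "e \<longlonglongrightarrow> s0"
      by (rule Lim_transform_eventually[OF mean_lim[OF t s0]])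
        (use eventually_good in \<open>auto simp: e_def elim: eventually_mono\<close>)
    fix \<epsilon> :: real assume \<epsilon>: "\<epsilon> > 0"
    let ?q = "exp (- (\<epsilon>\<^sup>2 * t\<^sup>2 * c / 4))"
    have q: "?q < 1" using \<epsilon> t c_pos by simp
    show "summable (\<lambda>n. M.prob {\<omega> \<in> space M. \<bar>F n \<omega> - e n\<bar> \<ge> \<epsilon>})"
    proof (rule summable_comparison_test_ev)
      show "\<forall>\<^sub>F n in sequentially. norm (M.prob {\<omega> \<in> space M. \<bar>F n \<omega> - e n\<bar> \<ge> \<epsilon>}) \<le> 2 * ?q ^ n"
        using eventually_good by eventually_elim (use stieltjes_tail[OF _ t \<epsilon>] in \<open>simp add: F_def e_def\<close>)
      show "summable (\<lambda>n. 2 * ?q ^ n)"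
        using q by (intro summable_mult summable_geometric) simp
    qed
  qed
  then show ?thesis
  proof eventually_elim
    case (elim \<omega>)
    show ?case
      by (rule Lim_transform_eventually[OF elim])
        (use eventually_good in \<open>auto simp: F_def elim: eventually_mono\<close>)
  qed
qed

lemma ESD_AE_weak_conv:
  "AE \<omega> in M. weak_conv_m
     (\<lambda>n. ESD (sample_cov n (d n) (m (n choose d n)) (\<lambda>k. x n k \<omega>))) (MP_law c)"
proof -
  define t where "t = (\<lambda>j. 1 + 1 / real (Suc j))"
  define s where "s = (\<lambda>j. \<integral>z. 1 / (z + t j) \<partial>MP_law c)"
  have t: "t j > 0" for j by (simp add: t_def add_pos_nonneg)
  have "AE \<omega> in M. \<forall>j. (\<lambda>n. stieltjes (t j) n \<omega>) \<longlonglongrightarrow> s j"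
    unfolding AE_all_countable
  proof
    fix j
    have "t j * s j + s j / (1 + c * s j) = 1"
      using MP_law_stieltjes_equation[OF c_pos t[of j]] by (simp add: s_def Let_def)
    then show "AE \<omega> in M. (\<lambda>n. stieltjes (t j) n \<omega>) \<longlonglongrightarrow> s j"
      using MP_law_stieltjes_nonneg[OF c_pos t[of j]] by (intro stieltjes_AE_lim[OF t]) (simp_all add: s_def)
  qed
  then show ?thesis
  proof eventually_elim
    case (elim \<omega>)
    define \<mu> where "\<mu> = (\<lambda>n. ESD (sample_cov n (d n) (m (dimn n)) (\<lambda>k. x n k \<omega>)))"
    \<comment> \<open>An \<open>n\<close> that is not good may have dimension 0, where
      \<open>ESD\<close> is not a probability measure; a point mass stands in, and eventually the
      two sequences agree.\<close>
    define \<mu>' where "\<mu>' = (\<lambda>n. if good n then \<mu> n else return borel 0)"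
    have pp: "n choose d n > 0" if "good n" for n
      using dimn_ge[OF that] that less_le_trans[of 0 n] by (simp add: dimn_def good_def del: zero_less_binomial_iff)
    have r0: "real_distribution (return borel (0::real))"
      by (intro real_distribution.intro prob_space_return) (auto simp: real_distribution_axioms_def)
    have "weak_conv_m \<mu>' (MP_law c)"
    proof (rule weak_conv_of_stieltjes)
      show "real_distribution (\<mu>' n)" for n
        using ESD_sample_cov(1)[OF pp[of n], of "1::real"] r0 by (cases "good n") (simp_all add: \<mu>'_def \<mu>_def)
      show "AE z in \<mu>' n. z \<ge> 0" for n
        unfolding \<mu>'_def \<mu>_def
        using ESD_sample_cov(2)[OF pp[of n], of "1::real"] by (cases "good n") (simp_all add: AE_return)
      show "real_distribution (MP_law c)" "AE z in MP_law c. z \<ge> 0"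
        using real_distribution_MP_law[OF c_pos] AE_MP_law_nonneg[OF c_pos] by auto
      fix j
      have "\<forall>\<^sub>F n in sequentially. stieltjes (t j) n \<omega> = (\<integral>z. 1 / (z + t j) \<partial>\<mu>' n)"
        using eventually_good
      proof eventually_elim
        case (elim n)
        show ?case
          using ESD_sample_cov(3)[OF pp[OF elim] t[of j]] elim
          by (simp add: stieltjes_def \<mu>'_def \<mu>_def dimn_def)
      qed
      with elim have "(\<lambda>n. \<integral>z. 1 / (z + t j) \<partial>\<mu>' n) \<longlonglongrightarrow> s j"
        by (blast intro: Lim_transform_eventually)
      then show "(\<lambda>n. \<integral>z. 1 / (z + (1 + 1 / real (Suc j))) \<partial>\<mu>' n)
          \<longlonglongrightarrow> (\<integral>z. 1 / (z + (1 + 1 / real (Suc j))) \<partial>MP_law c)"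
        unfolding s_def t_def .
    qed
    moreover have "\<forall>\<^sub>F n in sequentially. \<mu>' n = \<mu> n"
      using eventually_good by eventually_elim (simp add: \<mu>'_def)
    ultimately have "weak_conv_m \<mu> (MP_law c)"
      unfolding weak_conv_m_def weak_conv_def
    proof (intro allI impI)
      fix y
      assume W: "\<forall>y. isCont (cdf (MP_law c)) y \<longrightarrow> (\<lambda>n. cdf (\<mu>' n) y) \<longlonglongrightarrow> cdf (MP_law c) y"
        and ev: "\<forall>\<^sub>F n in sequentially. \<mu>' n = \<mu> n" and y: "isCont (cdf (MP_law c)) y"
      show "(\<lambda>n. cdf (\<mu> n) y) \<longlonglongrightarrow> cdf (MP_law c) y"
        by (rule Lim_transform_eventually[OF W[rule_format, OF y]]) (use ev in \<open>auto elim: eventually_mono\<close>)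
    qed
    then show ?case by (simp add: \<mu>_def dimn_def)
  qed
qed

end

theorem theorem2p4:
  fixes d m :: "nat \<Rightarrow> nat"
    and N :: "nat \<Rightarrow> 'b measure"
    and X :: "nat \<Rightarrow> nat \<Rightarrow> 'b \<Rightarrow> real"
    and c :: real
    and M :: "'a measure"
    and x :: "nat \<Rightarrow> nat \<Rightarrow> 'a \<Rightarrow> nat set \<Rightarrow> real"
  assumes d_pos: "\<And>n. n \<ge> 1 \<Longrightarrow> d n \<ge> 1"
    and d_small: "(\<lambda>n. real (d n)) \<in> o(\<lambda>n. sqrt (real n))"
    and X_rv: "\<And>n. n \<ge> 1 \<Longrightarrow> random_vector (N n) n (X n)"
    and X_exch: "\<And>n. n \<ge> 1 \<Longrightarrow> exchangeable (N n) n (X n)"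
    and X_uncond: "\<And>n. n \<ge> 1 \<Longrightarrow> unconditional (N n) n (X n)"
    and c_pos: "c > 0"
    and aspect: "(\<lambda>n. real (n choose d n) / real (m (n choose d n))) \<longlonglongrightarrow> c"
    and M_prob: "prob_space M"
    and x_indep: "\<And>n. n \<ge> 1 \<Longrightarrow>
      prob_space.indep_vars M (\<lambda>_. tensor_space n (d n)) (x n) {1..m (n choose d n)}"
    and x_law: "\<And>n k. n \<ge> 1 \<Longrightarrow> k \<in> {1..m (n choose d n)} \<Longrightarrow>
      distr M (tensor_space n (d n)) (x n k) = PrincipalT (N n) n (d n) (X n)"
    and i: "\<And>n. n \<ge> 1 \<Longrightarrow> (\<integral>\<omega>. (X n 1 \<omega>)\<^sup>2 \<partial>N n) = 1"
    and ii: "(\<lambda>n. 1 / real n ^ (4 * d n) *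
      (\<integral>\<omega>. lnorm 2 n (\<lambda>i. X n i \<omega>) ^ (8 * d n) \<partial>N n)) \<longlonglongrightarrow> 1"
    and iii_or_iii':
      "(\<exists>L :: nat \<Rightarrow> real. (\<lambda>n. L n * real (d n) ^ 2 / real n) \<longlonglongrightarrow> 0 \<and>
          (\<forall>n\<ge>1. \<forall>r. 1 \<le> r \<and> r \<le> d n \<and> r \<le> n \<longrightarrow>
             integrable (N n) (\<lambda>\<omega>. \<Prod>j=1..r. X n j \<omega> ^ 8) \<and>
             (\<integral>\<omega>. (\<Prod>j=1..r. X n j \<omega> ^ 8) \<partial>N n) \<le> L n ^ (2 * r)))
       \<or> (\<exists>L :: nat \<Rightarrow> real. (\<lambda>n. L n * real (d n) ^ 2 / real n) \<longlonglongrightarrow> 0 \<and>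
          (\<forall>n\<ge>1. \<forall>r. 1 \<le> r \<and> r \<le> d n \<longrightarrow>
             integrable (N n) (\<lambda>\<omega>. lnorm 4 n (\<lambda>i. X n i \<omega>) ^ (8 * r)) \<and>
             1 / real n ^ (2 * r) * (\<integral>\<omega>. lnorm 4 n (\<lambda>i. X n i \<omega>) ^ (8 * r) \<partial>N n)
               \<le> L n ^ (2 * r)))"
  shows "(\<exists>L' :: nat \<Rightarrow> real. (\<lambda>n. L' n * real (d n) ^ 2 / real n) \<longlonglongrightarrow> 0 \<and>
      (\<lambda>n. \<integral>\<omega>. (\<Prod>j=1..d n. (X n j \<omega>)\<^sup>2) \<partial>N n) \<longlonglongrightarrow> 1 \<and>
      (\<lambda>n. (\<integral>\<omega>. (\<Prod>j=1..2 * d n. (X n j \<omega>)\<^sup>2) \<partial>N n)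
            - (\<integral>\<omega>. (\<Prod>j=1..d n. (X n j \<omega>)\<^sup>2) \<partial>N n)\<^sup>2) \<longlonglongrightarrow> 0 \<and>
      (\<forall>\<^sub>F n in sequentially. \<forall>r. 1 \<le> r \<and> r \<le> d n \<longrightarrow>
         integrable (N n)
           (\<lambda>\<omega>. (\<Prod>j=1..r. X n j \<omega> ^ 4) * (\<Prod>j=r+1..2 * d n - r. (X n j \<omega>)\<^sup>2)) \<and>
         (\<integral>\<omega>. (\<Prod>j=1..r. X n j \<omega> ^ 4) * (\<Prod>j=r+1..2 * d n - r. (X n j \<omega>)\<^sup>2) \<partial>N n)
           \<le> L' n ^ r))
    \<and> (AE \<omega> in M. weak_conv_m
          (\<lambda>n. ESD (sample_cov n (d n) (m (n choose d n)) (\<lambda>k. x n k \<omega>))) (MP_law c))"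
proof -
  obtain L :: "nat \<Rightarrow> real" where L_lim: "(\<lambda>n. L n * real (d n) ^ 2 / real n) \<longlonglongrightarrow> 0"
    and L: "(\<forall>n\<ge>1. \<forall>r. 1 \<le> r \<and> r \<le> d n \<and> r \<le> n \<longrightarrow>
             integrable (N n) (\<lambda>\<omega>. \<Prod>j=1..r. X n j \<omega> ^ 8) \<and>
             (\<integral>\<omega>. (\<Prod>j=1..r. X n j \<omega> ^ 8) \<partial>N n) \<le> L n ^ (2 * r))
       \<or> (\<forall>n\<ge>1. \<forall>r. 1 \<le> r \<and> r \<le> d n \<longrightarrow>
             integrable (N n) (\<lambda>\<omega>. lnorm 4 n (\<lambda>i. X n i \<omega>) ^ (8 * r)) \<and>
             1 / real n ^ (2 * r) * (\<integral>\<omega>. lnorm 4 n (\<lambda>i. X n i \<omega>) ^ (8 * r) \<partial>N n)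
               \<le> L n ^ (2 * r))"
    using iii_or_iii' by (elim disjE exE conjE) blast+
  \<comment> \<open>Only even powers of \<open>L\<close> are bounded by hypothesis, so
    \<open>|L|\<close> serves equally well; its nonnegativity is used for
    \<open>sqrt (L ^ (2 * r)) = L ^ r\<close>.\<close>
  have abs_lim: "(\<lambda>n. \<bar>L n\<bar> * real (d n) ^ 2 / real n) \<longlonglongrightarrow> 0"
    using tendsto_rabs_zero[OF L_lim] by (simp add: abs_mult)
  interpret mp_setting d m N X c M x "\<lambda>n. \<bar>L n\<bar>"
    using L abs_lim
    by (intro mp_setting.intro assms(1-12)) (simp_all add: power_even_abs)
  have "(\<lambda>n. 8 * (\<bar>L n\<bar> * real (d n) ^ 2 / real n)) \<longlonglongrightarrow> 8 * 0"
    by (intro tendsto_intros abs_lim)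
  then have "(\<lambda>n. 8 * \<bar>L n\<bar> * real (d n) ^ 2 / real n) \<longlonglongrightarrow> 0"
    by (simp add: mult.assoc)
  then show ?thesis
    using moment_conclusions mixed_conclusion ESD_AE_weak_conv
    by (intro conjI exI[where x = "\<lambda>n. 8 * \<bar>L n\<bar>"]) assumption+
qed

end
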